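(* Let $g\in L^2(\Omega)$, $\alpha>0$, $g_h:=\Pi_hg$, and let $\varepsilon_h\in\mathcal{L}^0(\mathcal{T}_h)$ with $0<\varepsilon_h<1$ a.e. in $\Omega$. Define $$I^{cr}_{h,\varepsilon_h}(v_h):=\|f_{\varepsilon_h}(|\nabla_hv_h|)\|_{L^1(\Omega)}+\tfrac{\alpha}{2}\|\Pi_hv_h-g_h\|^2_{L^2(\Omega)},\qquad v_h\in\mathcal{S}^{1,cr}(\mathcal{T}_h),$$ $$D^{rt}_{h,\varepsilon_h}(y_h):=-\int_\Omega f_{\varepsilon_h}^*(|\Pi_hy_h|)\,\mathrm{d}x-\tfrac{1}{2\alpha}\|\mathrm{div}\,y_h+\alpha g_h\|^2_{L^2(\Omega)}+\tfrac{\alpha}{2}\|g_h\|^2_{L^2(\Omega)},\qquad y_h\in\mathcal{R}T^0_N(\mathcal{T}_h),$$ and let $u_{h,\varepsilon_h}^{cr}\in\mathcal{S}^{1,cr}(\mathcal{T}_h)$ be the unique minimizer of $I^{cr}_{h,\varepsilon_h}$. Then: (i) A discrete weak duality relation applies, i.e., $$\inf_{v_h\in\mathcal{S}^{1,cr}(\mathcal{T}_h)}I^{cr}_{h,\varepsilon_h}(v_h)\ge\sup_{y_h\in\mathcal{R}T^0_N(\mathcal{T}_h)}D^{rt}_{h,\varepsilon_h}(y_h).$$ (ii) The discrete flux $z_{h,\varepsilon_h}^{rt}\in\mathcal{L}^1(\mathcal{T}_h)^d$ defined by $$z_{h,\varepsilon_h}^{rt}:=\frac{f_{\varepsilon_h}'(|\nabla_hu_{h,\varepsilon_h}^{cr}|)}{|\nabla_hu_{h,\varepsilon_h}^{cr}|}\nabla_hu_{h,\varepsilon_h}^{cr}+\alpha\,\frac{\Pi_hu_{h,\varepsilon_h}^{cr}-g_h}{d}\big(\mathrm{id}_{\mathbb{R}^d}-\Pi_h\mathrm{id}_{\mathbb{R}^d}\big)$$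 satisfies $z_{h,\varepsilon_h}^{rt}\in\mathcal{R}T^0_N(\mathcal{T}_h)$ and $$\mathrm{div}\,z_{h,\varepsilon_h}^{rt}=\alpha(\Pi_hu_{h,\varepsilon_h}^{cr}-g_h)\ \text{ in }\mathcal{L}^0(\mathcal{T}_h),\qquad \Pi_hz_{h,\varepsilon_h}^{rt}=\frac{f_{\varepsilon_h}'(|\nabla_hu_{h,\varepsilon_h}^{cr}|)}{|\nabla_hu_{h,\varepsilon_h}^{cr}|}\nabla_hu_{h,\varepsilon_h}^{cr}\ \text{ in }\mathcal{L}^0(\mathcal{T}_h)^d.$$ (iii) $z_{h,\varepsilon_h}^{rt}\in\mathcal{R}T^0_N(\mathcal{T}_h)$ is a maximizer of $D^{rt}_{h,\varepsilon_h}$ and discrete strong duality applies, i.e., $I^{cr}_{h,\varepsilon_h}(u_{h,\varepsilon_h}^{cr})=D^{rt}_{h,\varepsilon_h}(z_{h,\varepsilon_h}^{rt})$.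
   Context: $\Omega\subseteq\mathbb{R}^d$, $d\in\mathbb{N}$, is a bounded polyhedral Lipschitz domain, with $\Gamma_D=\emptyset$ and $\Gamma_N=\partial\Omega$; $\mathcal{T}_h$ is a conforming simplicial triangulation of $\Omega$. For $k\ge0$, $\mathcal{L}^k(\mathcal{T}_h)$ denotes the element-wise polynomial functions of degree at most $k$ (no continuity required). $\Pi_h$ is the $L^2$-projection onto element-wise constant functions or vector fields; $\nabla_h$ is the element-wise gradient; $\mathrm{id}_{\mathbb{R}^d}$ is the identity map $x\mapsto x$. $\mathcal{S}^{1,cr}(\mathcal{T}_h)$ (Crouzeix–Raviart space) is the set of $v_h\in\mathcal{L}^1(\mathcal{T}_h)$ continuous at the barycenters of all interior sides. $\mathcal{R}T^0(\mathcal{T}_h)$ (Raviart–Thomas space) is the set of $y_h\in\mathcal{L}^1(\mathcal{T}_h)^d$ whose normal component is constant on each side of each element and continuous across interior sides (with, as usual for lowest order, $y_h|_T(x)=a_T+b_Tx$, $a_T\in\mathbb{R}^d$, $b_T\in\mathbb{R}$); $\mathcal{R}T^0_N(\mathcal{T}_h)$ is the subset with $y_h\cdot n=0$ on $\partial\Omega$. For $\varepsilon\in(0,1)$, $f_\varepsilon:\mathbb{R}\to\mathbb{R}_{\ge0}$ is $f_\varepsilon(t):=(1-\varepsilon)(t^2+\varepsilon^2)^{1/2}$, $f_\varepsilon'$ is its derivative, and $f_\varepsilon^*$ its Fenchel conjugate; $f_{\varepsilon_h}$, $f_{\varepsilon_h}'$ and $f_{\varepsilon_h}^*$ are understood element-wise,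 with $\varepsilon=\varepsilon_h|_T$ on $T\in\mathcal{T}_h$. The quotient $f_\varepsilon'(t)/t=(1-\varepsilon)(t^2+\varepsilon^2)^{-1/2}$ is extended continuously to $t=0$. *)

theory Defs
  imports "HOL-Analysis.Analysis"
begin

section \<open>Domain and triangulation\<close>

text \<open>Near every boundary point, \<open>\<Omega>\<close> is the strict supergraph of a Lipschitz function over the
  hyperplane orthogonal to some unit vector \<open>\<nu>\<close>. The function \<open>\<phi>\<close> is only ever evaluated on that
  hyperplane.\<close>

definition Lipschitz_boundary :: "'a::euclidean_space set \<Rightarrow> bool" where
  "Lipschitz_boundary \<Omega> \<longleftrightarrow>
    (\<forall>p\<in>frontier \<Omega>. \<exists>U \<nu> L (\<phi> :: 'a \<Rightarrow> real).
       open U \<and> p \<in> U \<and> norm \<nu> = 1 \<and> L-lipschitz_on UNIV \<phi> \<and>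
       \<Omega> \<inter> U = {x \<in> U. \<phi> (x - (x \<bullet> \<nu>) *\<^sub>R \<nu>) < x \<bullet> \<nu>})"

definition polyhedral_Lipschitz_domain :: "'a::euclidean_space set \<Rightarrow> bool" where
  "polyhedral_Lipschitz_domain \<Omega> \<longleftrightarrow>
    \<Omega> \<noteq> {} \<and> open \<Omega> \<and> connected \<Omega> \<and> bounded \<Omega> \<and> Lipschitz_boundary \<Omega> \<and>
    (\<exists>\<P>. finite \<P> \<and> (\<forall>P\<in>\<P>. polytope P) \<and> closure \<Omega> = \<Union>\<P>)"

text \<open>Elements are closed nondegenerate simplices. Conformity, i.e. that two elements meet in a
  common face, is part of \<^const>\<open>triangulation\<close>. The sides of an element are its facets.\<close>

definition conforming_triangulation :: "'a::euclidean_space set \<Rightarrow> 'a set set \<Rightarrow> bool" where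
  "conforming_triangulation \<Omega> \<T> \<longleftrightarrow>
    triangulation \<T> \<and> (\<forall>T\<in>\<T>. int DIM('a) simplex T) \<and> \<Union>\<T> = closure \<Omega>"

text \<open>The arithmetic mean of the vertices, for a simplex \<open>S\<close>.\<close>

definition barycenter :: "'a::euclidean_space set \<Rightarrow> 'a" where
  "barycenter S = (\<Sum>v | v extreme_point_of S. v) /\<^sub>R real (card {v. v extreme_point_of S})"

definition unit_normal :: "'a::euclidean_space set \<Rightarrow> 'a \<Rightarrow> bool" where
  "unit_normal S n \<longleftrightarrow> norm n = 1 \<and> (\<forall>x\<in>S. \<forall>y\<in>S. (x - y) \<bullet> n = 0)"


section \<open>Element-wise polynomial functions\<close>

text \<open>The index \<open>m\<close> ranges over the multi-indices of order at most \<open>k\<close>.\<close>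

definition polynomials_upto :: "nat \<Rightarrow> ('a::euclidean_space \<Rightarrow> real) set" where
  "polynomials_upto k = {p. \<exists>c :: ('a \<Rightarrow> nat) \<Rightarrow> real. \<forall>x.
     p x = (\<Sum>m | m \<in> Basis \<rightarrow>\<^sub>E {..k} \<and> sum m Basis \<le> k. c m * (\<Prod>b\<in>Basis. (x \<bullet> b) ^ m b))}"

text \<open>Element-wise functions are determined only up to their values on the skeleton, a Lebesgue null
  set on which representatives are left arbitrary. Taking the codomain to be \<^typ>\<open>real\<close> gives
  \<open>\<L>\<^sup>k\<close>, taking it to be the space itself gives \<open>(\<L>\<^sup>k)\<^sup>d\<close>.\<close>

definition pw_poly :: "nat \<Rightarrow> 'a::euclidean_space set set \<Rightarrow> ('a \<Rightarrow> 'b::euclidean_space) set" where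
  "pw_poly k \<T> = {v. \<forall>T\<in>\<T>. \<forall>b\<in>Basis. \<exists>p\<in>polynomials_upto k. \<forall>x\<in>interior T. v x \<bullet> b = p x}"

definition pw_eq :: "'a::euclidean_space set set \<Rightarrow> ('a \<Rightarrow> 'b) \<Rightarrow> ('a \<Rightarrow> 'b) \<Rightarrow> bool" where
  "pw_eq \<T> v w \<longleftrightarrow> (\<forall>T\<in>\<T>. \<forall>x\<in>interior T. v x = w x)"

text \<open>The value at a point of the closed element \<open>T\<close> of the restriction of \<open>v\<close> to \<open>T\<close>.\<close>

definition trace_from :: "'a::euclidean_space set \<Rightarrow> ('a \<Rightarrow> 'b::t2_space) \<Rightarrow> 'a \<Rightarrow> 'b" where
  "trace_from T v x = Lim (at x within interior T) v"

definition grad_h :: "'a::euclidean_space set set \<Rightarrow> ('a \<Rightarrow> real) \<Rightarrow> 'a \<Rightarrow> 'a" where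
  "grad_h \<T> v x = (if x \<in> (\<Union>T\<in>\<T>. interior T) then (THE D. GDERIV v x :> D) else 0)"

text \<open>For Raviart--Thomas fields the distributional divergence is the element-wise one.\<close>

definition div_h :: "'a::euclidean_space set set \<Rightarrow> ('a \<Rightarrow> 'a) \<Rightarrow> 'a \<Rightarrow> real" where
  "div_h \<T> y x = (if x \<in> (\<Union>T\<in>\<T>. interior T)
     then (\<Sum>b\<in>Basis. frechet_derivative y (at x) b \<bullet> b) else 0)"

text \<open>The \<open>L\<^sup>2\<close>-orthogonal projection onto element-wise constant functions; the choice operator only
  selects the values on the skeleton.\<close>

definition L2_proj ::
    "'a::euclidean_space set \<Rightarrow> 'a set set \<Rightarrow> ('a \<Rightarrow> 'b::euclidean_space) \<Rightarrow> 'a \<Rightarrow> 'b" where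
  "L2_proj \<Omega> \<T> w = (SOME p. p \<in> pw_poly 0 \<T> \<and>
     (\<forall>q\<in>pw_poly 0 \<T>. (LINT x:\<Omega>|lebesgue. (w x - p x) \<bullet> q x) = 0))"


section \<open>Crouzeix--Raviart and Raviart--Thomas spaces\<close>

text \<open>Interior sides are the common facets of two distinct elements; for \<open>T = T'\<close> the conditions
  below are trivial.\<close>

definition CR :: "'a::euclidean_space set set \<Rightarrow> ('a \<Rightarrow> real) set" where
  "CR \<T> = {v \<in> pw_poly 1 \<T>. \<forall>T\<in>\<T>. \<forall>T'\<in>\<T>. \<forall>S. S facet_of T \<and> S facet_of T' \<longrightarrow>
     trace_from T v (barycenter S) = trace_from T' v (barycenter S)}"

definition RT :: "'a::euclidean_space set set \<Rightarrow> ('a \<Rightarrow> 'a) set" where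
  "RT \<T> = {y \<in> pw_poly 1 \<T>.
     (\<forall>T\<in>\<T>. \<exists>a (b::real). \<forall>x\<in>interior T. y x = a + b *\<^sub>R x) \<and>
     (\<forall>T\<in>\<T>. \<forall>S n. S facet_of T \<and> unit_normal S n \<longrightarrow>
        (\<exists>c. \<forall>x\<in>S. trace_from T y x \<bullet> n = c)) \<and>
     (\<forall>T\<in>\<T>. \<forall>T'\<in>\<T>. \<forall>S n. S facet_of T \<and> S facet_of T' \<and> unit_normal S n \<longrightarrow>
        (\<forall>x\<in>S. trace_from T y x \<bullet> n = trace_from T' y x \<bullet> n))}"

definition RT_N :: "'a::euclidean_space set \<Rightarrow> 'a set set \<Rightarrow> ('a \<Rightarrow> 'a) set" where
  "RT_N \<Omega> \<T> = {y \<in> RT \<T>. \<forall>T\<in>\<T>. \<forall>S n. S facet_of T \<and> S \<subseteq> frontier \<Omega> \<and> unit_normal S n \<longrightarrow>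
     (\<forall>x\<in>S. trace_from T y x \<bullet> n = 0)}"


section \<open>Regularized modulus and the two functionals\<close>

definition f_reg :: "real \<Rightarrow> real \<Rightarrow> real" where
  "f_reg \<epsilon> t = (1 - \<epsilon>) * sqrt (t\<^sup>2 + \<epsilon>\<^sup>2)"

definition fenchel_conjugate :: "(real \<Rightarrow> real) \<Rightarrow> real \<Rightarrow> ereal" where
  "fenchel_conjugate f s = (SUP t. ereal (s * t - f t))"

text \<open>The quotient \<open>f\<^sub>\<epsilon>'(t) / t\<close>, extended continuously to \<open>t = 0\<close>.\<close>

definition f_reg_quot :: "real \<Rightarrow> real \<Rightarrow> real" where
  "f_reg_quot \<epsilon> t = (if t = 0 then Lim (at 0) (\<lambda>s. deriv (f_reg \<epsilon>) s / s)
                     else deriv (f_reg \<epsilon>) t / t)"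

definition in_L2 :: "'a::euclidean_space set \<Rightarrow> ('a \<Rightarrow> real) \<Rightarrow> bool" where
  "in_L2 \<Omega> g \<longleftrightarrow> set_borel_measurable lebesgue \<Omega> g \<and> set_integrable lebesgue \<Omega> (\<lambda>x. (g x)\<^sup>2)"

definition L1_norm :: "'a::euclidean_space set \<Rightarrow> ('a \<Rightarrow> real) \<Rightarrow> real" where
  "L1_norm \<Omega> f = (LINT x:\<Omega>|lebesgue. \<bar>f x\<bar>)"

definition L2_norm :: "'a::euclidean_space set \<Rightarrow> ('a \<Rightarrow> real) \<Rightarrow> real" where
  "L2_norm \<Omega> f = sqrt (LINT x:\<Omega>|lebesgue. (f x)\<^sup>2)"

text \<open>The Lebesgue integral of an extended-real-valued function: since \<^const>\<open>e2ennreal\<close> sends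
  negative arguments to \<open>0\<close>, the two terms are the integrals of the positive and negative parts.\<close>

definition ereal_integral :: "'a::euclidean_space set \<Rightarrow> ('a \<Rightarrow> ereal) \<Rightarrow> ereal" where
  "ereal_integral \<Omega> F =
     enn2ereal (\<integral>\<^sup>+x\<in>\<Omega>. e2ennreal (F x) \<partial>lebesgue) - enn2ereal (\<integral>\<^sup>+x\<in>\<Omega>. e2ennreal (- F x) \<partial>lebesgue)"

definition I_cr ::
    "'a::euclidean_space set \<Rightarrow> 'a set set \<Rightarrow> ('a \<Rightarrow> real) \<Rightarrow> real \<Rightarrow> ('a \<Rightarrow> real) \<Rightarrow> ('a \<Rightarrow> real) \<Rightarrow> real"
  where
  "I_cr \<Omega> \<T> \<epsilon> \<alpha> g v =
     L1_norm \<Omega> (\<lambda>x. f_reg (\<epsilon> x) (norm (grad_h \<T> v x)))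
     + \<alpha> / 2 * (L2_norm \<Omega> (\<lambda>x. L2_proj \<Omega> \<T> v x - g x))\<^sup>2"

text \<open>The value is \<open>-\<infinity>\<close> where the conjugate is infinite on some element.\<close>

definition D_rt ::
    "'a::euclidean_space set \<Rightarrow> 'a set set \<Rightarrow> ('a \<Rightarrow> real) \<Rightarrow> real \<Rightarrow> ('a \<Rightarrow> real) \<Rightarrow> ('a \<Rightarrow> 'a) \<Rightarrow> ereal"
  where
  "D_rt \<Omega> \<T> \<epsilon> \<alpha> g y =
     - ereal_integral \<Omega> (\<lambda>x. fenchel_conjugate (f_reg (\<epsilon> x)) (norm (L2_proj \<Omega> \<T> y x)))
     - ereal (1 / (2 * \<alpha>) * (L2_norm \<Omega> (\<lambda>x. div_h \<T> y x + \<alpha> * g x))\<^sup>2)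
     + ereal (\<alpha> / 2 * (L2_norm \<Omega> g)\<^sup>2)"

definition flux ::
    "'a::euclidean_space set \<Rightarrow> 'a set set \<Rightarrow> ('a \<Rightarrow> real) \<Rightarrow> real \<Rightarrow> ('a \<Rightarrow> real) \<Rightarrow> ('a \<Rightarrow> real) \<Rightarrow> 'a \<Rightarrow> 'a"
  where
  "flux \<Omega> \<T> \<epsilon> \<alpha> g u x =
     f_reg_quot (\<epsilon> x) (norm (grad_h \<T> u x)) *\<^sub>R grad_h \<T> u x
     + (\<alpha> * ((L2_proj \<Omega> \<T> u x - g x) / DIM('a))) *\<^sub>R (x - L2_proj \<Omega> \<T> (\<lambda>x. x) x)"

end

theory Submission
  imports Defs
begin

text \<open>Everything reduces to finite sums over the elements. On a simplex \<open>T\<close> with barycentric coordinates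
  \<open>\<lambda>\<^sub>S\<close> (one for each facet \<open>S\<close>), an affine \<open>v\<close> equals the sum of \<open>v (x\<^sub>S) (1 - d \<lambda>\<^sub>S)\<close>, where \<open>x\<^sub>S\<close> is the
  barycenter of \<open>S\<close>, and elementwise integration by parts against a field \<open>a + b x\<close> becomes an algebraic
  identity with the weights \<open>\<bar>T\<bar> \<nabla>\<lambda>\<^sub>S\<close> in place of surface integrals. For two elements sharing \<open>S\<close> these weights
  are opposite, which gives the discrete integration by parts formula. Weak duality is this formula together
  with the Fenchel--Young inequality. The Euler--Lagrange equation of the minimizer, tested with the
  Crouzeix--Raviart basis function of \<open>S\<close>, says that the normal components of the flux on \<open>S\<close> match (or
  vanish, on the boundary); tested with the minimizer itself it gives strong duality.\<close>

section \<open>Linear images and Lebesgue measure\<close>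

text \<open>Only two facts about volumes are needed: the ratio of the volumes of two simplices with
  a common facet, and that the vertex mean of a simplex is its center of mass. Both come from affine
  maps \<open>x + (m \<bullet> (x - a)) *\<^sub>R w\<close>, one carrying a simplex onto its
  neighbour, one exchanging two vertices, so the determinant of a rank-one perturbation of the
  identity is enough. The geometric obstacle is to tell interior facets from boundary facets: the
  spaces speak of \<open>frontier \<Omega>\<close>, the algebra of the number of adjacent elements.
  Opposite weights allow at most two elements per facet, conformity keeps an unshared facet out of
  \<Omega>, and the Lipschitz condition, by excluding slits, lets a shared facet enter \<Omega>. On
  the analytic side, \<epsilon> > 0 makes the primal functional differentiable even where the
  gradient vanishes, while the conjugate may be infinite and forces the dual functional into the
  extended reals.\<close>

lemma emeasure_linear_vimage_commute:
  fixes f g :: "'a::euclidean_space \<Rightarrow> 'a"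
  assumes f: "linear f" and fg: "\<And>x. f (g x) = x"
    and [measurable]: "A \<in> sets borel" "B \<in> sets borel"
  shows "emeasure lborel (f -` A) * emeasure lborel B = emeasure lborel A * emeasure lborel (f -` B)"
proof -
  have cont: "continuous_on UNIV f"
    using f by (simp add: linear_continuous_on linear_conv_bounded_linear)
  have [measurable]: "f \<in> borel_measurable borel"
    using cont by (rule borel_measurable_continuous_onI)
  have shift: "(\<integral>\<^sup>+x. h (x + c) \<partial>lborel) = (\<integral>\<^sup>+x. h x \<partial>lborel)"
    if [measurable]: "h \<in> borel_measurable borel" for h :: "'a \<Rightarrow> ennreal" and c
  proof -
    have "(\<integral>\<^sup>+x. h x \<partial>lborel) = (\<integral>\<^sup>+x. h x \<partial>distr lborel borel ((+) c))"
      by (simp add: lborel_distr_plus)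
    also have "\<dots> = (\<integral>\<^sup>+x. h (c + x) \<partial>lborel)"
      by (rule nn_integral_distr) simp_all
    finally show ?thesis by (simp add: add.commute)
  qed
  have vim: "emeasure lborel (f -` S) = (\<integral>\<^sup>+x. indicator S (f x) \<partial>lborel)" if "S \<in> sets borel" for S
  proof -
    have "f -` S \<in> sets borel"
      using that measurable_sets[of f borel borel S] by simp
    then have "emeasure lborel (f -` S) = (\<integral>\<^sup>+x. indicator (f -` S) x \<partial>lborel)"
      by simp
    then show ?thesis by (simp add: indicator_def)
  qed
  have refl: "(\<integral>\<^sup>+y. indicator A (c - y) \<partial>lborel) = emeasure lborel A" for c :: 'a
  proof -
    have "(\<integral>\<^sup>+y. indicator A y \<partial>lborel)
        = (\<integral>\<^sup>+y. indicator A y \<partial>density (distr lborel borel (\<lambda>x. c + (-1) *\<^sub>R x)) (\<lambda>_. ennreal (\<bar>-1\<bar>^DIM('a))))"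
      using lborel_affine[of "-1" c] by (simp only:)
    also have "\<dots> = (\<integral>\<^sup>+y. indicator A (c - y) \<partial>lborel)"
      by (subst nn_integral_density) (simp_all add: nn_integral_distr del: nn_integral_indicator)
    finally show ?thesis by simp
  qed
  \<comment> \<open>Only Fubini and the invariance of Lebesgue measure under translation and
    reflection enter: \<open>y\<close> is shifted by \<open>f x\<close>, then \<open>x\<close> by
    the preimage \<open>g y\<close>, after which \<open>A\<close> and \<open>B\<close> have
    exchanged roles.\<close>
  have "emeasure lborel (f -` A) * emeasure lborel B
      = (\<integral>\<^sup>+x. indicator A (f x) * (\<integral>\<^sup>+y. indicator B y \<partial>lborel) \<partial>lborel)"
    by (simp add: vim nn_integral_multc)
  also have "\<dots> = (\<integral>\<^sup>+x. indicator A (f x) * (\<integral>\<^sup>+y. indicator B (y + f x) \<partial>lborel) \<partial>lborel)"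
    by (subst shift) simp_all
  also have "\<dots> = (\<integral>\<^sup>+x. (\<integral>\<^sup>+y. indicator A (f x) * indicator B (y + f x) \<partial>lborel) \<partial>lborel)"
    by (simp add: nn_integral_cmult)
  also have "\<dots> = (\<integral>\<^sup>+y. (\<integral>\<^sup>+x. indicator A (f x) * indicator B (y + f x) \<partial>lborel) \<partial>lborel)"
    by (rule lborel_pair.Fubini') measurable
  also have "\<dots> = (\<integral>\<^sup>+y. (\<integral>\<^sup>+x. indicator A (f x - y) * indicator B (f x) \<partial>lborel) \<partial>lborel)"
  proof (rule nn_integral_cong)
    fix y :: 'a
    have e: "indicator A (f x) * indicator B (y + f x)
        = indicator A (f (x + g y) - y) * (indicator B (f (x + g y)) :: ennreal)" for x
      by (simp add: linear_add[OF f] fg add.commute)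
    show "(\<integral>\<^sup>+x. indicator A (f x) * indicator B (y + f x) \<partial>lborel)
        = (\<integral>\<^sup>+x. indicator A (f x - y) * indicator B (f x) \<partial>lborel)"
      unfolding e by (rule shift) measurable
  qed
  also have "\<dots> = (\<integral>\<^sup>+x. (\<integral>\<^sup>+y. indicator A (f x - y) * indicator B (f x) \<partial>lborel) \<partial>lborel)"
    by (rule lborel_pair.Fubini') measurable
  also have "\<dots> = emeasure lborel A * (\<integral>\<^sup>+x. indicator B (f x) \<partial>lborel)"
    by (simp add: nn_integral_multc refl nn_integral_cmult)
  finally show ?thesis by (simp add: vim)
qed

text \<open>Comparison with the unit cube. The value of the constant is left open; what counts is
  that one factor serves all Borel sets, so that it cancels in a conjugation.\<close>

lemma emeasure_linear_vimage_scale: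
  fixes f g :: "'a::euclidean_space \<Rightarrow> 'a"
  assumes f: "linear f" and fg: "\<And>x. f (g x) = x"
  obtains c where "\<And>A. A \<in> sets borel \<Longrightarrow> emeasure lborel (f -` A) = c * emeasure lborel A"
proof
  define B where "B = cbox (0::'a) One"
  have B: "B \<in> sets borel" "emeasure lborel B = 1"
    by (simp_all add: B_def emeasure_lborel_cbox_eq)
  show "emeasure lborel (f -` A) = emeasure lborel (f -` B) * emeasure lborel A" if "A \<in> sets borel" for A
    using emeasure_linear_vimage_commute[OF f fg that B(1)] B(2) by (simp add: mult.commute)
qed

lemma emeasure_vimage_scale_Basis:
  fixes e :: "'a::euclidean_space"
  assumes e: "e \<in> Basis" and s: "s \<noteq> 0" and A: "A \<in> sets borel"
  shows "emeasure lborel A = ennreal \<bar>s\<bar> * emeasure lborel ((\<lambda>x. x + ((s - 1) * (x \<bullet> e)) *\<^sub>R e) -` A)"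
proof -
  define c where "c j = (if j = e then s else 1)" for j :: 'a
  have T: "0 + (\<Sum>j\<in>Basis. (c j * (x \<bullet> j)) *\<^sub>R j) = x + ((s - 1) * (x \<bullet> e)) *\<^sub>R e" for x
  proof -
    have "(\<Sum>j\<in>Basis. (c j * (x \<bullet> j)) *\<^sub>R j)
        = (\<Sum>j\<in>Basis. (x \<bullet> j) *\<^sub>R j + (if j = e then ((s - 1) * (x \<bullet> e)) *\<^sub>R e else 0))"
      by (intro sum.cong) (auto simp: c_def algebra_simps)
    also have "\<dots> = x + ((s - 1) * (x \<bullet> e)) *\<^sub>R e"
      using e by (simp add: sum.distrib euclidean_representation)
    finally show ?thesis by simp
  qed
  have p: "(\<Prod>j\<in>Basis. \<bar>c j\<bar>) = \<bar>s\<bar>"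
  proof -
    have "(\<Prod>j\<in>Basis. \<bar>c j\<bar>) = (\<Prod>j\<in>Basis. if j = e then \<bar>s\<bar> else 1)"
      by (intro prod.cong) (auto simp: c_def)
    then show ?thesis using e by simp
  qed
  let ?T = "\<lambda>x. x + ((s - 1) * (x \<bullet> e)) *\<^sub>R e"
  have "lborel = density (distr lborel borel ?T) (\<lambda>_. ennreal \<bar>s\<bar>)"
    using lborel_affine_euclidean[of c 0, unfolded T p] s by (simp add: c_def)
  then have "emeasure lborel A = emeasure (density (distr lborel borel ?T) (\<lambda>_. ennreal \<bar>s\<bar>)) A"
    by simp
  also have "\<dots> = ennreal \<bar>s\<bar> * emeasure (distr lborel borel ?T) A"
    using A by (simp add: emeasure_density_const)
  also have "emeasure (distr lborel borel ?T) A = emeasure lborel (?T -` A)"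
    using A by (subst emeasure_distr) auto
  finally show ?thesis .
qed

text \<open>The map is diagonalizable, with eigenvalue \<open>1 + m \<bullet> w\<close> along \<open>w\<close> and \<open>1\<close> on the orthogonal
  complement of \<open>m\<close>, hence conjugate to the scaling of one coordinate.\<close>

lemma emeasure_vimage_rank_one:
  fixes m w :: "'a::euclidean_space"
  assumes mw: "m \<bullet> w \<noteq> 0" "1 + m \<bullet> w \<noteq> 0" and A: "A \<in> sets borel"
  shows "emeasure lborel A = ennreal \<bar>1 + m \<bullet> w\<bar> * emeasure lborel ((\<lambda>x. x + (m \<bullet> x) *\<^sub>R w) -` A)"
proof -
  obtain e where e: "e \<in> Basis" and em: "e \<bullet> m \<noteq> 0"
    using mw(1) by (metis euclidean_all_zero_iff inner_commute inner_zero_left)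
  define s where "s = 1 + m \<bullet> w"
  define f where "f x = x + (m \<bullet> x) *\<^sub>R w" for x
  define R where "R x = x + ((s - 1) * (x \<bullet> e)) *\<^sub>R e" for x
  \<comment> \<open>\<open>G\<close> sends \<open>e\<close> to \<open>w\<close> and the orthogonal
    complement of \<open>e\<close> into that of \<open>m\<close>, correcting along \<open>e\<close>,
    which \<open>em\<close> makes possible. \<open>H\<close> is its inverse, built from the
    projection \<open>r\<close> along \<open>w\<close> onto the complement of
    \<open>m\<close>.\<close>
  define G where "G x = (x \<bullet> e) *\<^sub>R w + ((x - (x \<bullet> e) *\<^sub>R e) - (((x - (x \<bullet> e) *\<^sub>R e) \<bullet> m) / (e \<bullet> m)) *\<^sub>R e)" for x
  define r where "r x = x - ((x \<bullet> m) / (w \<bullet> m)) *\<^sub>R w" for x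
  define H where "H x = ((x \<bullet> m) / (w \<bullet> m)) *\<^sub>R e + (r x - (r x \<bullet> e) *\<^sub>R e)" for x
  have wm: "w \<bullet> m \<noteq> 0" using mw by (simp add: inner_commute)
  have ee: "e \<bullet> e = 1" using e by simp
  have linG: "linear G"
    unfolding G_def by (rule linearI) (simp_all add: algebra_simps inner_simps add_divide_distrib diff_divide_distrib)
  have linH: "linear H"
    unfolding H_def r_def by (rule linearI) (simp_all add: algebra_simps inner_simps add_divide_distrib diff_divide_distrib)
  have GH: "G (H x) = x" for x
  proof -
    have rm: "r x \<bullet> m = 0" using wm by (simp add: r_def inner_simps)
    have He: "H x \<bullet> e = (x \<bullet> m) / (w \<bullet> m)"
      using ee by (simp add: H_def inner_simps)
    have z: "H x - (H x \<bullet> e) *\<^sub>R e = r x - (r x \<bullet> e) *\<^sub>R e"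
      unfolding He by (simp add: H_def)
    define Z where "Z = r x - (r x \<bullet> e) *\<^sub>R e"
    have "G (H x) = (H x \<bullet> e) *\<^sub>R w + (Z - ((Z \<bullet> m) / (e \<bullet> m)) *\<^sub>R e)"
      by (simp only: G_def z Z_def)
    moreover have "Z \<bullet> m = - (r x \<bullet> e) * (e \<bullet> m)"
      using rm by (simp add: Z_def inner_simps)
    ultimately have "G (H x) = ((x \<bullet> m) / (w \<bullet> m)) *\<^sub>R w + r x"
      using em by (simp add: He Z_def)
    then show ?thesis by (simp add: r_def)
  qed
  have HG: "H (G x) = x" for x
  proof -
    define z where "z = x - (x \<bullet> e) *\<^sub>R e"
    define y where "y = z - ((z \<bullet> m) / (e \<bullet> m)) *\<^sub>R e"
    have G: "G x = (x \<bullet> e) *\<^sub>R w + y" by (simp add: G_def y_def z_def)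
    have ym: "y \<bullet> m = 0" using em by (simp add: y_def inner_simps)
    have Gm: "G x \<bullet> m = (x \<bullet> e) * (w \<bullet> m)" by (simp add: G inner_simps ym)
    have rG: "r (G x) = y" using wm by (simp add: r_def Gm) (simp add: G)
    have ze: "z \<bullet> e = 0" using ee by (simp add: z_def inner_simps)
    have "y - (y \<bullet> e) *\<^sub>R e = z" using ee ze by (simp add: y_def inner_simps algebra_simps)
    then have "H (G x) = (x \<bullet> e) *\<^sub>R e + z" using wm by (simp add: H_def rG Gm)
    then show ?thesis by (simp add: z_def)
  qed
  have fG: "f (G x) = G (R x)" for x
  proof -
    have mG: "m \<bullet> G x = (x \<bullet> e) * (m \<bullet> w)"
      using em by (simp add: G_def inner_simps inner_commute[of m])
    have Ge: "G e = w" using ee by (simp add: G_def)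
    have "G (R x) = G x + ((s - 1) * (x \<bullet> e)) *\<^sub>R G e"
      by (simp add: R_def linear_add[OF linG] linear_scale[OF linG])
    then show ?thesis by (simp add: f_def mG Ge s_def mult.commute)
  qed
  obtain cG where cG: "\<And>A. A \<in> sets borel \<Longrightarrow> emeasure lborel (G -` A) = cG * emeasure lborel A"
    using emeasure_linear_vimage_scale[OF linG GH] by metis
  obtain cH where cH: "\<And>A. A \<in> sets borel \<Longrightarrow> emeasure lborel (H -` A) = cH * emeasure lborel A"
    using emeasure_linear_vimage_scale[OF linH HG] by metis
  have meas: "k -` S \<in> sets borel" if "linear k" "S \<in> sets borel" for k :: "'a \<Rightarrow> 'a" and S
  proof -
    have "k \<in> borel_measurable borel"
      using that(1) by (intro borel_measurable_continuous_onI) (simp add: linear_continuous_on linear_conv_bounded_linear)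
    from measurable_sets[OF this that(2)] show ?thesis by simp
  qed
  have linR: "linear R"
    unfolding R_def by (rule linearI) (simp_all add: algebra_simps inner_simps)
  have GA: "G -` A \<in> sets borel" by (rule meas[OF linG A])
  have vim: "f -` A = H -` (R -` (G -` A))"
  proof -
    have "f x = G (R (H x))" for x using fG[of "H x"] by (simp add: GH)
    then show ?thesis by auto
  qed
  \<comment> \<open>The factor \<open>cH\<close> is taken out and put back in, so it needs no
    evaluation.\<close>
  have "ennreal \<bar>s\<bar> * emeasure lborel (f -` A) = cH * (ennreal \<bar>s\<bar> * emeasure lborel (R -` (G -` A)))"
    unfolding vim by (simp add: cH[OF meas[OF linR GA]] mult_ac)
  also have "\<dots> = cH * emeasure lborel (G -` A)"
    using emeasure_vimage_scale_Basis[OF e _ GA, of s] mw(2) by (simp add: R_def[abs_def] s_def)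
  also have "\<dots> = emeasure lborel (H -` (G -` A))"
    by (simp add: cH[OF GA])
  also have "H -` (G -` A) = A"
    by (auto simp: GH)
  finally show ?thesis by (simp add: f_def s_def)
qed

text \<open>Conjugation with the translation by \<open>a\<close>. Such a map fixes the hyperplane
  through \<open>a\<close> orthogonal to \<open>m\<close>; later this is the hyperplane of the
  common facet of two simplices.\<close>

lemma emeasure_vimage_affine_rank_one:
  fixes m w a :: "'a::euclidean_space"
  assumes mw: "m \<bullet> w \<noteq> 0" "1 + m \<bullet> w \<noteq> 0" and A: "A \<in> sets borel"
  shows "emeasure lborel A = ennreal \<bar>1 + m \<bullet> w\<bar> * emeasure lborel ((\<lambda>x. x + (m \<bullet> (x - a)) *\<^sub>R w) -` A)"
proof -
  have tr: "emeasure lborel ((\<lambda>x. c + x) -` S) = emeasure lborel S" if "S \<in> sets borel" for c :: 'a and S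
  proof -
    have "emeasure lborel S = emeasure (distr lborel borel ((+) c)) S"
      by (simp add: lborel_distr_plus)
    also have "\<dots> = emeasure lborel ((\<lambda>x. c + x) -` S)"
      using that by (subst emeasure_distr) auto
    finally show ?thesis by simp
  qed
  have m: "k -` S \<in> sets borel" if "continuous_on UNIV k" "S \<in> sets borel" for k :: "'a \<Rightarrow> 'a" and S
    using measurable_sets[OF borel_measurable_continuous_onI[OF that(1)] that(2)] by simp
  have A1: "(+) a -` A \<in> sets borel" by (intro m A continuous_intros)
  have eq: "(\<lambda>x. x + (m \<bullet> (x - a)) *\<^sub>R w) -` A = (+) (-a) -` ((\<lambda>x. x + (m \<bullet> x) *\<^sub>R w) -` ((+) a -` A))"
    by (auto simp: algebra_simps)
  have A2: "(\<lambda>x. x + (m \<bullet> x) *\<^sub>R w) -` ((+) a -` A) \<in> sets borel"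
    by (intro m A1 continuous_intros)
  show ?thesis
    by (simp only: eq tr[OF A2] tr[OF A] emeasure_vimage_rank_one[OF mw A1, symmetric])
qed


section \<open>Barycentric coordinates and facets\<close>

text \<open>\<open>facet_coord T S\<close> is the barycentric coordinate of the simplex \<open>T\<close> that belongs to the vertex
  opposite to the facet \<open>S\<close>.\<close>

definition facet_grad :: "'a::euclidean_space set \<Rightarrow> 'a set \<Rightarrow> 'a" where
  "facet_grad T S = (SOME m. (\<forall>x\<in>S. m \<bullet> (x - barycenter S) = 0) \<and>
     (\<forall>v. v extreme_point_of T \<and> v \<notin> S \<longrightarrow> m \<bullet> (v - barycenter S) = 1))"

definition facet_coord :: "'a::euclidean_space set \<Rightarrow> 'a set \<Rightarrow> 'a \<Rightarrow> real" where
  "facet_coord T S x = facet_grad T S \<bullet> (x - barycenter S)"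

locale full_simplex =
  fixes C :: "'a::euclidean_space set"
  assumes indep: "\<not> affine_dependent C" and card_C: "card C = Suc DIM('a)"
begin

definition opp :: "'a \<Rightarrow> 'a set" where
  "opp p = convex hull (C - {p})"

definition lam :: "'a \<Rightarrow> 'a \<Rightarrow> real" where
  "lam p = facet_coord (convex hull C) (opp p)"

lemma finite_C [simp]: "finite C"
  using indep aff_independent_finite by blast

lemma affine_combination:
  obtains u where "sum u C = 1" "(\<Sum>v\<in>C. u v *\<^sub>R v) = x"
  using affine_independent_span_eq[OF indep card_C] affine_hull_finite[OF finite_C] by blast

lemma extreme_point_iff: "v extreme_point_of (convex hull C) \<longleftrightarrow> v \<in> C"
  by (rule extreme_point_of_convex_hull_affine_independent[OF indep])

lemma card_minus: "p \<in> C \<Longrightarrow> card (C - {p}) = DIM('a)"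
  using card_C by (simp only: card_Diff_singleton diff_Suc_1)

lemma extreme_point_opp: "v extreme_point_of (opp p) \<longleftrightarrow> v \<in> C - {p}"
  unfolding opp_def by (rule extreme_point_of_convex_hull_affine_independent[OF affine_independent_Diff[OF indep]])

lemma barycenter_simplex: "barycenter (convex hull C) = (\<Sum>q\<in>C. q) /\<^sub>R real (Suc DIM('a))"
  unfolding barycenter_def by (simp add: extreme_point_iff card_C)

lemma barycenter_opp: "p \<in> C \<Longrightarrow> barycenter (opp p) = (\<Sum>q\<in>C - {p}. q) /\<^sub>R real DIM('a)"
proof -
  assume p: "p \<in> C"
  have "{v. v extreme_point_of (opp p)} = C - {p}" using extreme_point_opp by blast
  then show ?thesis unfolding barycenter_def by (simp only: card_minus[OF p])
qed

lemma notin_opp: "p \<in> C \<Longrightarrow> p \<notin> opp p"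
  using indep convex_hull_subset_affine_hull[of "C - {p}"] unfolding opp_def affine_dependent_def by blast

lemma in_opp: "q \<in> C \<Longrightarrow> q \<noteq> p \<Longrightarrow> q \<in> opp p"
  unfolding opp_def by (simp add: hull_inc)

text \<open>The description inside \<open>facet_grad\<close> is satisfiable: the vertices other than
  \<open>p\<close> span a hyperplane that misses \<open>p\<close>, and its normal can be scaled to
  give the value 1 at \<open>p\<close>.\<close>

lemma facet_grad_opp:
  assumes p: "p \<in> C"
  shows "\<And>x. x \<in> opp p \<Longrightarrow> lam p x = 0" "lam p p = 1"
proof -
  have "of_nat (card (C - {p})) = aff_dim (C - {p}) + 1"
    by (rule aff_dim_affine_independent[OF affine_independent_Diff[OF indep]])
  then have "aff_dim (C - {p}) = int (DIM('a) - 1)"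
    unfolding card_minus[OF p] using DIM_positive[where 'a='a] by linarith
  then obtain a b where a: "a \<noteq> 0" and hp: "affine hull (C - {p}) = {x. a \<bullet> x = b}"
    unfolding aff_dim_eq_hyperplane by blast
  have ab: "a \<bullet> p \<noteq> b"
    using indep p hp unfolding affine_dependent_def by blast
  have S: "a \<bullet> x = b" if "x \<in> opp p" for x
    using that convex_hull_subset_affine_hull[of "C - {p}"] hp unfolding opp_def by blast
  have bS: "a \<bullet> barycenter (opp p) = b"
  proof -
    have "a \<bullet> (\<Sum>q\<in>C - {p}. q) = (\<Sum>q\<in>C - {p}. b)"
      unfolding inner_sum_right using S in_opp by (intro sum.cong) auto
    also have "\<dots> = real DIM('a) * b"
      unfolding sum_constant card_minus[OF p] by simp
    finally show ?thesis by (simp add: barycenter_opp[OF p])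
  qed
  let ?P = "\<lambda>m. (\<forall>x\<in>opp p. m \<bullet> (x - barycenter (opp p)) = 0) \<and>
     (\<forall>v. v extreme_point_of (convex hull C) \<and> v \<notin> opp p \<longrightarrow> m \<bullet> (v - barycenter (opp p)) = 1)"
  have "?P ((1 / (a \<bullet> p - b)) *\<^sub>R a)"
  proof (intro conjI ballI allI impI)
    show "((1 / (a \<bullet> p - b)) *\<^sub>R a) \<bullet> (x - barycenter (opp p)) = 0" if "x \<in> opp p" for x
      using S[OF that] bS by (simp add: inner_diff_right)
    show "((1 / (a \<bullet> p - b)) *\<^sub>R a) \<bullet> (v - barycenter (opp p)) = 1"
      if "v extreme_point_of (convex hull C) \<and> v \<notin> opp p" for v
    proof -
      have "v = p" using that in_opp extreme_point_iff by blast
      then show ?thesis using ab bS by (simp add: inner_diff_right flip: diff_divide_distrib)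
    qed
  qed
  then have "?P (facet_grad (convex hull C) (opp p))"
    unfolding facet_grad_def by (rule someI)
  then show "\<And>x. x \<in> opp p \<Longrightarrow> lam p x = 0" "lam p p = 1"
    using p notin_opp unfolding lam_def facet_coord_def by (auto simp: extreme_point_iff)
qed

lemma lam_vertex: "p \<in> C \<Longrightarrow> q \<in> C \<Longrightarrow> lam p q = (if q = p then 1 else 0)"
  by (metis facet_grad_opp in_opp)

lemma lam_affine: "lam p x = lam p 0 + facet_grad (convex hull C) (opp p) \<bullet> x"
  by (simp add: lam_def facet_coord_def inner_diff_right)

lemma lam_sum_scaleR:
  assumes "sum u C = 1"
  shows "lam p (\<Sum>v\<in>C. u v *\<^sub>R v) = (\<Sum>v\<in>C. u v * lam p v)"
proof -
  have "(\<Sum>v\<in>C. u v * lam p v)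
      = (\<Sum>v\<in>C. u v * lam p 0 + u v * (facet_grad (convex hull C) (opp p) \<bullet> v))"
    by (intro sum.cong refl) (metis distrib_left lam_affine)
  also have "\<dots> = lam p 0 + facet_grad (convex hull C) (opp p) \<bullet> (\<Sum>v\<in>C. u v *\<^sub>R v)"
    by (simp add: sum.distrib inner_sum_right assms flip: sum_distrib_right)
  finally show ?thesis by (metis lam_affine)
qed

lemma lam_combination:
  assumes "sum u C = 1" "p \<in> C"
  shows "lam p (\<Sum>v\<in>C. u v *\<^sub>R v) = u p"
proof -
  have "(\<Sum>v\<in>C. u v * lam p v) = (\<Sum>v\<in>C. if v = p then u p else 0)"
    by (intro sum.cong) (auto simp: lam_vertex assms)
  then show ?thesis using assms by (simp add: lam_sum_scaleR)
qed

lemma sum_lam: "(\<Sum>p\<in>C. lam p x) = 1" and sum_lam_scaleR: "(\<Sum>p\<in>C. lam p x *\<^sub>R p) = x"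
proof -
  obtain u where u: "sum u C = 1" "(\<Sum>v\<in>C. u v *\<^sub>R v) = x"
    by (rule affine_combination)
  have "lam p x = u p" if "p \<in> C" for p
    using lam_combination[OF u(1) that] u(2) by simp
  then show "(\<Sum>p\<in>C. lam p x) = 1" "(\<Sum>p\<in>C. lam p x *\<^sub>R p) = x"
    using u by simp_all
qed

lemma mem_simplex_iff: "x \<in> convex hull C \<longleftrightarrow> (\<forall>p\<in>C. 0 \<le> lam p x)"
proof
  assume "x \<in> convex hull C"
  then obtain u where "\<forall>v\<in>C. 0 \<le> u v" "sum u C = 1" "(\<Sum>v\<in>C. u v *\<^sub>R v) = x"
    by (auto simp: convex_hull_finite)
  then show "\<forall>p\<in>C. 0 \<le> lam p x" using lam_combination by auto
next
  assume "\<forall>p\<in>C. 0 \<le> lam p x"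
  then show "x \<in> convex hull C"
    using sum_lam sum_lam_scaleR by (auto simp: convex_hull_finite)
qed

lemma affine_expansion: "k + m \<bullet> x = (\<Sum>p\<in>C. lam p x * (k + m \<bullet> p))"
proof -
  have "k + m \<bullet> x = k * (\<Sum>p\<in>C. lam p x) + m \<bullet> (\<Sum>p\<in>C. lam p x *\<^sub>R p)"
    by (simp add: sum_lam sum_lam_scaleR)
  then show ?thesis
    by (simp add: sum_distrib_left inner_sum_right sum.distrib algebra_simps)
qed

lemma lam_opp_barycenter:
  assumes "p \<in> C" "q \<in> C"
  shows "lam p (barycenter (opp q)) = (if p = q then 0 else 1 / DIM('a))"
proof -
  define u where "u v = (if v = q then 0 else 1 / real DIM('a))" for v
  have "sum u C = sum u (C - {q})"
    using assms by (subst sum.remove[of C q]) (auto simp: u_def)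
  also have "\<dots> = (\<Sum>v\<in>C - {q}. 1 / real DIM('a))" by (intro sum.cong) (auto simp: u_def)
  also have "\<dots> = 1" using card_minus[OF assms(2)] by simp
  finally have u: "sum u C = 1" .
  have "(\<Sum>v\<in>C. u v *\<^sub>R v) = (\<Sum>v\<in>C - {q}. u v *\<^sub>R v)"
    using assms by (subst sum.remove[of C q]) (auto simp: u_def)
  also have "\<dots> = (\<Sum>v\<in>C - {q}. (1 / real DIM('a)) *\<^sub>R v)"
    by (intro sum.cong) (auto simp: u_def)
  also have "\<dots> = barycenter (opp q)"
    using assms by (simp add: barycenter_opp scaleR_sum_right divide_inverse)
  finally have "lam p (barycenter (opp q)) = u p"
    using lam_combination[OF u assms(1)] by simp
  then show ?thesis by (simp add: u_def)
qed

lemma lam_barycenter: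
  assumes "p \<in> C"
  shows "lam p (barycenter (convex hull C)) = 1 / (DIM('a) + 1)"
proof -
  have "(\<Sum>v\<in>C. (1 / real (Suc DIM('a))) *\<^sub>R v) = barycenter (convex hull C)"
    by (simp add: barycenter_simplex scaleR_sum_right divide_inverse)
  moreover have "(\<Sum>v\<in>C. 1 / real (Suc DIM('a))) = 1" by (simp add: card_C)
  ultimately show ?thesis
    using lam_combination[OF _ assms, of "\<lambda>_. 1 / real (Suc DIM('a))"] by (simp only:) simp
qed

lemma opp_inj: "inj_on opp C"
  using in_opp notin_opp by (intro inj_onI) metis

lemma facet_iff: "S facet_of (convex hull C) \<longleftrightarrow> S \<in> opp ` C"
  unfolding facet_of_convex_hull_affine_independent_alt[OF indep] card_C opp_def
  using DIM_ge_Suc0[where 'a='a] by (simp add: image_iff Bex_def)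

lemma CR_expansion:
  "k + m \<bullet> x = (\<Sum>p\<in>C. (k + m \<bullet> barycenter (opp p)) * (1 - DIM('a) * lam p x))"
proof -
  define d where "d = real DIM('a)"
  have d: "d \<noteq> 0" by (simp add: d_def)
  define v where "v p = k + m \<bullet> p" for p
  define N where "N = sum v C"
  have b: "k + m \<bullet> barycenter (opp p) = (N - v p) / d" if p: "p \<in> C" for p
  proof -
    have "N - v p = (\<Sum>q\<in>C - {p}. v q)" unfolding N_def using p by (simp add: sum.remove)
    also have "\<dots> = k * d + m \<bullet> (\<Sum>q\<in>C - {p}. q)"
      using card_minus[OF p] by (simp add: v_def sum.distrib inner_sum_right d_def)
    finally show ?thesis using d p by (simp add: barycenter_opp field_simps d_def)
  qed
  \<comment> \<open>A facet value is the mean of all vertex values but one. Of the three resulting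
    sums the first is \<open>N\<close>, the second \<open>- N\<close>, and the third is the
    barycentric expansion.\<close>
  have "(\<Sum>p\<in>C. (k + m \<bullet> barycenter (opp p)) * (1 - d * lam p x))
      = (\<Sum>p\<in>C. (N - v p) / d - N * lam p x + lam p x * v p)"
    using d by (intro sum.cong) (simp_all add: b field_simps)
  also have "\<dots> = (\<Sum>p\<in>C. N - v p) / d - N * (\<Sum>p\<in>C. lam p x) + (\<Sum>p\<in>C. lam p x * v p)"
    by (simp add: sum.distrib sum_subtractf sum_distrib_left sum_divide_distrib diff_divide_distrib)
  also have "(\<Sum>p\<in>C. N - v p) = N * d"
    by (simp add: sum_subtractf card_C N_def d_def algebra_simps)
  also have "(\<Sum>p\<in>C. lam p x * v p) = k + m \<bullet> x"
    unfolding v_def by (rule affine_expansion[symmetric])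
  finally show ?thesis using d by (simp add: sum_lam d_def)
qed

lemma interior_simplexI:
  assumes "\<And>p. p \<in> C \<Longrightarrow> 0 < lam p x"
  shows "x \<in> interior (convex hull C)"
proof (rule interiorI)
  have "open {x. 0 < lam p x}" for p
    unfolding lam_def facet_coord_def by (intro open_Collect_less continuous_intros)
  then show "open (\<Inter>p\<in>C. {x. 0 < lam p x})"
    by (intro open_INT) auto
  show "x \<in> (\<Inter>p\<in>C. {x. 0 < lam p x})" using assms by auto
  show "(\<Inter>p\<in>C. {x. 0 < lam p x}) \<subseteq> convex hull C"
    using mem_simplex_iff by (auto intro: less_imp_le)
qed

text \<open>Only the term of \<open>p\<close> survives in the barycentric expansion. Hence affine
  functions vanishing on the same facet are proportional, and so are all normals of that
  facet.\<close>

lemma vanishing_on_facet: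
  assumes p: "p \<in> C" and S: "\<And>x. x \<in> opp p \<Longrightarrow> k + m \<bullet> x = 0"
  shows "k + m \<bullet> x = (k + m \<bullet> p) * lam p x"
proof -
  have "k + m \<bullet> x = (\<Sum>q\<in>C. if q = p then (k + m \<bullet> p) * lam p x else 0)"
    unfolding affine_expansion[of k m x] using S in_opp by (intro sum.cong) auto
  then show ?thesis using p by simp
qed

end

section \<open>Simplices described by their facets alone\<close>

lemma full_simplexE:
  fixes T :: "'a::euclidean_space set"
  assumes "int DIM('a) simplex T"
  obtains C where "full_simplex C" "T = convex hull C"
proof -
  obtain C where "\<not> affine_dependent C" "int (card C) = int DIM('a) + 1" "T = convex hull C"
    using assms unfolding simplex_def by blast
  then show thesis by (intro that[of C]) (simp_all add: full_simplex_def)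
qed

lemma inner_eqI:
  fixes m m' :: "'a::real_inner"
  assumes "\<And>x. k + m \<bullet> x = k' + m' \<bullet> x"
  shows "m = m'"
proof -
  have "m \<bullet> x = m' \<bullet> x" for x using assms[of x] assms[of 0] by simp
  then show ?thesis by (metis inner_commute vector_eq_rdot)
qed

context
  fixes T :: "'a::euclidean_space set"
  assumes T: "int DIM('a) simplex T"
begin

lemma finite_facets: "finite {S. S facet_of T}"
proof -
  obtain C where C: "full_simplex C" "T = convex hull C" using T by (rule full_simplexE)
  interpret full_simplex C by fact
  have "{S. S facet_of T} = opp ` C" using facet_iff C(2) by auto
  then show ?thesis by simp
qed

lemma facet_coord_barycenter_facet:
  assumes "S facet_of T" "S' facet_of T"
  shows "facet_coord T S (barycenter S') = (if S = S' then 0 else 1 / DIM('a))"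
proof -
  obtain C where C: "full_simplex C" "T = convex hull C" using T by (rule full_simplexE)
  interpret full_simplex C by fact
  obtain p q where "p \<in> C" "S = opp p" "q \<in> C" "S' = opp q"
    using assms unfolding C(2) facet_iff by blast
  then show ?thesis
    using lam_opp_barycenter inj_on_eq_iff[OF opp_inj] by (simp add: lam_def C(2))
qed

lemma facet_coord_barycenter:
  assumes "S facet_of T"
  shows "facet_coord T S (barycenter T) = 1 / (DIM('a) + 1)"
proof -
  obtain C where C: "full_simplex C" "T = convex hull C" using T by (rule full_simplexE)
  interpret full_simplex C by fact
  show ?thesis using assms lam_barycenter unfolding C(2) facet_iff by (auto simp: lam_def)
qed

lemma facet_coord_on_facet:
  assumes "S facet_of T" "x \<in> S"
  shows "facet_coord T S x = 0"
proof -
  obtain C where C: "full_simplex C" "T = convex hull C" using T by (rule full_simplexE)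
  interpret full_simplex C by fact
  show ?thesis using assms facet_grad_opp unfolding C(2) facet_iff by (auto simp: lam_def)
qed

lemma facet_grad_nonzero:
  assumes "S facet_of T"
  shows "facet_grad T S \<noteq> 0"
  using facet_coord_barycenter[OF assms] by (auto simp: facet_coord_def)

lemma mem_simplex_facet_coord: "x \<in> T \<longleftrightarrow> (\<forall>S. S facet_of T \<longrightarrow> 0 \<le> facet_coord T S x)"
proof -
  obtain C where C: "full_simplex C" "T = convex hull C" using T by (rule full_simplexE)
  interpret full_simplex C by fact
  show ?thesis unfolding C(2) facet_iff mem_simplex_iff by (auto simp: lam_def)
qed

lemma interior_simplex_facet_coord:
  assumes "\<And>S. S facet_of T \<Longrightarrow> 0 < facet_coord T S x"
  shows "x \<in> interior T"
proof -
  obtain C where C: "full_simplex C" "T = convex hull C" using T by (rule full_simplexE)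
  interpret full_simplex C by fact
  show ?thesis using assms interior_simplexI unfolding C(2) facet_iff by (auto simp: lam_def)
qed

lemma barycenter_interior: "barycenter T \<in> interior T"
  by (rule interior_simplex_facet_coord) (simp add: facet_coord_barycenter)

lemma barycenter_facet_mem:
  assumes "S facet_of T"
  shows "barycenter S \<in> T"
  using facet_coord_barycenter_facet[OF _ assms] by (simp add: mem_simplex_facet_coord)

lemma CR_expansion_simplex:
  fixes m a :: 'a
  shows "k + m \<bullet> (x - a) = (\<Sum>S | S facet_of T. (k + m \<bullet> (barycenter S - a)) * (1 - DIM('a) * facet_coord T S x))"
proof -
  obtain C where C: "full_simplex C" "T = convex hull C" using T by (rule full_simplexE)
  interpret full_simplex C by fact
  have facets: "{S. S facet_of T} = opp ` C" using facet_iff C(2) by auto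
  have k: "k + m \<bullet> (y - a) = k - m \<bullet> a + m \<bullet> y" for y
    by (simp add: inner_diff_right)
  have "(\<Sum>S | S facet_of T. (k + m \<bullet> (barycenter S - a)) * (1 - DIM('a) * facet_coord T S x))
      = (\<Sum>p\<in>C. (k - m \<bullet> a + m \<bullet> barycenter (opp p)) * (1 - DIM('a) * lam p x))"
    unfolding facets sum.reindex[OF opp_inj] k lam_def C(2)[symmetric] o_def ..
  also have "\<dots> = k - m \<bullet> a + m \<bullet> x"
    by (rule CR_expansion[symmetric])
  finally show ?thesis unfolding k by (rule sym)
qed

lemma vanishing_on_facet_simplex:
  assumes S: "S facet_of T" and k: "\<And>x. x \<in> S \<Longrightarrow> k + m \<bullet> x = 0"
  obtains c where "\<And>x. k + m \<bullet> x = c * facet_coord T S x" "m = c *\<^sub>R facet_grad T S"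
proof -
  obtain C where C: "full_simplex C" "T = convex hull C" using T by (rule full_simplexE)
  interpret full_simplex C by fact
  obtain p where p: "p \<in> C" "S = opp p" using S unfolding C(2) facet_iff by auto
  define c where "c = k + m \<bullet> p"
  have e: "k + m \<bullet> x = c * facet_coord T S x" for x
    unfolding c_def C(2) p(2) lam_def[symmetric]
    by (rule vanishing_on_facet[OF p(1)]) (simp add: k p(2))
  have "m = c *\<^sub>R facet_grad T S"
  proof (rule inner_eqI)
    show "k + m \<bullet> x = - c * (facet_grad T S \<bullet> barycenter S) + (c *\<^sub>R facet_grad T S) \<bullet> x" for x
      using e[of x] by (simp add: facet_coord_def inner_diff_right algebra_simps)
  qed
  with e show ?thesis by (rule that)
qed

lemma barycenter_facet_in_facet:
  assumes S: "S facet_of T"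
  shows "barycenter S \<in> S"
proof -
  obtain C where C: "full_simplex C" "T = convex hull C" using T by (rule full_simplexE)
  interpret full_simplex C by fact
  obtain p where p: "p \<in> C" "S = opp p" using S unfolding C(2) facet_iff by auto
  have "(\<Sum>q\<in>C - {p}. (1 / real DIM('a)) *\<^sub>R q) \<in> convex hull (C - {p})"
    using card_minus[OF p(1)]
    by (intro convex_sum) (auto simp: hull_inc)
  then show ?thesis
    using p barycenter_opp[OF p(1)] by (simp add: opp_def scaleR_sum_right divide_inverse)
qed

end


section \<open>Measure and mean of a simplex\<close>

context full_simplex
begin

text \<open>\<open>F\<close> is the affine map that exchanges \<open>p\<close> and \<open>q\<close>
  and fixes the other vertices. It permutes the barycentric coordinates, so it preserves the
  simplex, and its rank-one determinant is 1 - 2 = -1, so it preserves the measure.\<close>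

lemma vimage_swap_vertices:
  fixes p q :: 'a
  assumes pq: "p \<in> C" "q \<in> C"
  defines "F \<equiv> \<lambda>x. x + (lam p x - lam q x) *\<^sub>R (q - p)"
  shows "r \<in> C \<Longrightarrow> lam r (F x) = (if r = p then lam q x else if r = q then lam p x else lam r x)"
    and "F x \<in> convex hull C \<longleftrightarrow> x \<in> convex hull C"
    and "distr lborel borel F = lborel"
proof -
  show lam: "lam r (F x) = (if r = p then lam q x else if r = q then lam p x else lam r x)"
    if "r \<in> C" for r x
  proof -
    have "lam r (F x) = lam r x + (lam p x - lam q x) * (lam r q - lam r p)"
      by (simp add: F_def lam_def facet_coord_def algebra_simps inner_simps)
    then show ?thesis using pq that by (auto simp: lam_vertex)
  qed
  show "F x \<in> convex hull C \<longleftrightarrow> x \<in> convex hull C"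
    unfolding mem_simplex_iff using lam[of _ x] pq by (metis (full_types))
  show "distr lborel borel F = lborel"
  proof (cases "p = q")
    case True
    then have "F = (\<lambda>x. x)" by (simp add: F_def)
    then show ?thesis by (simp add: distr_id2 sets_eq_imp_space_eq)
  next
    case False
    define m where "m = facet_grad (convex hull C) (opp p) - facet_grad (convex hull C) (opp q)"
    \<comment> \<open>The base point has to be a zero of \<open>lam p - lam q\<close>; at the
      barycenter all coordinates are equal.\<close>
    define a where "a = barycenter (convex hull C)"
    have d: "lam p x - lam q x = m \<bullet> (x - a)" for x
    proof -
      have "lam p x - lam q x = (lam p a - lam q a) + m \<bullet> (x - a)"
        by (simp add: lam_def facet_coord_def m_def inner_simps)
      then show ?thesis using pq by (simp add: a_def lam_barycenter)
    qed
    have "m \<bullet> (q - p) = (lam p q - lam q q) - (lam p p - lam q p)"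
      unfolding d by (simp add: inner_simps)
    then have mw: "m \<bullet> (q - p) = -2" using pq False by (simp add: lam_vertex)
    have F: "F = (\<lambda>x. x + (m \<bullet> (x - a)) *\<^sub>R (q - p))"
      by (simp add: F_def d)
    have [measurable]: "F \<in> borel_measurable borel" unfolding F by measurable
    show ?thesis
    proof (rule measure_eqI)
      fix A assume "A \<in> sets (distr lborel borel F)"
      then have A: "A \<in> sets borel" by simp
      have "emeasure lborel A = emeasure lborel (F -` A)"
        using emeasure_vimage_affine_rank_one[OF _ _ A, of m "q - p" a] mw unfolding F[symmetric] by simp
      then show "emeasure (distr lborel borel F) A = emeasure lborel A"
        using A by (simp add: emeasure_distr)
    qed simp
  qed
qed

lemma compact_hull [simp]: "compact (convex hull C)"
  by (simp add: finite_imp_compact_convex_hull)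

lemma continuous_on_lam [continuous_intros]: "continuous_on S (lam p)"
  unfolding lam_def facet_coord_def by (intro continuous_intros)

lemma integrable_lam: "integrable lborel (\<lambda>x. indicator (convex hull C) x * lam p x)"
  using borel_integrable_compact[OF compact_hull continuous_on_lam] by simp

lemma measurable_lam [measurable]: "lam p \<in> borel_measurable borel"
  by (intro borel_measurable_continuous_onI continuous_on_lam)

lemma measurable_hull [measurable]: "convex hull C \<in> sets borel"
  using compact_imp_closed[OF compact_hull] by simp

text \<open>Swapping two vertices preserves the measure and the simplex, so the barycentric coordinates all
  have the same mean.\<close>

lemma integral_lam:
  assumes p: "p \<in> C"
  shows "(LINT x|lborel. indicator (convex hull C) x * lam p x) = measure lborel (convex hull C) / (DIM('a) + 1)"
proof -
  define I where "I p = (LINT x|lborel. indicator (convex hull C) x * lam p x)" for p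
  have "I p = I q" if q: "q \<in> C" for q
  proof -
    define F where "F x = x + (lam p x - lam q x) *\<^sub>R (q - p)" for x
    note F = vimage_swap_vertices[OF p q, folded F_def]
    have [measurable]: "F \<in> borel_measurable borel" unfolding F_def by measurable
    have "I p = (LINT x|distr lborel borel F. indicator (convex hull C) x * lam p x)"
      unfolding I_def using F(3) by simp
    also have "\<dots> = (LINT x|lborel. indicator (convex hull C) (F x) * lam p (F x))"
      by (rule integral_distr) measurable
    also have "\<dots> = I q"
      unfolding I_def by (intro Bochner_Integration.integral_cong refl) (simp add: indicator_def F p)
    finally show ?thesis .
  qed
  then have "(\<Sum>q\<in>C. I q) = (\<Sum>q\<in>C. I p)"
    by (intro sum.cong) simp_all
  then have "(\<Sum>q\<in>C. I q) = (DIM('a) + 1) * I p"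
    by (simp add: card_C)
  moreover have "(\<Sum>q\<in>C. I q) = (LINT x|lborel. (\<Sum>q\<in>C. indicator (convex hull C) x * lam q x))"
    unfolding I_def by (intro Bochner_Integration.integral_sum[symmetric] integrable_lam)
  moreover have "\<dots> = (LINT x|lborel. indicator (convex hull C) x)"
    by (simp add: sum_lam flip: sum_distrib_left)
  moreover have "\<dots> = measure lborel (convex hull C)"
    by simp
  ultimately show ?thesis by (simp add: I_def field_simps)
qed

text \<open>Integrating the barycentric representation of \<open>x\<close> gives every vertex the
  same weight, so the vertex mean is the center of mass. This is why projections of affine functions
  are values at barycenters.\<close>

lemma has_integral_id: "((\<lambda>x. x) has_integral (measure lborel (convex hull C) *\<^sub>R barycenter (convex hull C))) (convex hull C)"
proof -
  define c where "c = measure lborel (convex hull C) / (DIM('a) + 1)"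
  have "((\<lambda>x. indicator (convex hull C) x * lam p x) has_integral c) UNIV" if "p \<in> C" for p
    using has_integral_integral_lborel[OF integrable_lam[of p]] integral_lam[OF that] by (simp add: c_def)
  then have "((\<lambda>x. \<Sum>p\<in>C. (indicator (convex hull C) x * lam p x) *\<^sub>R p) has_integral (\<Sum>p\<in>C. c *\<^sub>R p)) UNIV"
    by (intro has_integral_sum has_integral_scaleR_left) simp_all
  moreover have "(\<Sum>p\<in>C. (indicator (convex hull C) x * lam p x) *\<^sub>R p) = (if x \<in> convex hull C then x else 0)" for x
    by (simp add: indicator_def sum_lam_scaleR)
  moreover have "(\<Sum>p\<in>C. c *\<^sub>R p) = measure lborel (convex hull C) *\<^sub>R barycenter (convex hull C)"
    by (simp add: c_def barycenter_simplex scaleR_sum_right[symmetric] divide_inverse add.commute)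
  ultimately show ?thesis by (simp add: has_integral_restrict_UNIV)
qed

end

lemma has_integral_id_simplex:
  fixes T :: "'a::euclidean_space set"
  assumes "int DIM('a) simplex T"
  shows "((\<lambda>x. x) has_integral (measure lebesgue T *\<^sub>R barycenter T)) T"
proof -
  obtain C where C: "full_simplex C" "T = convex hull C" using assms by (rule full_simplexE)
  interpret full_simplex C by fact
  show ?thesis using has_integral_id by (simp add: C(2))
qed

text \<open>Both coordinates vanish on \<open>S\<close>, hence are proportional. A positive factor
  would let one and the same small step off \<open>S\<close> enter the interiors of both
  simplices.\<close>

lemma facet_grad_opposite_direction:
  fixes T T' :: "'a::euclidean_space set"
  assumes T: "int DIM('a) simplex T" and T': "int DIM('a) simplex T'"
    and S: "S facet_of T" "S facet_of T'" and disj: "interior T \<inter> interior T' = {}"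
  obtains c where "c < 0" "facet_grad T' S = c *\<^sub>R facet_grad T S" "\<And>x. facet_coord T' S x = c * facet_coord T S x"
proof -
  define b where "b = barycenter S"
  define n where "n = facet_grad T S"
  have k: "facet_coord T' S x = - (facet_grad T' S \<bullet> b) + facet_grad T' S \<bullet> x" for x
    by (simp add: facet_coord_def b_def inner_simps)
  obtain c where c: "\<And>x. - (facet_grad T' S \<bullet> b) + facet_grad T' S \<bullet> x = c * facet_coord T S x"
    "facet_grad T' S = c *\<^sub>R facet_grad T S"
    using vanishing_on_facet_simplex[OF T S(1), of "- (facet_grad T' S \<bullet> b)" "facet_grad T' S"]
      facet_coord_on_facet[OF T' S(2)] unfolding k by metis
  have c0: "c \<noteq> 0" using c(2) facet_grad_nonzero[OF T' S(2)] by auto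
  have n0: "n \<noteq> 0" using facet_grad_nonzero[OF T S(1)] by (simp add: n_def)
  have "\<not> c > 0"
  proof
    assume cp: "c > 0"
    \<comment> \<open>At the barycenter of \<open>S\<close> the coordinate of \<open>S\<close> is 0
      and increases along \<open>n\<close>, while all other coordinates equal 1/d there and stay
      positive for small \<open>t\<close>.\<close>
    have ev: "\<forall>\<^sub>F t in at_right 0. b + t *\<^sub>R n \<in> interior U"
      if U: "int DIM('a) simplex U" "S facet_of U" and g: "facet_grad U S \<bullet> n > 0" for U
    proof -
      have "\<forall>\<^sub>F t in at_right 0. 0 < facet_coord U S' (b + t *\<^sub>R n)" if S': "S' facet_of U" for S'
      proof (cases "S' = S")
        case True
        have "facet_coord U S' (b + t *\<^sub>R n) = t * (facet_grad U S \<bullet> n)" for t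
          by (simp add: True facet_coord_def b_def)
        moreover have "\<forall>\<^sub>F t in at_right (0::real). 0 < t" by (simp add: eventually_at_right_less)
        ultimately show ?thesis using g by (auto elim: eventually_mono)
      next
        case False
        have "((\<lambda>t. facet_coord U S' (b + t *\<^sub>R n)) \<longlongrightarrow> facet_coord U S' (b + 0 *\<^sub>R n)) (at_right 0)"
          unfolding facet_coord_def by (intro tendsto_intros)
        moreover have "facet_coord U S' (b + 0 *\<^sub>R n) > 0"
          using facet_coord_barycenter_facet[OF U(1) S' U(2)] False by (simp add: b_def)
        ultimately show ?thesis by (rule order_tendstoD)
      qed
      then have "\<forall>\<^sub>F t in at_right 0. \<forall>S'\<in>{S'. S' facet_of U}. 0 < facet_coord U S' (b + t *\<^sub>R n)"
        using finite_facets[OF U(1)] by (intro eventually_ball_finite) auto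
      then show ?thesis
        by (rule eventually_mono) (auto intro: interior_simplex_facet_coord[OF U(1)])
    qed
    have "\<forall>\<^sub>F t in at_right 0. b + t *\<^sub>R n \<in> interior T"
      using n0 by (intro ev T S) (simp add: n_def)
    moreover have "\<forall>\<^sub>F t in at_right 0. b + t *\<^sub>R n \<in> interior T'"
      using n0 cp by (intro ev T' S) (simp add: c(2) n_def)
    ultimately have "\<forall>\<^sub>F t in at_right (0::real). False"
      by eventually_elim (use disj in blast)
    then show False by simp
  qed
  then show thesis using that c c0 k by (metis linorder_neqE_linordered_idom)
qed

text \<open>Both sides are \<open>d - 1\<close> dimensional measures of \<open>S\<close> times unit normals, up to a common factor: the
  affine map that fixes \<open>S\<close> and moves one opposite vertex to the other maps \<open>T\<close> onto \<open>T'\<close>.\<close>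

lemma measure_scaleR_facet_grad:
  fixes T T' :: "'a::euclidean_space set"
  assumes T: "int DIM('a) simplex T" and T': "int DIM('a) simplex T'"
    and S: "S facet_of T" "S facet_of T'" and disj: "interior T \<inter> interior T' = {}"
  shows "measure lebesgue T' *\<^sub>R facet_grad T' S = - (measure lebesgue T *\<^sub>R facet_grad T S)"
proof -
  obtain c where c: "c < 0" "facet_grad T' S = c *\<^sub>R facet_grad T S" "\<And>x. facet_coord T' S x = c * facet_coord T S x"
    using facet_grad_opposite_direction[OF assms] by metis
  obtain C where C: "full_simplex C" "T = convex hull C" using T by (rule full_simplexE)
  obtain C' where C': "full_simplex C'" "T' = convex hull C'" using T' by (rule full_simplexE)
  interpret C: full_simplex C by fact
  interpret C': full_simplex C' by fact
  obtain p where p: "p \<in> C" "S = C.opp p" using S unfolding C(2) C.facet_iff by auto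
  obtain q where q: "q \<in> C'" "S = C'.opp q" using S unfolding C'(2) C'.facet_iff by auto
  \<comment> \<open>The facet determines its vertices as its extreme points, so the vertex sets
    differ only in \<open>p\<close> and \<open>q\<close>.\<close>
  have eq: "C - {p} = C' - {q}"
    using C.extreme_point_opp[of _ p] C'.extreme_point_opp[of _ q] p q by auto
  define m where "m = facet_grad T S"
  define b where "b = barycenter S"
  define w where "w = q - p"
  define F where "F x = x + (m \<bullet> (x - b)) *\<^sub>R w" for x
  have co: "facet_coord T S x = m \<bullet> (x - b)" for x by (simp add: facet_coord_def m_def b_def)
  have lp: "m \<bullet> (p - b) = 1"
    using C.lam_vertex[OF p(1) p(1)] co[of p] C(2) p(2) by (simp add: C.lam_def)
  have lq: "c * (m \<bullet> (q - b)) = 1"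
    using C'.lam_vertex[OF q(1) q(1)] co[of q] c(3)[of q] C'(2) q(2) by (simp add: C'.lam_def)
  \<comment> \<open>The determinant is the coordinate of \<open>T\<close> at the opposite vertex
    \<open>q\<close> of \<open>T'\<close>, which is 1/c. The volume ratio is therefore -1/c, just
    what cancels the factor \<open>c\<close> between the gradients up to sign.\<close>
  have mw1: "1 + m \<bullet> w = m \<bullet> (q - b)" using lp by (simp add: w_def inner_simps)
  have lq': "m \<bullet> (q - b) = 1 / c" using lq c(1) by (simp add: field_simps)
  have mw0: "m \<bullet> w \<noteq> 0"
  proof
    assume "m \<bullet> w = 0"
    then have "1 = 1 / c" using mw1 lq' by simp
    then show False using c(1) by (simp add: field_simps)
  qed
  have mw: "1 + m \<bullet> w \<noteq> 0" using mw1 lq' c(1) by simp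
  have FT: "F ` T = T'"
  proof -
    define f where "f x = x + (m \<bullet> x) *\<^sub>R w" for x
    define k where "k = - (m \<bullet> b) *\<^sub>R w"
    have F: "F = (\<lambda>x. k + x) \<circ> f" by (auto simp: F_def f_def k_def fun_eq_iff inner_simps algebra_simps)
    have "linear f" unfolding f_def by (rule linearI) (simp_all add: inner_simps algebra_simps)
    then have "(\<lambda>x. k + x) ` (f ` (convex hull C)) = convex hull ((\<lambda>x. k + x) ` (f ` C))"
      by (simp only: convex_hull_linear_image convex_hull_translation)
    then have "F ` T = convex hull (F ` C)"
      by (simp only: F C(2) image_comp)
    also have "F ` C = C'"
    proof -
      have "F v = v" if "v \<in> C - {p}" for v
      proof -
        have "m \<bullet> (v - b) = 0"
          using C.lam_vertex[OF p(1), of v] that co[of v] C(2) p(2) by (simp add: C.lam_def)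
        then show ?thesis by (simp add: F_def)
      qed
      then have "F ` (C - {p}) = C - {p}" by simp
      moreover have "F p = q" using lp by (simp add: F_def w_def)
      moreover have "C = insert p (C - {p})" using p by auto
      ultimately have "F ` C = insert q (C - {p})" by (metis image_insert)
      then show ?thesis using eq q by auto
    qed
    finally show ?thesis by (simp add: C'(2))
  qed
  have inj: "inj F"
  proof (rule injI)
    fix x y assume xy: "F x = F y"
    then have "m \<bullet> (F x - F y) = 0" by simp
    then have "(m \<bullet> (x - y)) * (1 + m \<bullet> w) = 0" by (simp add: F_def inner_simps algebra_simps)
    then have "m \<bullet> (x - y) = 0" using mw by simp
    then have "m \<bullet> (x - b) = m \<bullet> (y - b)" by (simp add: inner_simps)
    then show "x = y" using xy by (simp add: F_def)
  qed
  have FT': "F -` T' = T" using inj_vimage_image_eq[OF inj, of T] FT by simp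
  have "emeasure lborel T' = ennreal \<bar>1 + m \<bullet> w\<bar> * emeasure lborel T"
    using emeasure_vimage_affine_rank_one[OF mw0 mw, of T' b] C'.measurable_hull FT'
    unfolding F_def[abs_def] by (simp add: C'(2))
  then have "measure lborel T' = \<bar>1 + m \<bullet> w\<bar> * measure lborel T"
    by (simp add: measure_def enn2real_mult)
  moreover have "\<bar>1 + m \<bullet> w\<bar> * c = -1" using mw1 lq' c(1) by simp
  moreover have "measure lebesgue T = measure lborel T" "measure lebesgue T' = measure lborel T'"
    using C.measurable_hull C'.measurable_hull by (simp_all add: C(2) C'(2))
  ultimately have "measure lebesgue T' * c = - measure lebesgue T"
    by (metis mult.assoc mult.commute mult_minus1)
  then show ?thesis by (simp add: c(2) flip: scaleR_minus_left)
qed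


section \<open>Geometry of the triangulation\<close>

text \<open>This rules out slits. Near a boundary point the part strictly below the graph is open
  and disjoint from \<Omega>, hence disjoint from the closure, so no neighbourhood of the point lies
  in the closure.\<close>

lemma Lipschitz_boundary_interior_closure:
  assumes \<Omega>: "open \<Omega>" "Lipschitz_boundary \<Omega>"
  shows "interior (closure \<Omega>) \<subseteq> \<Omega>"
proof (rule ccontr)
  assume "\<not> interior (closure \<Omega>) \<subseteq> \<Omega>"
  then obtain p where p: "p \<in> interior (closure \<Omega>)" "p \<notin> \<Omega>" by blast
  then have "p \<in> frontier \<Omega>"
    using interior_subset \<Omega>(1) by (auto simp: frontier_def interior_open)
  then obtain U \<nu> L and \<phi> :: "'a \<Rightarrow> real" where U: "open U" "p \<in> U" and \<nu>: "norm \<nu> = 1"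
    and L: "L-lipschitz_on UNIV \<phi>" and eq: "\<Omega> \<inter> U = {x \<in> U. \<phi> (x - (x \<bullet> \<nu>) *\<^sub>R \<nu>) < x \<bullet> \<nu>}"
    using \<Omega>(2) unfolding Lipschitz_boundary_def by meson
  define P where "P x = x - (x \<bullet> \<nu>) *\<^sub>R \<nu>" for x
  have \<nu>\<nu>: "\<nu> \<bullet> \<nu> = 1" using \<nu> by (simp add: norm_eq_1)
  have "continuous_on UNIV \<phi>" using L by (rule lipschitz_on_continuous_on)
  then have "continuous_on UNIV (\<lambda>x. \<phi> (P x))"
    by (rule continuous_on_compose2) (auto simp: P_def intro!: continuous_intros)
  then have "open {x. x \<bullet> \<nu> < \<phi> (P x)}"
    by (intro open_Collect_less continuous_intros)
  then have W: "open (U \<inter> {x. x \<bullet> \<nu> < \<phi> (P x)})"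
    using U(1) by blast
  have "U \<inter> {x. x \<bullet> \<nu> < \<phi> (P x)} \<inter> \<Omega> = {}"
  proof -
    have "x \<notin> \<Omega>" if "x \<in> U" "x \<bullet> \<nu> < \<phi> (P x)" for x
    proof
      assume "x \<in> \<Omega>"
      then have "x \<in> {x \<in> U. \<phi> (x - (x \<bullet> \<nu>) *\<^sub>R \<nu>) < x \<bullet> \<nu>}" using that(1) eq by blast
      then show False using that(2) by (simp add: P_def)
    qed
    then show ?thesis by blast
  qed
  then have W0: "U \<inter> {x. x \<bullet> \<nu> < \<phi> (P x)} \<inter> closure \<Omega> = {}"
    using open_Int_closure_eq_empty[OF W] by blast
  have "open (U \<inter> interior (closure \<Omega>))" using U(1) by blast
  moreover have "p \<in> U \<inter> interior (closure \<Omega>)" using U(2) p(1) by blast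
  ultimately obtain e where e: "e > 0" "ball p e \<subseteq> U \<inter> interior (closure \<Omega>)"
    by (meson openE)
  \<comment> \<open>\<open>p\<close> may lie on the graph itself; a step against \<nu> keeps the
    projection \<open>P\<close> and leads strictly below the graph.\<close>
  define x where "x = p - (e / 2) *\<^sub>R \<nu>"
  have "x \<in> ball p e" using e(1) \<nu> by (simp add: x_def dist_norm)
  then have x: "x \<in> U" "x \<in> closure \<Omega>" using e(2) interior_subset[of "closure \<Omega>"] by blast+
  have "P x = P p" using \<nu>\<nu> by (simp add: P_def x_def inner_diff_left algebra_simps)
  moreover have "\<phi> (P p) \<ge> p \<bullet> \<nu>" using p(2) U(2) eq by (auto simp: P_def not_less[symmetric])
  moreover have "x \<bullet> \<nu> < p \<bullet> \<nu>" using \<nu>\<nu> e(1) by (simp add: x_def inner_diff_left)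
  ultimately have "x \<in> U \<inter> {x. x \<bullet> \<nu> < \<phi> (P x)}" using x(1) by simp
  then show False using W0 x(2) by blast
qed

locale triangulated_domain =
  fixes \<Omega> :: "'a::euclidean_space set" and \<T> :: "'a set set"
  assumes domain: "polyhedral_Lipschitz_domain \<Omega>" and conforming: "conforming_triangulation \<Omega> \<T>"
begin

section \<open>Elements and the skeleton\<close>

abbreviation vol :: "'a set \<Rightarrow> real" where
  "vol T \<equiv> measure lebesgue T"

lemma open_domain: "open \<Omega>" and bounded_domain: "bounded \<Omega>"
  using domain by (simp_all add: polyhedral_Lipschitz_domain_def)

lemma interior_closure_domain: "interior (closure \<Omega>) \<subseteq> \<Omega>"
  using domain by (intro Lipschitz_boundary_interior_closure) (simp_all add: polyhedral_Lipschitz_domain_def)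

lemma finite_triangulation [simp]: "finite \<T>"
  and simplexD: "T \<in> \<T> \<Longrightarrow> int DIM('a) simplex T"
  and Union_triangulation: "\<Union>\<T> = closure \<Omega>"
  and face_Int: "T \<in> \<T> \<Longrightarrow> T' \<in> \<T> \<Longrightarrow> (T \<inter> T') face_of T"
  using conforming by (simp_all add: conforming_triangulation_def triangulation_def)

lemma element_subset: "T \<in> \<T> \<Longrightarrow> T \<subseteq> closure \<Omega>"
  using Union_triangulation by blast

lemma interior_element_subset: "T \<in> \<T> \<Longrightarrow> interior T \<subseteq> \<Omega>"
  using interior_mono[OF element_subset] interior_closure_domain by (rule subset_trans)

text \<open>A proper face misses the relative interior, but a nonempty open subset of the
  intersection lies in the interior of both elements. By conformity the intersection is then each of
  the two elements.\<close>

lemma overlapping_elements_eq: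
  assumes T: "T \<in> \<T>" "T' \<in> \<T>" and ne: "interior (T \<inter> T') \<noteq> {}"
  shows "T = T'"
proof -
  have full: "U = U \<inter> V" if "U \<in> \<T>" "V \<in> \<T>" "interior (U \<inter> V) \<noteq> {}" for U V
  proof (rule ccontr)
    assume "U \<noteq> U \<inter> V"
    then have "(U \<inter> V) \<inter> rel_interior U = {}"
      using face_of_disjoint_rel_interior[OF face_Int[OF that(1,2)]] by auto
    moreover have "interior (U \<inter> V) \<subseteq> rel_interior U"
      using interior_mono[of "U \<inter> V" U] interior_subset_rel_interior by blast
    ultimately show False using interior_subset[of "U \<inter> V"] that(3) by blast
  qed
  show ?thesis using full[OF T ne] full[OF T(2,1)] ne by (simp add: Int_commute)
qed

lemma interior_disjoint:
  assumes "T \<in> \<T>" "T' \<in> \<T>" "T \<noteq> T'"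
  shows "interior T \<inter> interior T' = {}"
  using overlapping_elements_eq[OF assms(1,2)] assms(3) by (auto simp: interior_Int)

lemma convex_element: "T \<in> \<T> \<Longrightarrow> convex T"
  and compact_element: "T \<in> \<T> \<Longrightarrow> compact T"
  using convex_simplex compact_simplex simplexD by blast+

lemma barycenter_element: "T \<in> \<T> \<Longrightarrow> barycenter T \<in> interior T"
  by (rule barycenter_interior[OF simplexD])

lemma closed_element: "T \<in> \<T> \<Longrightarrow> closed T"
  by (rule compact_imp_closed[OF compact_element])

lemma closure_interior_element:
  assumes T: "T \<in> \<T>"
  shows "closure (interior T) = T"
proof -
  have "interior T \<noteq> {}" using barycenter_element[OF T] by blast
  from convex_closure_interior[OF convex_element[OF T] this] show ?thesis
    by (simp only: closure_closed[OF closed_element[OF T]])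
qed

lemma lmeasurable_element: "T \<in> \<T> \<Longrightarrow> T \<in> lmeasurable"
  by (rule lmeasurable_compact[OF compact_element])

lemma negligible_frontier_element: "T \<in> \<T> \<Longrightarrow> negligible (frontier T)"
  by (rule negligible_convex_frontier[OF convex_element])

lemma lmeasurable_interior_element: "T \<in> \<T> \<Longrightarrow> interior T \<in> lmeasurable"
  by (rule lmeasurable_interior[OF compact_imp_bounded[OF compact_element]])

lemma vol_interior: "T \<in> \<T> \<Longrightarrow> measure lebesgue (interior T) = vol T"
  by (rule measure_interior[OF compact_imp_bounded[OF compact_element] negligible_frontier_element])

lemma vol_pos:
  assumes T: "T \<in> \<T>"
  shows "0 < vol T"
proof -
  have "\<not> negligible (interior T)"
    using barycenter_element[OF T] by (intro open_not_negligible) auto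
  then have "vol T \<noteq> 0"
    using lmeasurable_interior_element[OF T] vol_interior[OF T] by (simp add: negligible_iff_measure)
  then show ?thesis using measure_nonneg[of lebesgue T] by linarith
qed

lemma negligible_skeleton: "negligible (\<Omega> - (\<Union>T\<in>\<T>. interior T))"
proof (rule negligible_subset)
  show "negligible (\<Union>T\<in>\<T>. frontier T)"
    by (intro negligible_Union) (auto simp: negligible_frontier_element)
  show "\<Omega> - (\<Union>T\<in>\<T>. interior T) \<subseteq> (\<Union>T\<in>\<T>. frontier T)"
  proof
    fix x assume x: "x \<in> \<Omega> - (\<Union>T\<in>\<T>. interior T)"
    then obtain T where T: "T \<in> \<T>" "x \<in> T" using Union_triangulation closure_subset[of \<Omega>] by blast
    then have "x \<in> frontier T" using x closure_subset[of T] unfolding frontier_def by blast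
    then show "x \<in> (\<Union>T\<in>\<T>. frontier T)" using T by blast
  qed
qed

lemma UN_interior_subset: "(\<Union>T\<in>\<T>. interior T) \<subseteq> \<Omega>"
  using interior_element_subset by blast

section \<open>Integrals of element-wise functions\<close>

lemma set_integrable_elementwise:
  fixes F :: "'a \<Rightarrow> 'b::euclidean_space"
  assumes "\<And>T. T \<in> \<T> \<Longrightarrow> set_integrable lebesgue (interior T) F"
  shows "set_integrable lebesgue \<Omega> F" "(LINT x:\<Omega>|lebesgue. F x) = (\<Sum>T\<in>\<T>. LINT x:interior T|lebesgue. F x)"
proof -
  let ?U = "\<Union>T\<in>\<T>. interior T"
  have U: "set_integrable lebesgue ?U F"
    by (intro set_integrable_UN assms) auto
  have n1: "negligible {x \<in> ?U - \<Omega>. F x \<noteq> 0}"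
    using UN_interior_subset by (simp add: Diff_eq_empty_iff[THEN iffD2])
  have n2: "negligible {x \<in> \<Omega> - ?U. F x \<noteq> 0}"
    by (rule negligible_subset[OF negligible_skeleton]) auto
  show \<Omega>: "set_integrable lebesgue \<Omega> F"
    by (rule absolutely_integrable_spike_set[OF U n1 n2])
  have "(LINT x:\<Omega>|lebesgue. F x) = integral \<Omega> F"
    by (rule set_lebesgue_integral_eq_integral(2)[OF \<Omega>])
  also have "\<dots> = integral ?U F"
    by (rule integral_spike_set) (use n1 n2 in auto)
  also have "\<dots> = (LINT x:?U|lebesgue. F x)"
    by (rule set_lebesgue_integral_eq_integral(2)[OF U, symmetric])
  also have "\<dots> = (\<Sum>T\<in>\<T>. LINT x:interior T|lebesgue. F x)"
  proof (rule set_integral_finite_UN_AE)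
    show "AE x in lebesgue. x \<in> interior T \<and> x \<in> interior T' \<longrightarrow> T = T'" if "T \<in> \<T>" "T' \<in> \<T>" for T T'
      using interior_disjoint[OF that] by (intro AE_I2) blast
  qed (auto intro: assms)
  finally show "(LINT x:\<Omega>|lebesgue. F x) = (\<Sum>T\<in>\<T>. LINT x:interior T|lebesgue. F x)" .
qed

lemma set_integrable_const_on_interior:
  assumes T: "T \<in> \<T>" and F: "\<And>x. x \<in> interior T \<Longrightarrow> F x = (c :: 'b::euclidean_space)"
  shows "set_integrable lebesgue (interior T) F" "(LINT x:interior T|lebesgue. F x) = vol T *\<^sub>R c"
proof -
  have "set_integrable lebesgue (interior T) (\<lambda>x. c)"
    using lmeasurable_interior_element[OF T] by (simp add: absolutely_integrable_on_const)
  then show "set_integrable lebesgue (interior T) F"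
    by (subst set_integrable_cong[OF refl refl F])
  have "(LINT x:interior T|lebesgue. F x) = (LINT x:interior T|lebesgue. c)"
    using F by (intro set_lebesgue_integral_cong) auto
  also have "\<dots> = vol T *\<^sub>R c"
    using lmeasurable_interior_element[OF T]
    by (simp add: set_lebesgue_integral_def vol_interior[OF T] fmeasurable_def top.not_eq_extremum)
  finally show "(LINT x:interior T|lebesgue. F x) = vol T *\<^sub>R c" .
qed

lemma integral_elementwise_const:
  fixes F :: "'a \<Rightarrow> real"
  assumes "\<And>T x. T \<in> \<T> \<Longrightarrow> x \<in> interior T \<Longrightarrow> F x = F (barycenter T)"
  shows "(LINT x:\<Omega>|lebesgue. F x) = (\<Sum>T\<in>\<T>. vol T * F (barycenter T))"
proof -
  have "(LINT x:\<Omega>|lebesgue. F x) = (\<Sum>T\<in>\<T>. LINT x:interior T|lebesgue. F x)"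
    by (rule set_integrable_elementwise(2)) (rule set_integrable_const_on_interior(1)[OF _ assms])
  also have "\<dots> = (\<Sum>T\<in>\<T>. vol T *\<^sub>R F (barycenter T))"
    by (intro sum.cong refl set_integrable_const_on_interior(2)[OF _ assms])
  finally show ?thesis by simp
qed

text \<open>Stated for \<open>ennreal\<close> because the Fenchel conjugate, which is integrated in
  the dual functional, takes the value \<infinity>.\<close>

lemma nn_integral_elementwise_const:
  fixes F :: "'a \<Rightarrow> ennreal"
  assumes F: "\<And>T x. T \<in> \<T> \<Longrightarrow> x \<in> interior T \<Longrightarrow> F x = F (barycenter T)"
  shows "(\<integral>\<^sup>+x\<in>\<Omega>. F x \<partial>lebesgue) = (\<Sum>T\<in>\<T>. F (barycenter T) * ennreal (vol T))"
proof -
  have "AE x in lebesgue. x \<notin> \<Omega> - (\<Union>T\<in>\<T>. interior T)"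
    using negligible_skeleton unfolding negligible_iff_null_sets by (rule AE_not_in)
  then have "AE x in lebesgue. F x * indicator \<Omega> x = (\<Sum>T\<in>\<T>. F (barycenter T) * indicator (interior T) x)"
  proof eventually_elim
    case (elim x)
    show ?case
    proof (cases "x \<in> \<Omega>")
      case True
      then obtain T where T: "T \<in> \<T>" "x \<in> interior T" using elim by blast
      have "(\<Sum>T\<in>\<T>. F (barycenter T) * indicator (interior T) x)
          = (\<Sum>T'\<in>\<T>. if T' = T then F (barycenter T) else 0)"
        using interior_disjoint T by (intro sum.cong) (auto simp: indicator_def)
      then show ?thesis using T True F[OF T] by simp
    next
      case False
      then show ?thesis using UN_interior_subset by (auto intro!: sum.neutral[symmetric] simp: indicator_def)
    qed
  qed
  then have "(\<integral>\<^sup>+x\<in>\<Omega>. F x \<partial>lebesgue) = (\<integral>\<^sup>+x. (\<Sum>T\<in>\<T>. F (barycenter T) * indicator (interior T) x) \<partial>lebesgue)"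
    by (rule nn_integral_cong_AE)
  also have "\<dots> = (\<Sum>T\<in>\<T>. F (barycenter T) * ennreal (vol T))"
  proof (subst nn_integral_sum)
    show "(\<Sum>T\<in>\<T>. \<integral>\<^sup>+x. F (barycenter T) * indicator (interior T) x \<partial>lebesgue) = (\<Sum>T\<in>\<T>. F (barycenter T) * ennreal (vol T))"
    proof (intro sum.cong refl)
      fix T assume T: "T \<in> \<T>"
      have "(\<integral>\<^sup>+x. F (barycenter T) * indicator (interior T) x \<partial>lebesgue) = F (barycenter T) * emeasure lebesgue (interior T)"
        by (rule nn_integral_cmult_indicator) simp
      then show "(\<integral>\<^sup>+x. F (barycenter T) * indicator (interior T) x \<partial>lebesgue) = F (barycenter T) * ennreal (vol T)"
        using lmeasurable_interior_element[OF T] by (simp add: emeasure_eq_measure2 vol_interior[OF T])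
    qed
  qed (auto intro!: borel_measurable_times_ennreal borel_measurable_indicator)
  finally show ?thesis .
qed

text \<open>The frontier is negligible, so the center of mass of the closed simplex serves the open
  one. \<open>L\<close> is a general linear map in order to cover scalar functions, Raviart--Thomas
  fields and the identity at once.\<close>

lemma integral_affine_element:
  fixes L :: "'a \<Rightarrow> 'b::euclidean_space"
  assumes T: "T \<in> \<T>" and L: "linear L" and F: "\<And>x. x \<in> interior T \<Longrightarrow> F x = a + L x"
  shows "set_integrable lebesgue (interior T) F"
    and "(LINT x:interior T|lebesgue. F x) = vol T *\<^sub>R (a + L (barycenter T))"
proof -
  have bl: "bounded_linear L" using L by (simp add: linear_conv_bounded_linear)
  have cont: "continuous_on T (\<lambda>x. a + L x)"
    using bl by (intro continuous_intros linear_continuous_on)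
  have ai: "(\<lambda>x. a + L x) absolutely_integrable_on T"
    using borel_integrable_compact[OF compact_element[OF T] cont] compact_imp_closed[OF compact_element[OF T]]
    unfolding set_integrable_def by (subst integrable_completion) simp_all
  have "T - interior T \<subseteq> frontier T" "interior T - T = {}"
    using interior_subset[of T] closure_subset[of T] unfolding frontier_def by blast+
  then have neg: "negligible {x \<in> T - interior T. P x}" "negligible {x \<in> interior T - T. P x}" for P
    using negligible_frontier_element[OF T] by (auto intro: negligible_subset)
  have ai': "(\<lambda>x. a + L x) absolutely_integrable_on (interior T)"
    by (rule absolutely_integrable_spike_set[OF ai neg])
  then show "set_integrable lebesgue (interior T) F"
    by (subst set_integrable_cong[OF refl refl F])
  have "((\<lambda>x. a + L x) has_integral (vol T *\<^sub>R a + L (vol T *\<^sub>R barycenter T))) T"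
  proof (rule has_integral_add)
    show "((\<lambda>x. a) has_integral vol T *\<^sub>R a) T"
      using has_integral_scaleR_left[OF integrable_integral[OF integrable_on_const[OF lmeasurable_element[OF T], of "1::real"]], of a]
      by (simp add: lmeasure_integral[OF lmeasurable_element[OF T]])
    show "(L has_integral L (vol T *\<^sub>R barycenter T)) T"
      using has_integral_linear[OF has_integral_id_simplex[OF simplexD[OF T]] bl] by (simp add: o_def)
  qed
  then have "integral T (\<lambda>x. a + L x) = vol T *\<^sub>R (a + L (barycenter T))"
    by (simp add: integral_unique linear_scale[OF L] scaleR_add_right)
  moreover have "(LINT x:interior T|lebesgue. F x) = (LINT x:interior T|lebesgue. a + L x)"
    using F by (intro set_lebesgue_integral_cong) auto
  moreover have "\<dots> = integral (interior T) (\<lambda>x. a + L x)"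
    by (rule set_lebesgue_integral_eq_integral(2)[OF ai'])
  moreover have "\<dots> = integral T (\<lambda>x. a + L x)"
    by (rule integral_spike_set) (use neg in auto)
  ultimately show "(LINT x:interior T|lebesgue. F x) = vol T *\<^sub>R (a + L (barycenter T))" by simp
qed

section \<open>Shared facets and boundary facets\<close>

lemma facet_weights:
  assumes "T \<in> \<T>" "T' \<in> \<T>" "T \<noteq> T'" "S facet_of T" "S facet_of T'"
  shows "vol T' *\<^sub>R facet_grad T' S = - (vol T *\<^sub>R facet_grad T S)"
  using assms by (intro measure_scaleR_facet_grad simplexD interior_disjoint)

text \<open>The weights of three distinct elements at one facet would be pairwise opposite, which
  forces them to vanish.\<close>

lemma facet_at_most_two:
  assumes T: "T1 \<in> \<T>" "T2 \<in> \<T>" "T3 \<in> \<T>" and S: "S facet_of T1" "S facet_of T2" "S facet_of T3"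
    and ne: "T1 \<noteq> T2" "T1 \<noteq> T3"
  shows "T2 = T3"
proof (rule ccontr)
  assume "T2 \<noteq> T3"
  then have "vol T3 *\<^sub>R facet_grad T3 S = vol T1 *\<^sub>R facet_grad T1 S"
    using facet_weights[OF T(2,3) _ S(2,3)] facet_weights[OF T(1,2) ne(1) S(1,2)] by simp
  then have "vol T1 *\<^sub>R facet_grad T1 S = - (vol T1 *\<^sub>R facet_grad T1 S)"
    using facet_weights[OF T(1,3) ne(2) S(1,3)] by simp
  then have "vol T1 *\<^sub>R facet_grad T1 S = 0"
    by (simp add: eq_neg_iff_add_eq_0 flip: scaleR_2)
  then show False using vol_pos[OF T(1)] facet_grad_nonzero[OF simplexD[OF T(1)] S(1)] by simp
qed

text \<open>Near the barycenter of \<open>S\<close> all other coordinates of both elements are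
  positive, and the two coordinates of \<open>S\<close> have opposite signs, so each nearby point
  lies in one of the elements. The barycenter is thus interior to the closure, and without slits it
  lies in \<Omega>.\<close>

lemma shared_facet_barycenter:
  assumes T: "T \<in> \<T>" "T' \<in> \<T>" "T \<noteq> T'" and S: "S facet_of T" "S facet_of T'"
  shows "barycenter S \<in> \<Omega>"
proof -
  define b where "b = barycenter S"
  obtain c where c: "c < 0" "\<And>x. facet_coord T' S x = c * facet_coord T S x"
    using facet_grad_opposite_direction[OF simplexD[OF T(1)] simplexD[OF T(2)] S interior_disjoint[OF T]] by metis
  have "open {x. \<forall>S'\<in>{S'. S' facet_of U \<and> S' \<noteq> S}. 0 < facet_coord U S' x}" if U: "U \<in> \<T>" for U
  proof -
    have "open (\<Inter>S'\<in>{S'. S' facet_of U \<and> S' \<noteq> S}. {x. 0 < facet_coord U S' x})"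
      using finite_facets[OF simplexD[OF U]] unfolding facet_coord_def
      by (intro open_INT ballI open_Collect_less continuous_intros) auto
    moreover have "(\<Inter>S'\<in>{S'. S' facet_of U \<and> S' \<noteq> S}. {x. 0 < facet_coord U S' x})
        = {x. \<forall>S'\<in>{S'. S' facet_of U \<and> S' \<noteq> S}. 0 < facet_coord U S' x}" by blast
    ultimately show ?thesis by (simp only:)
  qed
  note op = this
  define W where "W = {x. \<forall>S'\<in>{S'. S' facet_of T \<and> S' \<noteq> S}. 0 < facet_coord T S' x}
      \<inter> {x. \<forall>S'\<in>{S'. S' facet_of T' \<and> S' \<noteq> S}. 0 < facet_coord T' S' x}"
  have "open W" unfolding W_def using op T by blast
  moreover have "b \<in> W"
    using facet_coord_barycenter_facet[OF simplexD[OF T(1)] _ S(1)]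
      facet_coord_barycenter_facet[OF simplexD[OF T(2)] _ S(2)] by (simp add: W_def b_def)
  moreover have "W \<subseteq> closure \<Omega>"
  proof
    fix x assume x: "x \<in> W"
    show "x \<in> closure \<Omega>"
    proof (cases "facet_coord T S x \<ge> 0")
      case True
      have "0 \<le> facet_coord T S' x" if "S' facet_of T" for S'
        using x that True by (cases "S' = S") (simp_all add: W_def less_imp_le)
      then have "x \<in> T" using mem_simplex_facet_coord[OF simplexD[OF T(1)]] by blast
      then show ?thesis using element_subset T by blast
    next
      case False
      then have "0 \<le> facet_coord T' S x" using c by (simp add: mult_nonpos_nonpos)
      have "0 \<le> facet_coord T' S' x" if "S' facet_of T'" for S'
        using x that \<open>0 \<le> facet_coord T' S x\<close> by (cases "S' = S") (simp_all add: W_def less_imp_le)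
      then have "x \<in> T'" using mem_simplex_facet_coord[OF simplexD[OF T(2)]] by blast
      then show ?thesis using element_subset T by blast
    qed
  qed
  ultimately have "b \<in> interior (closure \<Omega>)" by (meson interiorI)
  then show ?thesis
    using interior_closure_domain by (auto simp: b_def)
qed

text \<open>A relative interior point of a facet inside \<open>\<Omega>\<close> is a limit of points beyond the facet, infinitely
  many of which lie in one other element; conformity makes the facet a facet of that element.\<close>

lemma unshared_facet_boundary:
  assumes T: "T \<in> \<T>" and S: "S facet_of T" and un: "\<And>T'. T' \<in> \<T> \<Longrightarrow> S facet_of T' \<Longrightarrow> T' = T"
  shows "S \<subseteq> frontier \<Omega>"
proof -
  have "rel_interior S \<inter> \<Omega> = {}"
  proof (rule ccontr)
    assume "rel_interior S \<inter> \<Omega> \<noteq> {}"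
    then obtain x where x: "x \<in> rel_interior S" "x \<in> \<Omega>" by blast
    have xS: "x \<in> S" using x rel_interior_subset by blast
    define n where "n = facet_grad T S"
    have n: "n \<bullet> n > 0" using facet_grad_nonzero[OF simplexD[OF T] S] by (simp add: n_def)
    have notT: "x - t *\<^sub>R n \<notin> T" if "t > 0" for t
    proof -
      have "facet_coord T S (x - t *\<^sub>R n) = facet_coord T S x - t * (n \<bullet> n)"
        by (simp add: facet_coord_def n_def inner_simps)
      also have "\<dots> < 0" using facet_coord_on_facet[OF simplexD[OF T] S xS] n that by simp
      finally show ?thesis unfolding mem_simplex_facet_coord[OF simplexD[OF T]] using S by force
    qed
    have lim: "((\<lambda>t. x - t *\<^sub>R n) \<longlongrightarrow> x - 0 *\<^sub>R n) (at_right 0)" by (intro tendsto_intros)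
    then have "\<forall>\<^sub>F t in at_right 0. x - t *\<^sub>R n \<in> \<Omega>"
      using topological_tendstoD[OF lim open_domain] x(2) by simp
    moreover have "\<forall>\<^sub>F t in at_right (0::real). 0 < t" by (simp add: eventually_at_right_less)
    ultimately have ev: "\<forall>\<^sub>F t in at_right 0. \<exists>T'\<in>\<T> - {T}. x - t *\<^sub>R n \<in> T'"
    proof eventually_elim
      case (elim t)
      then have "x - t *\<^sub>R n \<in> \<Union>\<T>" using Union_triangulation closure_subset by blast
      then show ?case using notT[OF elim(2)] by blast
    qed
    have "\<exists>T'\<in>\<T> - {T}. x \<in> T'"
    proof (rule ccontr)
      assume no: "\<not> (\<exists>T'\<in>\<T> - {T}. x \<in> T')"
      \<comment> \<open>The finitely many other elements form a closed set; were \<open>x\<close>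
        outside it, nearby points would be outside too, contrary to \<open>ev\<close>.\<close>
      have "closed (\<Union>(\<T> - {T}))"
        using compact_element compact_imp_closed by (intro closed_Union) auto
      then have "open (- \<Union>(\<T> - {T}))" by blast
      moreover have "x - 0 *\<^sub>R n \<in> - \<Union>(\<T> - {T})" using no by auto
      ultimately have "\<forall>\<^sub>F t in at_right 0. x - t *\<^sub>R n \<in> - \<Union>(\<T> - {T})"
        by (rule topological_tendstoD[OF lim])
      with ev have "\<forall>\<^sub>F t in at_right (0::real). False" by eventually_elim auto
      then show False by simp
    qed
    then obtain T' where T': "T' \<in> \<T>" "T' \<noteq> T" "x \<in> T'" by blast
    have xT: "x \<in> T" using xS facet_of_imp_subset[OF S] by blast
    have Tconv: "S \<subseteq> T" by (rule facet_of_imp_subset[OF S])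
    have "S \<subseteq> T \<inter> T'"
      using subset_of_face_of[OF face_Int[OF T T'(1)] Tconv] x(1) xT T'(3) by blast
    moreover have "T \<inter> T' \<noteq> T"
    proof
      assume "T \<inter> T' = T"
      then have "interior (T \<inter> T') \<noteq> {}" using barycenter_element[OF T] by auto
      then show False using overlapping_elements_eq[OF T T'(1)] T'(2) by blast
    qed
    \<comment> \<open>\<open>S\<close> has codimension one in \<open>T\<close>, so the dimension
      leaves no room for a face strictly between \<open>S\<close> and \<open>T\<close>.\<close>
    moreover have "T \<inter> T' = S"
    proof (rule ccontr)
      assume "T \<inter> T' \<noteq> S"
      have "S face_of (T \<inter> T')"
        using face_of_subset[OF facet_of_imp_face_of[OF S]] \<open>S \<subseteq> T \<inter> T'\<close> by blast
      moreover have "convex (T \<inter> T')" using convex_element T T' by (simp add: convex_Int)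
      ultimately have "aff_dim S < aff_dim (T \<inter> T')"
        using face_of_aff_dim_lt \<open>T \<inter> T' \<noteq> S\<close> by metis
      moreover have "aff_dim (T \<inter> T') < aff_dim T"
        using face_of_aff_dim_lt[OF convex_element[OF T] face_Int[OF T T'(1)]] \<open>T \<inter> T' \<noteq> T\<close> by blast
      ultimately show False using S by (simp add: facet_of_def)
    qed
    then have "S facet_of T'"
      using face_Int[OF T'(1) T] S aff_dim_simplex[OF simplexD[OF T]] aff_dim_simplex[OF simplexD[OF T'(1)]]
      by (simp add: facet_of_def Int_commute)
    then show False using un T' by blast
  qed
  \<comment> \<open>The relative interior of \<open>S\<close> misses the open set \<Omega>, hence so
    does its closure, which contains all of \<open>S\<close>.\<close>
  then have "\<Omega> \<inter> closure (rel_interior S) = {}"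
    using open_Int_closure_eq_empty[OF open_domain] by blast
  moreover have "convex S" using face_of_imp_convex facet_of_imp_face_of[OF S] by blast
  ultimately have "\<Omega> \<inter> S = {}" using convex_closure_rel_interior closure_subset by fastforce
  moreover have "S \<subseteq> closure \<Omega>" using facet_of_imp_subset[OF S] element_subset[OF T] by blast
  ultimately show ?thesis using open_domain by (auto simp: frontier_def interior_open)
qed

end


section \<open>Element-wise polynomials and projections\<close>

lemma polynomials_upto_0: "p \<in> polynomials_upto 0 \<longleftrightarrow> (\<exists>c. \<forall>x. p x = c)"
proof -
  let ?m = "\<lambda>b\<in>(Basis::'a set). 0::nat"
  have "{m. m \<in> (Basis::'a set) \<rightarrow>\<^sub>E {..0::nat} \<and> sum m Basis \<le> 0} = {?m}"
    by (auto simp: PiE_iff extensional_def restrict_def fun_eq_iff)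
  then have "p \<in> polynomials_upto 0 \<longleftrightarrow> (\<exists>c. \<forall>x. p x = c ?m)"
    unfolding polynomials_upto_def by simp
  also have "\<dots> \<longleftrightarrow> (\<exists>c. \<forall>x. p x = c)"
    by (metis (full_types))
  finally show ?thesis .
qed

lemma polynomials_upto_1:
  fixes p :: "'a::euclidean_space \<Rightarrow> real"
  shows "p \<in> polynomials_upto 1 \<longleftrightarrow> (\<exists>k m. \<forall>x. p x = k + m \<bullet> x)"
proof -
  let ?z = "\<lambda>b\<in>(Basis::'a set). 0::nat"
  \<comment> \<open>The unit multi-indices. They are restricted to \<open>Basis\<close> because the
    index set consists of extensional functions.\<close>
  define \<delta> where "\<delta> b = (\<lambda>j\<in>(Basis::'a set). if j = b then 1 else 0::nat)" for b :: 'a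
  have eq: "{m. m \<in> (Basis::'a set) \<rightarrow>\<^sub>E {..1::nat} \<and> sum m Basis \<le> 1} = insert ?z (\<delta> ` Basis)" (is "?A = _")
  proof (intro equalityI subsetI)
    fix m assume m: "m \<in> ?A"
    show "m \<in> insert ?z (\<delta> ` Basis)"
    proof (cases "\<forall>b\<in>Basis. m b = 0")
      case True
      then have "m = ?z" using m by (auto simp: PiE_iff extensional_def fun_eq_iff)
      then show ?thesis by simp
    next
      case False
      then obtain b where b: "b \<in> Basis" "m b \<noteq> 0" by blast
      have "sum m Basis = m b + sum m (Basis - {b})"
        using b(1) by (simp add: sum.remove)
      moreover have "sum m Basis \<le> 1" using m by blast
      ultimately have s: "m b = 1" "sum m (Basis - {b}) = 0" using b(2) by linarith+
      then have "m = \<delta> b" using m by (auto simp: PiE_iff extensional_def fun_eq_iff \<delta>_def)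
      then show ?thesis using b(1) by blast
    qed
  next
    fix m assume "m \<in> insert ?z (\<delta> ` Basis)"
    then show "m \<in> ?A" by (auto simp: \<delta>_def)
  qed
  have \<delta>b: "\<delta> b b = 1" if "b \<in> Basis" for b using that by (simp add: \<delta>_def)
  have notin: "?z \<notin> \<delta> ` Basis"
  proof
    assume "?z \<in> \<delta> ` Basis"
    then obtain b where "b \<in> Basis" "?z = \<delta> b" by blast
    then show False using \<delta>b[of b] by (metis restrict_apply' zero_neq_one)
  qed
  have inj: "inj_on \<delta> Basis"
  proof (rule inj_onI)
    fix b b' :: 'a assume b: "b \<in> Basis" "b' \<in> Basis" "\<delta> b = \<delta> b'"
    then have "\<delta> b' b = 1" using \<delta>b[OF b(1)] by simp
    then show "b = b'" using b(1) by (simp add: \<delta>_def split: if_splits)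
  qed
  have mon: "(\<Prod>j\<in>Basis. (x \<bullet> j) ^ \<delta> b j) = x \<bullet> b" if b: "b \<in> Basis" for b x :: 'a
  proof -
    have "(\<Prod>j\<in>Basis. (x \<bullet> j) ^ \<delta> b j) = (\<Prod>j\<in>Basis. if j = b then x \<bullet> b else 1)"
      by (intro prod.cong) (auto simp: \<delta>_def)
    then show ?thesis using b by simp
  qed
  have sum: "(\<Sum>m | m \<in> Basis \<rightarrow>\<^sub>E {..1} \<and> sum m Basis \<le> 1. c m * (\<Prod>b\<in>Basis. (x \<bullet> b) ^ m b))
      = c ?z + (\<Sum>b\<in>Basis. c (\<delta> b) * (x \<bullet> b))" for c and x :: 'a
    unfolding eq using notin by (simp add: sum.reindex[OF inj] mon)
  show ?thesis
  proof
    assume "p \<in> polynomials_upto 1"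
    then obtain c where c: "\<And>x. p x = c ?z + (\<Sum>b\<in>Basis. c (\<delta> b) * (x \<bullet> b))"
      unfolding polynomials_upto_def sum by blast
    have "p x = c ?z + (\<Sum>b\<in>Basis. c (\<delta> b) *\<^sub>R b) \<bullet> x" for x
      unfolding c inner_sum_left inner_scaleR_left by (simp add: inner_commute)
    then show "\<exists>k m. \<forall>x. p x = k + m \<bullet> x" by blast
  next
    assume "\<exists>k m. \<forall>x. p x = k + m \<bullet> x"
    then obtain k m where km: "\<And>x. p x = k + m \<bullet> x" by blast
    \<comment> \<open>The coefficient at \<open>\<delta> b\<close> has to be
      \<open>m \<bullet> b\<close>; the sum reads it off the multi-index without inverting
      \<delta>.\<close>
    define c where "c n = (if n = ?z then k else \<Sum>b\<in>Basis. real (n b) * (m \<bullet> b))" for n :: "'a \<Rightarrow> nat"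
    have "c (\<delta> b) = m \<bullet> b" if b: "b \<in> Basis" for b
    proof -
      have "\<delta> b \<noteq> ?z" using notin b by (metis imageI)
      then have "c (\<delta> b) = (\<Sum>j\<in>Basis. real (\<delta> b j) * (m \<bullet> j))" by (simp add: c_def)
      also have "\<dots> = (\<Sum>j\<in>Basis. if j = b then m \<bullet> b else 0)"
        by (intro sum.cong) (auto simp: \<delta>_def)
      finally show ?thesis using b by simp
    qed
    then have "(\<Sum>b\<in>Basis. c (\<delta> b) * (x \<bullet> b)) = m \<bullet> x" for x
      by (simp add: euclidean_inner[of m x])
    moreover have "c ?z = k" by (simp add: c_def)
    ultimately have "p x = c ?z + (\<Sum>b\<in>Basis. c (\<delta> b) * (x \<bullet> b))" for x
      by (simp add: km)
    then show "p \<in> polynomials_upto 1"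
      unfolding polynomials_upto_def sum by blast
  qed
qed

lemma pw_poly_0_iff:
  fixes p :: "'a::euclidean_space \<Rightarrow> 'b::euclidean_space"
  shows "p \<in> pw_poly 0 \<T> \<longleftrightarrow> (\<forall>T\<in>\<T>. \<exists>c. \<forall>x\<in>interior T. p x = c)"
proof -
  have "(\<forall>b\<in>Basis. \<exists>q\<in>polynomials_upto 0. \<forall>x\<in>interior T. p x \<bullet> b = q x) \<longleftrightarrow> (\<exists>c. \<forall>x\<in>interior T. p x = c)"
    (is "?l \<longleftrightarrow> ?r") for T
  proof
    assume ?l
    then have "\<forall>b\<in>Basis. \<exists>c. \<forall>x\<in>interior T. p x \<bullet> b = c"
      unfolding polynomials_upto_0 Bex_def by metis
    then obtain c where c: "\<And>b x. b \<in> Basis \<Longrightarrow> x \<in> interior T \<Longrightarrow> p x \<bullet> b = c b"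
      by metis
    have "p x = (\<Sum>b\<in>Basis. c b *\<^sub>R b)" if "x \<in> interior T" for x
    proof -
      have "p x = (\<Sum>b\<in>Basis. (p x \<bullet> b) *\<^sub>R b)" by (rule euclidean_representation[symmetric])
      also have "\<dots> = (\<Sum>b\<in>Basis. c b *\<^sub>R b)" by (intro sum.cong) (simp_all add: c[OF _ that])
      finally show ?thesis .
    qed
    then show ?r by blast
  next
    assume ?r
    then obtain c where "\<And>x. x \<in> interior T \<Longrightarrow> p x = c" by blast
    then have "\<exists>q\<in>polynomials_upto 0. \<forall>x\<in>interior T. p x \<bullet> b = q x" for b
      by (intro bexI[of _ "\<lambda>_. c \<bullet> b"]) (auto simp: polynomials_upto_0)
    then show ?l by blast
  qed
  then show ?thesis unfolding pw_poly_def by simp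
qed

lemma pw_poly_1_real_iff:
  fixes v :: "'a::euclidean_space \<Rightarrow> real"
  shows "v \<in> pw_poly 1 \<T> \<longleftrightarrow> (\<forall>T\<in>\<T>. \<exists>k m. \<forall>x\<in>interior T. v x = k + m \<bullet> x)"
proof -
  have "(\<exists>p\<in>polynomials_upto 1. \<forall>x\<in>interior T. v x = p x) \<longleftrightarrow> (\<exists>k m. \<forall>x\<in>interior T. v x = k + m \<bullet> x)" for T
    unfolding polynomials_upto_1 Bex_def by (auto simp: fun_eq_iff intro: exI[of _ "\<lambda>x. _ + _ \<bullet> x"]) blast
  then show ?thesis unfolding pw_poly_def by simp
qed

context triangulated_domain
begin

section \<open>Element-wise operators on affine functions\<close>

lemma grad_h_eq:
  assumes T: "T \<in> \<T>" and v: "\<And>x. x \<in> interior T \<Longrightarrow> v x = k + m \<bullet> x" and x: "x \<in> interior T"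
  shows "grad_h \<T> v x = m"
proof -
  have "((\<lambda>x. k + m \<bullet> x) has_derivative (\<lambda>h. h \<bullet> m)) (at x)"
    by (auto intro!: derivative_eq_intros simp: inner_commute)
  then have der: "(v has_derivative (\<lambda>h. h \<bullet> m)) (at x)"
    by (rule has_derivative_transform_within_open[OF _ open_interior x]) (simp add: v)
  have "(THE D. GDERIV v x :> D) = m"
  proof (rule the_equality)
    show "GDERIV v x :> m" using der by (simp add: gderiv_def)
    show "D = m" if "GDERIV v x :> D" for D
    proof -
      have "(\<lambda>h. h \<bullet> D) = (\<lambda>h. h \<bullet> m)"
        using has_derivative_unique[OF _ der] that by (simp add: gderiv_def)
      then show ?thesis by (metis vector_eq_ldot inner_commute)
    qed
  qed
  then show ?thesis using T x by (auto simp: grad_h_def)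
qed

lemma div_h_eq:
  assumes T: "T \<in> \<T>" and y: "\<And>x. x \<in> interior T \<Longrightarrow> y x = a + b *\<^sub>R x" and x: "x \<in> interior T"
  shows "div_h \<T> y x = b * DIM('a)"
proof -
  have "((\<lambda>x. a + b *\<^sub>R x) has_derivative (\<lambda>h. b *\<^sub>R h)) (at x)"
    by (auto intro!: derivative_eq_intros)
  then have "(y has_derivative (\<lambda>h. b *\<^sub>R h)) (at x)"
    by (rule has_derivative_transform_within_open[OF _ open_interior x]) (simp add: y)
  then have "frechet_derivative y (at x) = (\<lambda>h. b *\<^sub>R h)"
    by (rule frechet_derivative_at[symmetric])
  then have "(\<Sum>e\<in>Basis. frechet_derivative y (at x) e \<bullet> e) = (\<Sum>e\<in>(Basis::'a set). b)"
    by (intro sum.cong) simp_all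
  then show ?thesis using T x by (auto simp: div_h_def)
qed

text \<open>An element is the closure of its interior, so each of its points is a limit point of the
  interior and the limit in \<open>trace_from\<close> is unique.\<close>

lemma trace_from_eq:
  fixes f :: "'a \<Rightarrow> 'b::t2_space"
  assumes T: "T \<in> \<T>" and f: "continuous_on UNIV f" and v: "\<And>x. x \<in> interior T \<Longrightarrow> v x = f x" and x: "x \<in> T"
  shows "trace_from T v x = f x"
proof -
  have "x \<in> closure (interior T)" using closure_interior_element[OF T] x by simp
  then have "x islimpt interior T"
    unfolding closure_def using open_imp_islimpt[OF open_interior] by blast
  then have nt: "at x within interior T \<noteq> bot" by (simp add: trivial_limit_within)
  have "(f \<longlongrightarrow> f x) (at x within interior T)"
    using f by (meson UNIV_I continuous_on_def subset_UNIV tendsto_within_subset)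
  then have "(v \<longlongrightarrow> f x) (at x within interior T)"
    by (rule Lim_transform_eventually) (auto simp: eventually_at_filter v)
  then show ?thesis unfolding trace_from_def by (rule tendsto_Lim[OF nt])
qed

text \<open>The element means show that the choice in \<open>L2_proj\<close> has a witness.
  Conversely, any choice must have these means, as testing with fields supported in a single element
  shows.\<close>

lemma L2_proj_interior:
  fixes w :: "'a \<Rightarrow> 'b::euclidean_space"
  assumes w: "set_integrable lebesgue \<Omega> w"
  shows "L2_proj \<Omega> \<T> w \<in> pw_poly 0 \<T>"
    and "T \<in> \<T> \<Longrightarrow> x \<in> interior T \<Longrightarrow> vol T *\<^sub>R L2_proj \<Omega> \<T> w x = (LINT x:interior T|lebesgue. w x)"
proof -
  define P where "P p \<longleftrightarrow> p \<in> pw_poly 0 \<T> \<and>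
     (\<forall>q\<in>pw_poly 0 \<T>. (LINT x:\<Omega>|lebesgue. (w x - p x) \<bullet> q x) = 0)" for p
  define J where "J T = (LINT x:interior T|lebesgue. w x)" for T
  have wT: "set_integrable lebesgue (interior T) w" if "T \<in> \<T>" for T
    using set_integrable_subset[OF w _ interior_element_subset[OF that]] by simp
  have loc: "set_integrable lebesgue (interior T) (\<lambda>x. (w x - p x) \<bullet> q x)"
    "(LINT x:interior T|lebesgue. (w x - p x) \<bullet> q x) = (J T - vol T *\<^sub>R c) \<bullet> e"
    if T: "T \<in> \<T>" and p: "\<And>x. x \<in> interior T \<Longrightarrow> p x = c" and q: "\<And>x. x \<in> interior T \<Longrightarrow> q x = e"
    for T p q and c e :: 'b
  proof -
    note c = set_integrable_const_on_interior[OF T, of "\<lambda>_. c" c, OF refl]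
    have d: "set_integrable lebesgue (interior T) (\<lambda>x. w x - c)"
      by (rule set_integral_diff(1)[OF wT[OF T] c(1)])
    then have i: "set_integrable lebesgue (interior T) (\<lambda>x. (w x - c) \<bullet> e)"
      unfolding set_integrable_def using integrable_inner_left[of e] by (simp add: inner_scaleR_left[symmetric] del: inner_scaleR_left)
    then show "set_integrable lebesgue (interior T) (\<lambda>x. (w x - p x) \<bullet> q x)"
      by (subst set_integrable_cong[OF refl refl, where f'="\<lambda>x. (w x - c) \<bullet> e"]) (simp_all add: p q)
    have "(LINT x:interior T|lebesgue. (w x - p x) \<bullet> q x) = (LINT x:interior T|lebesgue. (w x - c) \<bullet> e)"
      by (intro set_lebesgue_integral_cong) (simp_all add: p q)
    also have "\<dots> = (LINT x:interior T|lebesgue. w x - c) \<bullet> e"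
      using d unfolding set_lebesgue_integral_def set_integrable_def
      by (subst integral_inner_left[symmetric]) simp_all
    also have "(LINT x:interior T|lebesgue. w x - c) = J T - vol T *\<^sub>R c"
      unfolding J_def c(2)[symmetric] by (rule set_integral_diff(2)[OF wT[OF T] c(1)])
    finally show "(LINT x:interior T|lebesgue. (w x - p x) \<bullet> q x) = (J T - vol T *\<^sub>R c) \<bullet> e" .
  qed
  define p0 where "p0 x = (\<Sum>T\<in>\<T>. indicator (interior T) x *\<^sub>R (J T /\<^sub>R vol T))" for x
  have p0: "p0 x = J T /\<^sub>R vol T" if T: "T \<in> \<T>" and x: "x \<in> interior T" for T x
  proof -
    have "p0 x = (\<Sum>T'\<in>\<T>. if T' = T then J T /\<^sub>R vol T else 0)"
      unfolding p0_def
    proof (intro sum.cong refl)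
      fix T' assume "T' \<in> \<T>"
      then show "indicator (interior T') x *\<^sub>R (J T' /\<^sub>R vol T') = (if T' = T then J T /\<^sub>R vol T else 0)"
        using interior_disjoint[of T' T] T x by (auto simp: indicator_def)
    qed
    then show ?thesis using T by simp
  qed
  have "P p0"
    unfolding P_def
  proof (intro conjI ballI)
    show "p0 \<in> pw_poly 0 \<T>" using p0 unfolding pw_poly_0_iff by blast
    fix q :: "'a \<Rightarrow> 'b" assume "q \<in> pw_poly 0 \<T>"
    then obtain e where e: "\<And>T x. T \<in> \<T> \<Longrightarrow> x \<in> interior T \<Longrightarrow> q x = e T"
      unfolding pw_poly_0_iff by metis
    have "(LINT x:\<Omega>|lebesgue. (w x - p0 x) \<bullet> q x) = (\<Sum>T\<in>\<T>. LINT x:interior T|lebesgue. (w x - p0 x) \<bullet> q x)"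
      by (rule set_integrable_elementwise(2)) (rule loc(1)[OF _ p0 e])
    also have "\<dots> = (\<Sum>T\<in>\<T>. (J T - vol T *\<^sub>R (J T /\<^sub>R vol T)) \<bullet> e T)"
      by (intro sum.cong refl loc(2) p0 e)
    also have "\<dots> = 0"
      using vol_pos by (intro sum.neutral) (simp add: less_imp_neq[symmetric])
    finally show "(LINT x:\<Omega>|lebesgue. (w x - p0 x) \<bullet> q x) = 0" .
  qed
  then have "P (SOME p. P p)" by (rule someI[of P])
  then have P: "P (L2_proj \<Omega> \<T> w)" unfolding L2_proj_def P_def .
  then show mem: "L2_proj \<Omega> \<T> w \<in> pw_poly 0 \<T>" by (simp add: P_def)
  then obtain c where c: "\<And>T x. T \<in> \<T> \<Longrightarrow> x \<in> interior T \<Longrightarrow> L2_proj \<Omega> \<T> w x = c T"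
    unfolding pw_poly_0_iff by metis
  assume T: "T \<in> \<T>" and x: "x \<in> interior T"
  have "(J T - vol T *\<^sub>R c T) \<bullet> e = 0" for e
  proof -
    \<comment> \<open>A constant vector on one element isolates that element in the orthogonality
      relation; \<open>e\<close> is arbitrary, so the whole vector is determined.\<close>
    define q where "q x = indicator (interior T) x *\<^sub>R e" for x
    have q: "q x = (if T' = T then e else 0)" if "T' \<in> \<T>" "x \<in> interior T'" for T' x
      using interior_disjoint[OF that(1) T] that(2) by (auto simp: q_def indicator_def)
    then have "q \<in> pw_poly 0 \<T>" unfolding pw_poly_0_iff by blast
    then have "0 = (LINT x:\<Omega>|lebesgue. (w x - L2_proj \<Omega> \<T> w x) \<bullet> q x)" using P by (simp add: P_def)
    also have "\<dots> = (\<Sum>T\<in>\<T>. LINT x:interior T|lebesgue. (w x - L2_proj \<Omega> \<T> w x) \<bullet> q x)"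
      by (rule set_integrable_elementwise(2)) (rule loc(1)[OF _ c q])
    also have "\<dots> = (\<Sum>T'\<in>\<T>. (J T' - vol T' *\<^sub>R c T') \<bullet> (if T' = T then e else 0))"
      by (intro sum.cong refl loc(2) c q)
    also have "\<dots> = (\<Sum>T'\<in>\<T>. if T' = T then (J T - vol T *\<^sub>R c T) \<bullet> e else 0)"
      by (intro sum.cong) auto
    finally show ?thesis using T by simp
  qed
  then have "J T - vol T *\<^sub>R c T = 0" by (metis inner_eq_zero_iff)
  then show "vol T *\<^sub>R L2_proj \<Omega> \<T> w x = (LINT x:interior T|lebesgue. w x)"
    using c[OF T x] by (simp add: J_def)
qed

lemma L2_proj_affine:
  fixes w :: "'a \<Rightarrow> 'b::euclidean_space"
  assumes w: "\<And>T. T \<in> \<T> \<Longrightarrow> \<exists>a L. linear L \<and> (\<forall>x\<in>interior T. w x = a + L x)"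
    and T: "T \<in> \<T>" and x: "x \<in> interior T"
  shows "L2_proj \<Omega> \<T> w x = w (barycenter T)"
proof -
  have "set_integrable lebesgue (interior T) w" if T: "T \<in> \<T>" for T
  proof -
    obtain a and L :: "'a \<Rightarrow> 'b" where "linear L" "\<And>x. x \<in> interior T \<Longrightarrow> w x = a + L x" using w[OF T] by blast
    then show ?thesis by (rule integral_affine_element(1)[OF T])
  qed
  then have i: "set_integrable lebesgue \<Omega> w" by (rule set_integrable_elementwise(1))
  obtain a and L :: "'a \<Rightarrow> 'b" where L: "linear L" "\<And>x. x \<in> interior T \<Longrightarrow> w x = a + L x" using w[OF T] by blast
  have "vol T *\<^sub>R L2_proj \<Omega> \<T> w x = vol T *\<^sub>R w (barycenter T)"
    using L2_proj_interior(2)[OF i T x] integral_affine_element(2)[OF T L] L(2)[OF barycenter_element[OF T]] by simp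
  then show ?thesis using vol_pos[OF T] by simp
qed

text \<open>On a bounded domain the constant 1 is integrable, and 1 + t^2 dominates the absolute
  value of t.\<close>

lemma L2_imp_integrable:
  assumes g: "in_L2 \<Omega> g"
  shows "set_integrable lebesgue \<Omega> g"
proof -
  have \<Omega>: "\<Omega> \<in> lmeasurable"
    using open_domain bounded_domain by (simp add: lmeasurable_open)
  have m: "(\<lambda>x. indicator \<Omega> x *\<^sub>R g x) \<in> borel_measurable lebesgue"
    using g by (simp add: in_L2_def set_borel_measurable_def)
  have i: "integrable lebesgue (\<lambda>x. indicator \<Omega> x * (1 + (g x)\<^sup>2))"
  proof -
    have "set_integrable lebesgue \<Omega> (\<lambda>x. 1 + (g x)\<^sup>2)"
    proof (rule set_integral_add(1))
      show "set_integrable lebesgue \<Omega> (\<lambda>x. 1::real)"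
        using \<Omega> by (simp add: absolutely_integrable_on_const)
      show "set_integrable lebesgue \<Omega> (\<lambda>x. (g x)\<^sup>2)"
        using g by (simp add: in_L2_def)
    qed
    then show ?thesis by (simp add: set_integrable_def)
  qed
  show ?thesis
    unfolding set_integrable_def
  proof (rule Bochner_Integration.integrable_bound[OF i m])
    have "\<bar>t\<bar> \<le> 1 + t\<^sup>2" for t :: real
    proof -
      have "0 \<le> (\<bar>t\<bar> - 1)\<^sup>2 + t\<^sup>2" by simp
      then show ?thesis by (simp add: power2_diff)
    qed
    then show "AE x in lebesgue. norm (indicator \<Omega> x *\<^sub>R g x) \<le> norm (indicator \<Omega> x * (1 + (g x)\<^sup>2))"
      by (intro AE_I2) (simp add: indicator_def)
  qed
qed

end


section \<open>Discrete integration by parts\<close>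

lemma f_reg_deriv:
  assumes "\<epsilon> > 0"
  shows "deriv (f_reg \<epsilon>) t = (1 - \<epsilon>) * t / sqrt (t\<^sup>2 + \<epsilon>\<^sup>2)"
proof (rule DERIV_imp_deriv)
  have "t\<^sup>2 + \<epsilon>\<^sup>2 > 0" using assms by (simp add: add_nonneg_pos)
  then show "(f_reg \<epsilon> has_field_derivative (1 - \<epsilon>) * t / sqrt (t\<^sup>2 + \<epsilon>\<^sup>2)) (at t)"
    unfolding f_reg_def[abs_def]
    by (auto intro!: derivative_eq_intros simp: field_simps) (simp add: diff_divide_distrib)
qed

text \<open>The factor \<open>t\<close> of the derivative cancels, and what is left is continuous at
  0. Both branches of \<open>f_reg_quot\<close> thus have one formula, and vanishing gradients need
  no separate case.\<close>

lemma f_reg_quot_eq: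
  assumes "\<epsilon> > 0"
  shows "f_reg_quot \<epsilon> t = (1 - \<epsilon>) / sqrt (t\<^sup>2 + \<epsilon>\<^sup>2)"
proof (cases "t = 0")
  case True
  have "((\<lambda>s. (1 - \<epsilon>) / sqrt (s\<^sup>2 + \<epsilon>\<^sup>2)) \<longlongrightarrow> (1 - \<epsilon>) / sqrt (0\<^sup>2 + \<epsilon>\<^sup>2)) (at 0)"
    using assms by (intro tendsto_intros) auto
  then have "((\<lambda>s. deriv (f_reg \<epsilon>) s / s) \<longlongrightarrow> (1 - \<epsilon>) / sqrt (0\<^sup>2 + \<epsilon>\<^sup>2)) (at 0)"
    by (rule Lim_transform_eventually) (auto simp: eventually_at_filter f_reg_deriv[OF assms])
  then have "Lim (at 0) (\<lambda>s. deriv (f_reg \<epsilon>) s / s) = (1 - \<epsilon>) / sqrt (0\<^sup>2 + \<epsilon>\<^sup>2)"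
    by (intro tendsto_Lim) auto
  then show ?thesis using True by (simp add: f_reg_quot_def)
qed (simp add: f_reg_quot_def f_reg_deriv[OF assms])

text \<open>The norm itself is not differentiable at 0, but its square is a polynomial in
  \<open>t\<close>, and \<epsilon> keeps the argument of the root positive.\<close>

lemma f_reg_has_derivative_line:
  fixes G H :: "'a::euclidean_space"
  assumes "\<epsilon> > 0"
  shows "((\<lambda>t. f_reg \<epsilon> (norm (G + t *\<^sub>R H))) has_field_derivative f_reg_quot \<epsilon> (norm G) * (G \<bullet> H)) (at 0)"
proof -
  have eq: "f_reg \<epsilon> (norm (G + t *\<^sub>R H)) = (1 - \<epsilon>) * sqrt (G \<bullet> G + 2 * t * (G \<bullet> H) + t\<^sup>2 * (H \<bullet> H) + \<epsilon>\<^sup>2)" for t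
  proof -
    have "(norm (G + t *\<^sub>R H))\<^sup>2 = G \<bullet> G + 2 * t * (G \<bullet> H) + t\<^sup>2 * (H \<bullet> H)"
      unfolding power2_norm_eq_inner
      by (simp add: inner_simps inner_commute[of H G] power2_eq_square algebra_simps)
    then show ?thesis by (simp add: f_reg_def)
  qed
  have pos: "G \<bullet> G + \<epsilon>\<^sup>2 > 0" using assms by (simp add: add_nonneg_pos)
  show ?thesis
    unfolding eq f_reg_quot_eq[OF assms] using pos
    by (auto intro!: derivative_eq_intros simp: power2_norm_eq_inner field_simps)
qed

lemma fenchel_young: "ereal (s * t - f t) \<le> fenchel_conjugate f s"
  unfolding fenchel_conjugate_def by (rule SUP_upper) simp

text \<open>The tangent to \<open>f_reg \<epsilon>\<close> at \<open>t\<close> lies below the graph, by the Cauchy--Schwarz inequality for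
  \<open>(r, \<epsilon>)\<close> and \<open>(t, \<epsilon>)\<close>.\<close>

lemma fenchel_conjugate_f_reg:
  assumes \<epsilon>: "0 < \<epsilon>" "\<epsilon> < 1"
  shows "fenchel_conjugate (f_reg \<epsilon>) (f_reg_quot \<epsilon> t * t) = ereal (f_reg_quot \<epsilon> t * t * t - f_reg \<epsilon> t)"
proof -
  define s where "s = f_reg_quot \<epsilon> t * t"
  have le: "s * r - f_reg \<epsilon> r \<le> s * t - f_reg \<epsilon> t" for r
  proof -
    define w where "w = sqrt (t\<^sup>2 + \<epsilon>\<^sup>2)"
    have w: "w > 0" "w\<^sup>2 = t\<^sup>2 + \<epsilon>\<^sup>2" using \<epsilon> by (simp_all add: w_def add_nonneg_pos)
    have "(r * t + \<epsilon>\<^sup>2)\<^sup>2 \<le> (r\<^sup>2 + \<epsilon>\<^sup>2) * (t\<^sup>2 + \<epsilon>\<^sup>2)"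
    proof -
      have "(r\<^sup>2 + \<epsilon>\<^sup>2) * (t\<^sup>2 + \<epsilon>\<^sup>2) - (r * t + \<epsilon>\<^sup>2)\<^sup>2 = (\<epsilon> * (r - t))\<^sup>2"
        by (simp add: power2_eq_square algebra_simps)
      then show ?thesis by (metis diff_ge_0_iff_ge zero_le_power2)
    qed
    then have "\<bar>r * t + \<epsilon>\<^sup>2\<bar> \<le> sqrt ((r\<^sup>2 + \<epsilon>\<^sup>2) * (t\<^sup>2 + \<epsilon>\<^sup>2))"
      by (metis real_sqrt_abs real_sqrt_le_iff)
    then have "r * t + \<epsilon>\<^sup>2 \<le> sqrt (r\<^sup>2 + \<epsilon>\<^sup>2) * w" by (simp add: real_sqrt_mult w_def)
    then have "(r * t + \<epsilon>\<^sup>2) / w \<le> sqrt (r\<^sup>2 + \<epsilon>\<^sup>2)" using w by (simp add: divide_le_eq)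
    moreover have "(r * t + \<epsilon>\<^sup>2) / w = w + (t * r - t * t) / w"
      using w by (simp add: field_simps power2_eq_square)
    ultimately have "w + (t * r - t * t) / w \<le> sqrt (r\<^sup>2 + \<epsilon>\<^sup>2)" by simp
    then have "(1 - \<epsilon>) * (w + (t * r - t * t) / w) \<le> (1 - \<epsilon>) * sqrt (r\<^sup>2 + \<epsilon>\<^sup>2)"
      using \<epsilon> by (intro mult_left_mono) auto
    moreover have "(1 - \<epsilon>) * (w + (t * r - t * t) / w) = f_reg \<epsilon> t + s * (r - t)"
    proof -
      have "f_reg \<epsilon> t = (1 - \<epsilon>) * w" "s = (1 - \<epsilon>) * t / w"
        by (simp_all add: f_reg_def w_def s_def f_reg_quot_eq \<epsilon>)
      then show ?thesis using w(1) by (simp only:) (simp add: field_simps)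
    qed
    ultimately have "f_reg \<epsilon> t + s * (r - t) \<le> f_reg \<epsilon> r" by (simp add: f_reg_def)
    then show ?thesis by (simp add: algebra_simps)
  qed
  have "fenchel_conjugate (f_reg \<epsilon>) s = ereal (s * t - f_reg \<epsilon> t)"
    unfolding fenchel_conjugate_def
    by (rule antisym) (auto intro!: SUP_least SUP_upper simp: le)
  then show ?thesis by (simp add: s_def)
qed

section \<open>Affine data on elements and integration by parts\<close>

context triangulated_domain
begin

text \<open>Value and gradient at the barycenter are the complete data of an affine function on an
  element. Everything later is written in them, which turns the functionals into finite
  sums.\<close>

lemma pw_poly_1_element:
  fixes v :: "'a \<Rightarrow> real"
  assumes v: "v \<in> pw_poly 1 \<T>" and T: "T \<in> \<T>"
  shows "x \<in> interior T \<Longrightarrow> grad_h \<T> v x = grad_h \<T> v (barycenter T)"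
    and "x \<in> interior T \<Longrightarrow> v x = v (barycenter T) + grad_h \<T> v (barycenter T) \<bullet> (x - barycenter T)"
    and "x \<in> T \<Longrightarrow> trace_from T v x = v (barycenter T) + grad_h \<T> v (barycenter T) \<bullet> (x - barycenter T)"
    and "x \<in> interior T \<Longrightarrow> L2_proj \<Omega> \<T> v x = v (barycenter T)"
proof -
  obtain k m where km: "\<And>x. x \<in> interior T \<Longrightarrow> v x = k + m \<bullet> x"
    using v T unfolding pw_poly_1_real_iff by blast
  have g: "grad_h \<T> v x = m" if "x \<in> interior T" for x by (rule grad_h_eq[OF T km that])
  note b = barycenter_element[OF T]
  show "x \<in> interior T \<Longrightarrow> grad_h \<T> v x = grad_h \<T> v (barycenter T)" by (simp add: g b)
  have e: "k + m \<bullet> x = v (barycenter T) + grad_h \<T> v (barycenter T) \<bullet> (x - barycenter T)" for x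
    by (simp add: g b km inner_diff_right)
  show "x \<in> interior T \<Longrightarrow> v x = v (barycenter T) + grad_h \<T> v (barycenter T) \<bullet> (x - barycenter T)"
    by (subst e[symmetric]) (rule km)
  show "trace_from T v x = v (barycenter T) + grad_h \<T> v (barycenter T) \<bullet> (x - barycenter T)" if "x \<in> T"
    by (subst e[symmetric]) (rule trace_from_eq[OF T _ km that], intro continuous_intros)
  show "L2_proj \<Omega> \<T> v x = v (barycenter T)" if "x \<in> interior T"
  proof (rule L2_proj_affine[OF _ T that])
    fix T' assume "T' \<in> \<T>"
    then obtain k m where km: "\<And>x. x \<in> interior T' \<Longrightarrow> v x = k + m \<bullet> x"
      using v unfolding pw_poly_1_real_iff by blast
    have "linear (\<lambda>x. m \<bullet> x)" by (rule linearI) (simp_all add: inner_simps)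
    then show "\<exists>a L. linear L \<and> (\<forall>x\<in>interior T'. v x = a + L x)" using km by blast
  qed
qed

text \<open>The identity has divergence d, so the slope of the field is the divergence divided by
  d.\<close>

lemma RT_element:
  fixes y :: "'a \<Rightarrow> 'a"
  assumes y: "\<And>T. T \<in> \<T> \<Longrightarrow> \<exists>a (b::real). \<forall>x\<in>interior T. y x = a + b *\<^sub>R x" and T: "T \<in> \<T>"
  shows "x \<in> interior T \<Longrightarrow> div_h \<T> y x = div_h \<T> y (barycenter T)"
    and "x \<in> interior T \<Longrightarrow> y x = y (barycenter T) + (div_h \<T> y (barycenter T) / DIM('a)) *\<^sub>R (x - barycenter T)"
    and "x \<in> T \<Longrightarrow> trace_from T y x = y (barycenter T) + (div_h \<T> y (barycenter T) / DIM('a)) *\<^sub>R (x - barycenter T)"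
    and "x \<in> interior T \<Longrightarrow> L2_proj \<Omega> \<T> y x = y (barycenter T)"
proof -
  obtain a and b :: real where ab: "\<And>x. x \<in> interior T \<Longrightarrow> y x = a + b *\<^sub>R x"
    using y[OF T] by blast
  have g: "div_h \<T> y x = b * DIM('a)" if "x \<in> interior T" for x by (rule div_h_eq[OF T ab that])
  note bT = barycenter_element[OF T]
  show "x \<in> interior T \<Longrightarrow> div_h \<T> y x = div_h \<T> y (barycenter T)" by (simp add: g bT)
  have e: "a + b *\<^sub>R x = y (barycenter T) + (div_h \<T> y (barycenter T) / DIM('a)) *\<^sub>R (x - barycenter T)" for x
    by (simp add: g bT ab algebra_simps)
  show "x \<in> interior T \<Longrightarrow> y x = y (barycenter T) + (div_h \<T> y (barycenter T) / DIM('a)) *\<^sub>R (x - barycenter T)"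
    by (subst e[symmetric]) (rule ab)
  show "trace_from T y x = y (barycenter T) + (div_h \<T> y (barycenter T) / DIM('a)) *\<^sub>R (x - barycenter T)" if "x \<in> T"
    by (subst e[symmetric]) (rule trace_from_eq[OF T _ ab that], intro continuous_intros)
  show "L2_proj \<Omega> \<T> y x = y (barycenter T)" if "x \<in> interior T"
  proof (rule L2_proj_affine[OF _ T that])
    fix T' assume "T' \<in> \<T>"
    then obtain a and b :: real where ab: "\<And>x. x \<in> interior T' \<Longrightarrow> y x = a + b *\<^sub>R x"
      using y by blast
    have "linear (\<lambda>x::'a. b *\<^sub>R x)" by (rule linearI) (simp_all add: algebra_simps)
    then show "\<exists>a L. linear L \<and> (\<forall>x\<in>interior T'. y x = a + L x)" using ab by blast
  qed
qed

lemma RT_affine: "y \<in> RT \<T> \<Longrightarrow> T \<in> \<T> \<Longrightarrow> \<exists>a (b::real). \<forall>x\<in>interior T. y x = a + b *\<^sub>R x"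
  unfolding RT_def mem_Collect_eq by (elim conjE) (rule bspec)

lemma RT_N_RT: "y \<in> RT_N \<Omega> \<T> \<Longrightarrow> y \<in> RT \<T>"
  unfolding RT_N_def mem_Collect_eq by (rule conjunct1)

lemma CR_pw_poly: "v \<in> CR \<T> \<Longrightarrow> v \<in> pw_poly 1 \<T>"
  unfolding CR_def mem_Collect_eq by (rule conjunct1)

text \<open>The divergence theorem on \<open>T\<close>, divided by \<open>vol T\<close>: here
  \<open>V\<close> and \<open>G\<close> are value and gradient of a scalar, \<open>Y\<close> and
  \<beta> value and slope of a field at the barycenter. The outer normal of \<open>S\<close>, scaled
  to the area of \<open>S\<close>, is \<open>- d * vol T\<close> times
  \<open>facet_grad T S\<close>.\<close>

lemma integration_by_parts_element:
  fixes V \<beta> :: real and G Y :: 'a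
  assumes T: "T \<in> \<T>"
  shows "G \<bullet> Y + V * (\<beta> * DIM('a)) = - DIM('a) * (\<Sum>S | S facet_of T.
    (V + G \<bullet> (barycenter S - barycenter T)) * (facet_grad T S \<bullet> (Y + \<beta> *\<^sub>R (barycenter S - barycenter T))))"
proof -
  define b where "b = barycenter T"
  define d where "d = real DIM('a)"
  have d: "d > 0" by (simp add: d_def)
  define w where "w S = V + G \<bullet> (barycenter S - b)" for S
  note T' = simplexD[OF T]
  have lb: "facet_coord T S b = 1 / (d + 1)" if "S facet_of T" for S
    using facet_coord_barycenter[OF T' that] by (simp add: b_def d_def)
  have ex: "V + G \<bullet> (x - b) = (\<Sum>S | S facet_of T. w S * (1 - d * facet_coord T S x))" for x
    unfolding w_def d_def by (rule CR_expansion_simplex[OF T'])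
  have V: "V = (\<Sum>S | S facet_of T. w S * (1 / (d + 1)))"
  proof -
    have "V = (\<Sum>S | S facet_of T. w S * (1 - d * facet_coord T S b))" using ex[of b] by simp
    also have "\<dots> = (\<Sum>S | S facet_of T. w S * (1 / (d + 1)))"
      using d by (intro sum.cong) (simp_all add: lb field_simps)
    finally show ?thesis .
  qed
  \<comment> \<open>Evaluating the expansion at \<open>b\<close> gives \<open>V\<close>, at
    \<open>b + Y\<close> it gives \<open>V + G \<bullet> Y\<close>; the difference isolates
    \<open>G \<bullet> Y\<close>.\<close>
  have "V + G \<bullet> Y = (\<Sum>S | S facet_of T. w S * (1 - d * facet_coord T S (b + Y)))"
    using ex[of "b + Y"] by simp
  also have "\<dots> = (\<Sum>S | S facet_of T. w S * (1 / (d + 1)) - d * (w S * (facet_grad T S \<bullet> Y)))"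
  proof (intro sum.cong refl)
    fix S assume "S \<in> {S. S facet_of T}"
    then have "facet_coord T S (b + Y) = 1 / (d + 1) + facet_grad T S \<bullet> Y"
      using lb[of S] by (simp add: facet_coord_def inner_simps)
    then show "w S * (1 - d * facet_coord T S (b + Y)) = w S * (1 / (d + 1)) - d * (w S * (facet_grad T S \<bullet> Y))"
      using d by (simp add: field_simps)
  qed
  also have "\<dots> = V - d * (\<Sum>S | S facet_of T. w S * (facet_grad T S \<bullet> Y))"
    by (simp only: sum_subtractf V[symmetric] sum_distrib_left)
  finally have GY: "G \<bullet> Y = - d * (\<Sum>S | S facet_of T. w S * (facet_grad T S \<bullet> Y))" by simp
  have "(\<Sum>S | S facet_of T. w S * (facet_grad T S \<bullet> (Y + \<beta> *\<^sub>R (barycenter S - b))))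
      = (\<Sum>S | S facet_of T. w S * (facet_grad T S \<bullet> Y) - \<beta> * (w S * (1 / (d + 1))))"
  proof (intro sum.cong refl)
    fix S assume "S \<in> {S. S facet_of T}"
    \<comment> \<open>The coordinate drops from 1/(d + 1) at \<open>b\<close> to 0 on
      \<open>S\<close>; this constant is also the weight in the formula for \<open>V\<close>, so the
      slope terms add up to a multiple of \<open>V\<close>.\<close>
    then have "facet_grad T S \<bullet> (barycenter S - b) = - (1 / (d + 1))"
      using lb[of S] by (simp add: facet_coord_def inner_simps)
    then show "w S * (facet_grad T S \<bullet> (Y + \<beta> *\<^sub>R (barycenter S - b)))
        = w S * (facet_grad T S \<bullet> Y) - \<beta> * (w S * (1 / (d + 1)))"
      by (simp only: inner_add_right inner_scaleR_right) (simp add: algebra_simps)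
  qed
  also have "\<dots> = (\<Sum>S | S facet_of T. w S * (facet_grad T S \<bullet> Y)) - \<beta> * V"
    by (simp only: sum_subtractf V[symmetric] sum_distrib_left[symmetric])
  finally have E: "(\<Sum>S | S facet_of T. w S * (facet_grad T S \<bullet> (Y + \<beta> *\<^sub>R (barycenter S - b))))
      = (\<Sum>S | S facet_of T. w S * (facet_grad T S \<bullet> Y)) - \<beta> * V" .
  show ?thesis
    unfolding b_def[symmetric] d_def[symmetric] w_def[symmetric] E GY by (simp add: d_def algebra_simps)
qed

lemma facet_grad_on_facet:
  assumes "T \<in> \<T>" "S facet_of T" "x \<in> S"
  shows "facet_grad T S \<bullet> (x - barycenter S) = 0"
  using facet_coord_on_facet[OF simplexD[OF assms(1)] assms(2,3)] by (simp add: facet_coord_def)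

lemma unit_normal_facet:
  assumes T: "T \<in> \<T>" and S: "S facet_of T"
  defines "m \<equiv> facet_grad T S"
  shows "unit_normal S (m /\<^sub>R norm m)"
proof -
  have "m \<noteq> 0" using facet_grad_nonzero[OF simplexD[OF T] S] by (simp add: m_def)
  moreover have "m \<bullet> (x - y) = 0" if "x \<in> S" "y \<in> S" for x y
    using facet_grad_on_facet[OF T S that(1)] facet_grad_on_facet[OF T S that(2)]
    by (simp add: m_def inner_simps)
  ultimately show ?thesis by (simp add: unit_normal_def inner_commute[of _ m])
qed

lemma unit_normal_parallel:
  assumes T: "T \<in> \<T>" and S: "S facet_of T" and n: "unit_normal S n"
  obtains c where "n = c *\<^sub>R facet_grad T S"
proof -
  have b: "barycenter S \<in> S" by (rule barycenter_facet_in_facet[OF simplexD[OF T] S])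
  have vanish: "- (n \<bullet> barycenter S) + n \<bullet> x = 0" if "x \<in> S" for x
  proof -
    have "(x - barycenter S) \<bullet> n = 0" using n that b unfolding unit_normal_def by blast
    then show ?thesis by (simp add: inner_diff_left inner_commute[of x n] inner_commute[of "barycenter S" n])
  qed
  show thesis
  proof (rule vanishing_on_facet_simplex[OF simplexD[OF T] S vanish])
    fix c assume "n = c *\<^sub>R facet_grad T S"
    then show thesis by (rule that)
  qed
qed

text \<open>The link between counting elements and position: a shared facet has its barycenter in
  the open set \<Omega>, so it cannot lie in the frontier, whereas an unshared one must.\<close>

lemma facet_elements_cases:
  assumes T: "T \<in> \<T>" and S: "S facet_of T"
  obtains "{T \<in> \<T>. S facet_of T} = {T}" "S \<subseteq> frontier \<Omega>"
  | T' where "T' \<in> \<T>" "T' \<noteq> T" "S facet_of T'" "{T \<in> \<T>. S facet_of T} = {T, T'}" "\<not> S \<subseteq> frontier \<Omega>"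
proof (cases "\<exists>T'\<in>\<T>. T' \<noteq> T \<and> S facet_of T'")
  case True
  then obtain T' where T': "T' \<in> \<T>" "T' \<noteq> T" "S facet_of T'" by blast
  have "U = T'" if "U \<in> \<T>" "S facet_of U" "U \<noteq> T" for U
    by (rule facet_at_most_two[OF T that(1) T'(1) S that(2) T'(3)]) (use that T' in auto)
  then have "{T \<in> \<T>. S facet_of T} = {T, T'}" using T T' S by blast
  moreover have "barycenter S \<in> \<Omega>"
    using shared_facet_barycenter[OF T T'(1) _ S T'(3)] T'(2) by blast
  then have "\<not> S \<subseteq> frontier \<Omega>"
    using barycenter_facet_in_facet[OF simplexD[OF T] S] open_domain
    by (auto simp: frontier_def interior_open)
  ultimately show ?thesis using that(2) T' by blast
next
  case False
  then have "{T \<in> \<T>. S facet_of T} = {T}" using T S by blast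
  moreover have "S \<subseteq> frontier \<Omega>"
    using False by (intro unshared_facet_boundary[OF T S]) blast
  ultimately show ?thesis by (rule that(1))
qed

lemma finite_all_facets: "finite {S. \<exists>T\<in>\<T>. S facet_of T}"
proof -
  have "{S. \<exists>T\<in>\<T>. S facet_of T} = (\<Union>T\<in>\<T>. {S. S facet_of T})" by blast
  then show ?thesis using finite_facets[OF simplexD] by simp
qed

lemma sum_facets_swap:
  fixes h :: "'a set \<Rightarrow> 'a set \<Rightarrow> real"
  shows "(\<Sum>T\<in>\<T>. \<Sum>S | S facet_of T. h T S) = (\<Sum>S | \<exists>T\<in>\<T>. S facet_of T. \<Sum>T | T \<in> \<T> \<and> S facet_of T. h T S)"
proof -
  let ?\<S> = "{S. \<exists>T\<in>\<T>. S facet_of T}"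
  have "(\<Sum>T\<in>\<T>. \<Sum>S | S facet_of T. h T S) = (\<Sum>T\<in>\<T>. \<Sum>S | S \<in> ?\<S> \<and> S facet_of T. h T S)"
  proof (intro sum.cong refl)
    fix T assume "T \<in> \<T>"
    then show "{S. S facet_of T} = {S. S \<in> ?\<S> \<and> S facet_of T}" by blast
  qed
  also have "\<dots> = (\<Sum>S\<in>?\<S>. \<Sum>T | T \<in> \<T> \<and> S facet_of T. h T S)"
    by (rule sum.swap_restrict) (simp_all add: finite_all_facets)
  finally show ?thesis .
qed

text \<open>After the sum is rearranged by facets, each trace enters only at the facet barycenter,
  the one point where Crouzeix--Raviart functions are required to be continuous. Boundary facets
  drop out because the normal component vanishes.\<close>

lemma integration_by_parts:
  assumes v: "v \<in> CR \<T>" and y: "y \<in> RT_N \<Omega> \<T>"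
  shows "(\<Sum>T\<in>\<T>. vol T * (grad_h \<T> v (barycenter T) \<bullet> y (barycenter T) + v (barycenter T) * div_h \<T> y (barycenter T))) = 0"
proof -
  define d where "d = real DIM('a)"
  define h where "h T S = vol T * (trace_from T v (barycenter S) * (facet_grad T S \<bullet> trace_from T y (barycenter S)))" for T S
  note yRT = RT_N_RT[OF y]
  have el: "vol T * (grad_h \<T> v (barycenter T) \<bullet> y (barycenter T) + v (barycenter T) * div_h \<T> y (barycenter T))
      = - d * (\<Sum>S | S facet_of T. h T S)" if T: "T \<in> \<T>" for T
  proof -
    define \<beta> where "\<beta> = div_h \<T> y (barycenter T) / d"
    have div: "div_h \<T> y (barycenter T) = \<beta> * real DIM('a)" by (simp add: \<beta>_def d_def)
    have "(\<Sum>S | S facet_of T. h T S) = (\<Sum>S | S facet_of T. vol T * ((v (barycenter T) + grad_h \<T> v (barycenter T) \<bullet> (barycenter S - barycenter T))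
        * (facet_grad T S \<bullet> (y (barycenter T) + \<beta> *\<^sub>R (barycenter S - barycenter T)))))"
    proof (intro sum.cong refl)
      fix S assume "S \<in> {S. S facet_of T}"
      then have "barycenter S \<in> T" using barycenter_facet_mem[OF simplexD[OF T]] by simp
      then show "h T S = vol T * ((v (barycenter T) + grad_h \<T> v (barycenter T) \<bullet> (barycenter S - barycenter T))
        * (facet_grad T S \<bullet> (y (barycenter T) + \<beta> *\<^sub>R (barycenter S - barycenter T))))"
        by (simp only: h_def \<beta>_def d_def pw_poly_1_element(3)[OF CR_pw_poly[OF v] T] RT_element(3)[OF RT_affine[OF yRT] T])
    qed
    then show ?thesis
      unfolding div integration_by_parts_element[OF T] by (simp add: d_def sum_distrib_left mult_ac)
  qed
  have zero: "(\<Sum>T | T \<in> \<T> \<and> S facet_of T. h T S) = 0" if "\<exists>T\<in>\<T>. S facet_of T" for S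
  proof -
    obtain T where T: "T \<in> \<T>" "S facet_of T" using \<open>\<exists>T\<in>\<T>. S facet_of T\<close> by blast
    define n where "n = facet_grad T S /\<^sub>R norm (facet_grad T S)"
    have n: "unit_normal S n" unfolding n_def by (rule unit_normal_facet[OF T])
    have m: "facet_grad T S = norm (facet_grad T S) *\<^sub>R n"
      using facet_grad_nonzero[OF simplexD[OF T(1)] T(2)] by (simp add: n_def)
    have b: "barycenter S \<in> S" by (rule barycenter_facet_in_facet[OF simplexD[OF T(1)] T(2)])
    show ?thesis
    proof (cases rule: facet_elements_cases[OF T])
      case 1
      have "trace_from T y (barycenter S) \<bullet> n = 0"
        using y T 1(2) n b unfolding RT_N_def by blast
      then have "facet_grad T S \<bullet> trace_from T y (barycenter S) = 0"
        by (subst m) (simp add: inner_commute)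
      then show ?thesis unfolding 1(1) by (simp add: h_def)
    next
      case (2 T')
      have "trace_from T y (barycenter S) \<bullet> n = trace_from T' y (barycenter S) \<bullet> n"
        using yRT T 2 n b unfolding RT_def by blast
      then have ty: "facet_grad T S \<bullet> trace_from T y (barycenter S) = facet_grad T S \<bullet> trace_from T' y (barycenter S)"
        by (subst (1 2) m) (simp add: inner_commute)
      have tv: "trace_from T v (barycenter S) = trace_from T' v (barycenter S)"
        using v T 2 unfolding CR_def by blast
      have w: "vol T' *\<^sub>R facet_grad T' S = - (vol T *\<^sub>R facet_grad T S)"
        using 2 by (intro facet_weights T) auto
      have hh: "h U S = trace_from U v (barycenter S) * ((vol U *\<^sub>R facet_grad U S) \<bullet> trace_from U y (barycenter S))" for U
        by (simp add: h_def)
      have "h T' S = - h T S"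
        unfolding hh w by (simp add: ty tv)
      then show ?thesis unfolding 2(4) using 2(2) by simp
    qed
  qed
  have "(\<Sum>T\<in>\<T>. vol T * (grad_h \<T> v (barycenter T) \<bullet> y (barycenter T) + v (barycenter T) * div_h \<T> y (barycenter T)))
      = - d * (\<Sum>T\<in>\<T>. \<Sum>S | S facet_of T. h T S)"
    by (simp add: el sum_distrib_left cong: sum.cong)
  also have "\<dots> = 0"
    unfolding sum_facets_swap using zero by (simp add: sum.neutral)
  finally show ?thesis .
qed

section \<open>Lines and basis functions in the Crouzeix--Raviart space\<close>

lemma CR_combination:
  fixes u \<phi> :: "'a \<Rightarrow> real" and t :: real
  assumes u: "u \<in> pw_poly 1 \<T>" and \<phi>: "\<phi> \<in> pw_poly 1 \<T>"
  defines "w \<equiv> \<lambda>x. u x + t * \<phi> x"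
  shows "w \<in> pw_poly 1 \<T>"
    and "T \<in> \<T> \<Longrightarrow> grad_h \<T> w (barycenter T) = grad_h \<T> u (barycenter T) + t *\<^sub>R grad_h \<T> \<phi> (barycenter T)"
    and "T \<in> \<T> \<Longrightarrow> x \<in> T \<Longrightarrow> trace_from T w x = trace_from T u x + t * trace_from T \<phi> x"
proof -
  have w: "w x = (u (barycenter T) + t * \<phi> (barycenter T)
      - (grad_h \<T> u (barycenter T) + t *\<^sub>R grad_h \<T> \<phi> (barycenter T)) \<bullet> barycenter T)
      + (grad_h \<T> u (barycenter T) + t *\<^sub>R grad_h \<T> \<phi> (barycenter T)) \<bullet> x"
    if "T \<in> \<T>" "x \<in> interior T" for T x
    unfolding w_def pw_poly_1_element(2)[OF u that] pw_poly_1_element(2)[OF \<phi> that]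
    by (simp add: inner_simps algebra_simps)
  show wp: "w \<in> pw_poly 1 \<T>" unfolding pw_poly_1_real_iff using w by blast
  show g: "grad_h \<T> w (barycenter T) = grad_h \<T> u (barycenter T) + t *\<^sub>R grad_h \<T> \<phi> (barycenter T)"
    if T: "T \<in> \<T>" for T
    by (rule grad_h_eq[OF T w[OF T] barycenter_element[OF T]])
  show "trace_from T w x = trace_from T u x + t * trace_from T \<phi> x" if T: "T \<in> \<T>" and x: "x \<in> T"
    unfolding pw_poly_1_element(3)[OF wp T x] pw_poly_1_element(3)[OF u T x]
      pw_poly_1_element(3)[OF \<phi> T x] g[OF T]
    by (simp add: w_def inner_simps algebra_simps)
qed

lemma CR_line:
  assumes u: "u \<in> CR \<T>" and \<phi>: "\<phi> \<in> CR \<T>"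
  shows "(\<lambda>x. u x + t * \<phi> x) \<in> CR \<T>"
proof -
  note c = CR_combination[OF CR_pw_poly[OF u] CR_pw_poly[OF \<phi>]]
  have "trace_from T (\<lambda>x. u x + t * \<phi> x) (barycenter S) = trace_from T' (\<lambda>x. u x + t * \<phi> x) (barycenter S)"
    if "T \<in> \<T>" "T' \<in> \<T>" "S facet_of T" "S facet_of T'" for T T' S
  proof -
    have "barycenter S \<in> T" "barycenter S \<in> T'"
      using that barycenter_facet_mem simplexD by blast+
    moreover have "trace_from T u (barycenter S) = trace_from T' u (barycenter S)"
      "trace_from T \<phi> (barycenter S) = trace_from T' \<phi> (barycenter S)"
      using u \<phi> that unfolding CR_def by blast+
    ultimately show ?thesis using that by (simp add: c(3))
  qed
  then show ?thesis using c(1) unfolding CR_def by blast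
qed

text \<open>The disjoint open interiors select one local shape function at a time. Traces are limits
  from inside an element, so the functions can be glued without values on the skeleton.\<close>

definition CR_basis :: "'a set \<Rightarrow> 'a \<Rightarrow> real" where
  "CR_basis S x = (\<Sum>T | T \<in> \<T> \<and> S facet_of T. indicator (interior T) x * (1 - DIM('a) * facet_coord T S x))"

lemma CR_basis_interior:
  assumes T: "T \<in> \<T>" and x: "x \<in> interior T"
  shows "CR_basis S x = (if S facet_of T then 1 - DIM('a) * facet_coord T S x else 0)"
proof -
  have "CR_basis S x = (\<Sum>T' | T' \<in> \<T> \<and> S facet_of T'. if T' = T then 1 - DIM('a) * facet_coord T S x else 0)"
    unfolding CR_basis_def
  proof (intro sum.cong refl)
    fix T' assume "T' \<in> {T'. T' \<in> \<T> \<and> S facet_of T'}"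
    then show "indicator (interior T') x * (1 - DIM('a) * facet_coord T' S x) = (if T' = T then 1 - DIM('a) * facet_coord T S x else 0)"
      using interior_disjoint[of T' T] T x by (auto simp: indicator_def)
  qed
  then show ?thesis using T by (simp add: sum.delta)
qed

text \<open>The coordinate of \<open>S\<close> is 0 at the barycenter of \<open>S\<close> and 1/d at
  those of the other facets; the factor d in \<open>CR_basis\<close> is what makes the traces
  nodal.\<close>

lemma CR_basis_pw_poly: "CR_basis S \<in> pw_poly 1 \<T>"
  and grad_CR_basis: "T \<in> \<T> \<Longrightarrow> grad_h \<T> (CR_basis S) (barycenter T) = (if S facet_of T then - (DIM('a) *\<^sub>R facet_grad T S) else 0)"
  and CR_basis_barycenter: "T \<in> \<T> \<Longrightarrow> CR_basis S (barycenter T) = (if S facet_of T then 1 / (DIM('a) + 1) else 0)"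
  and trace_CR_basis: "T \<in> \<T> \<Longrightarrow> S' facet_of T \<Longrightarrow> trace_from T (CR_basis S) (barycenter S') = (if S' = S then 1 else 0)"
proof -
  define k where "k T = (if S facet_of T then 1 + DIM('a) * (facet_grad T S \<bullet> barycenter S) else 0)" for T
  define m where "m T = (if S facet_of T then - (DIM('a) *\<^sub>R facet_grad T S) else 0)" for T
  have eq: "(if S facet_of T then 1 - DIM('a) * facet_coord T S x else 0) = k T + m T \<bullet> x" for T x
    by (simp add: k_def m_def facet_coord_def inner_simps algebra_simps)
  have i: "CR_basis S x = k T + m T \<bullet> x" if "T \<in> \<T>" "x \<in> interior T" for T x
    unfolding CR_basis_interior[OF that] by (rule eq)
  show "CR_basis S \<in> pw_poly 1 \<T>" unfolding pw_poly_1_real_iff using i by blast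
  show "grad_h \<T> (CR_basis S) (barycenter T) = (if S facet_of T then - (DIM('a) *\<^sub>R facet_grad T S) else 0)" if T: "T \<in> \<T>"
    using grad_h_eq[OF T i[OF T] barycenter_element[OF T]] by (simp add: m_def)
  show "CR_basis S (barycenter T) = (if S facet_of T then 1 / (DIM('a) + 1) else 0)" if T: "T \<in> \<T>"
    unfolding CR_basis_interior[OF T barycenter_element[OF T]]
    by (simp add: facet_coord_barycenter[OF simplexD[OF T]] field_simps)
  show "trace_from T (CR_basis S) (barycenter S') = (if S' = S then 1 else 0)" if T: "T \<in> \<T>" and S': "S' facet_of T"
  proof -
    have "trace_from T (CR_basis S) (barycenter S') = k T + m T \<bullet> barycenter S'"
      by (rule trace_from_eq[OF T _ i[OF T] barycenter_facet_mem[OF simplexD[OF T] S']]) (intro continuous_intros)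
    then have "trace_from T (CR_basis S) (barycenter S')
        = (if S facet_of T then 1 - DIM('a) * facet_coord T S (barycenter S') else 0)"
      unfolding eq .
    then show ?thesis
      using facet_coord_barycenter_facet[OF simplexD[OF T] _ S', of S] S' by (cases "S facet_of T") auto
  qed
qed

lemma CR_basis_CR: "CR_basis S \<in> CR \<T>"
proof -
  have "trace_from T (CR_basis S) (barycenter S') = trace_from T' (CR_basis S) (barycenter S')"
    if "T \<in> \<T>" "T' \<in> \<T>" "S' facet_of T" "S' facet_of T'" for T T' S'
    unfolding trace_CR_basis[OF that(1,3)] trace_CR_basis[OF that(2,4)] ..
  then show ?thesis unfolding CR_def using CR_basis_pw_poly by blast
qed

text \<open>The interior of an element is not negligible, so the condition holds at one of its
  points, and there \<epsilon> has the same value as at the barycenter.\<close>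

lemma AE_imp_element:
  assumes \<epsilon>: "\<epsilon> \<in> pw_poly 0 \<T>" and AE: "AE x in lebesgue. x \<in> \<Omega> \<longrightarrow> P (\<epsilon> x)" and T: "T \<in> \<T>"
  shows "P (\<epsilon> (barycenter T))"
proof -
  obtain c where c: "\<And>x. x \<in> interior T \<Longrightarrow> \<epsilon> x = c" using \<epsilon> T unfolding pw_poly_0_iff by blast
  have "\<exists>x\<in>interior T. P (\<epsilon> x)"
  proof (rule ccontr)
    assume no: "\<not> (\<exists>x\<in>interior T. P (\<epsilon> x))"
    have "AE x in lebesgue. x \<notin> interior T"
      using AE by (rule AE_mp) (use no interior_element_subset[OF T] in \<open>auto intro!: AE_I2\<close>)
    then have "negligible (interior T)"
      by (simp add: negligible_iff_null_sets AE_iff_null_sets)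
    moreover have "\<not> negligible (interior T)"
      using barycenter_element[OF T] by (intro open_not_negligible) auto
    ultimately show False by blast
  qed
  then show ?thesis using c barycenter_element[OF T] by metis
qed

end


section \<open>Duality\<close>

locale regularized_problem = triangulated_domain \<Omega> \<T>
  for \<Omega> :: "'a::euclidean_space set" and \<T> :: "'a set set" +
  fixes \<epsilon> g :: "'a \<Rightarrow> real" and \<alpha> :: real
  assumes \<alpha>_pos: "\<alpha> > 0"
    and g_pw: "g \<in> pw_poly 0 \<T>"
    and \<epsilon>_pw: "\<epsilon> \<in> pw_poly 0 \<T>"
    and \<epsilon>_range: "T \<in> \<T> \<Longrightarrow> 0 < \<epsilon> (barycenter T) \<and> \<epsilon> (barycenter T) < 1"
begin

abbreviation bc :: "'a set \<Rightarrow> 'a" where "bc \<equiv> barycenter"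

lemma pw_const:
  assumes "p \<in> pw_poly 0 \<T>" "T \<in> \<T>" "x \<in> interior T"
  shows "p x = p (bc T)"
proof -
  obtain c where "\<And>x. x \<in> interior T \<Longrightarrow> p x = c" using assms(1,2) unfolding pw_poly_0_iff by blast
  then show ?thesis using assms(3) barycenter_element[OF assms(2)] by simp
qed

lemmas \<epsilon>_const = pw_const[OF \<epsilon>_pw] and g_const = pw_const[OF g_pw]

section \<open>The two functionals as finite sums\<close>

lemma L2_norm_sq:
  assumes "\<And>T x. T \<in> \<T> \<Longrightarrow> x \<in> interior T \<Longrightarrow> F x = F (bc T)"
  shows "(L2_norm \<Omega> F)\<^sup>2 = (\<Sum>T\<in>\<T>. vol T * (F (bc T))\<^sup>2)"
proof -
  have "(LINT x:\<Omega>|lebesgue. (F x)\<^sup>2) = (\<Sum>T\<in>\<T>. vol T * (F (bc T))\<^sup>2)"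
    by (rule integral_elementwise_const) (simp only: assms)
  moreover have "(\<Sum>T\<in>\<T>. vol T * (F (bc T))\<^sup>2) \<ge> 0"
    by (intro sum_nonneg) simp
  ultimately show ?thesis by (simp add: L2_norm_def)
qed

lemma I_cr_eq:
  assumes v: "v \<in> pw_poly 1 \<T>"
  shows "I_cr \<Omega> \<T> \<epsilon> \<alpha> g v = (\<Sum>T\<in>\<T>. vol T *
    (f_reg (\<epsilon> (bc T)) (norm (grad_h \<T> v (bc T))) + \<alpha> / 2 * (v (bc T) - g (bc T))\<^sup>2))"
proof -
  note el = pw_poly_1_element[OF v]
  have "L1_norm \<Omega> (\<lambda>x. f_reg (\<epsilon> x) (norm (grad_h \<T> v x)))
      = (\<Sum>T\<in>\<T>. vol T * \<bar>f_reg (\<epsilon> (bc T)) (norm (grad_h \<T> v (bc T)))\<bar>)"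
    unfolding L1_norm_def
  proof (rule integral_elementwise_const)
    show "\<bar>f_reg (\<epsilon> x) (norm (grad_h \<T> v x))\<bar> = \<bar>f_reg (\<epsilon> (bc T)) (norm (grad_h \<T> v (bc T)))\<bar>"
      if "T \<in> \<T>" "x \<in> interior T" for T x
      unfolding \<epsilon>_const[OF that] el(1)[OF that] ..
  qed
  \<comment> \<open>The absolute value of the norm disappears because \<epsilon> < 1 makes
    \<open>f_reg\<close> nonnegative.\<close>
  also have "\<dots> = (\<Sum>T\<in>\<T>. vol T * f_reg (\<epsilon> (bc T)) (norm (grad_h \<T> v (bc T))))"
    using \<epsilon>_range by (intro sum.cong) (simp_all add: f_reg_def abs_mult less_imp_le)
  finally have L1: "L1_norm \<Omega> (\<lambda>x. f_reg (\<epsilon> x) (norm (grad_h \<T> v x)))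
      = (\<Sum>T\<in>\<T>. vol T * f_reg (\<epsilon> (bc T)) (norm (grad_h \<T> v (bc T))))" .
  have "(L2_norm \<Omega> (\<lambda>x. L2_proj \<Omega> \<T> v x - g x))\<^sup>2 = (\<Sum>T\<in>\<T>. vol T * (L2_proj \<Omega> \<T> v (bc T) - g (bc T))\<^sup>2)"
  proof (rule L2_norm_sq)
    show "L2_proj \<Omega> \<T> v x - g x = L2_proj \<Omega> \<T> v (bc T) - g (bc T)"
      if "T \<in> \<T>" "x \<in> interior T" for T x
      unfolding g_const[OF that] el(4)[OF that] el(4)[OF that(1) barycenter_element[OF that(1)]] ..
  qed
  also have "\<dots> = (\<Sum>T\<in>\<T>. vol T * (v (bc T) - g (bc T))\<^sup>2)"
  proof (intro sum.cong refl)
    show "vol T * (L2_proj \<Omega> \<T> v (bc T) - g (bc T))\<^sup>2 = vol T * (v (bc T) - g (bc T))\<^sup>2" if "T \<in> \<T>" for T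
      unfolding el(4)[OF that barycenter_element[OF that]] ..
  qed
  finally show ?thesis
    unfolding I_cr_def L1 by (simp add: sum.distrib sum_distrib_left algebra_simps)
qed

lemma ereal_integral_finite:
  assumes F: "\<And>T x. T \<in> \<T> \<Longrightarrow> x \<in> interior T \<Longrightarrow> F x = ereal (r T)"
  shows "ereal_integral \<Omega> F = ereal (\<Sum>T\<in>\<T>. vol T * r T)"
proof -
  have n: "(\<integral>\<^sup>+x\<in>\<Omega>. e2ennreal (H x) \<partial>lebesgue) = ennreal (\<Sum>T\<in>\<T>. max 0 (s T) * vol T)"
    if H: "\<And>T x. T \<in> \<T> \<Longrightarrow> x \<in> interior T \<Longrightarrow> H x = ereal (s T)" for H s
  proof -
    have "(\<integral>\<^sup>+x\<in>\<Omega>. e2ennreal (H x) \<partial>lebesgue) = (\<Sum>T\<in>\<T>. e2ennreal (H (bc T)) * ennreal (vol T))"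
      by (rule nn_integral_elementwise_const) (simp only: H barycenter_element)
    also have "\<dots> = (\<Sum>T\<in>\<T>. ennreal (max 0 (s T) * vol T))"
      by (intro sum.cong refl) (simp add: H barycenter_element e2ennreal_ereal ennreal_mult'' ennreal_max_0)
    also have "\<dots> = ennreal (\<Sum>T\<in>\<T>. max 0 (s T) * vol T)"
      by (intro sum_ennreal) simp
    finally show ?thesis .
  qed
  have m: "(\<integral>\<^sup>+x\<in>\<Omega>. e2ennreal (- F x) \<partial>lebesgue) = ennreal (\<Sum>T\<in>\<T>. max 0 (- r T) * vol T)"
    by (rule n) (simp add: F)
  have p: "(\<integral>\<^sup>+x\<in>\<Omega>. e2ennreal (F x) \<partial>lebesgue) = ennreal (\<Sum>T\<in>\<T>. max 0 (r T) * vol T)"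
    by (rule n) (rule F)
  have "ereal_integral \<Omega> F = ereal ((\<Sum>T\<in>\<T>. max 0 (r T) * vol T) - (\<Sum>T\<in>\<T>. max 0 (- r T) * vol T))"
    unfolding ereal_integral_def m p by (simp add: sum_nonneg)
  also have "(\<Sum>T\<in>\<T>. max 0 (r T) * vol T) - (\<Sum>T\<in>\<T>. max 0 (- r T) * vol T) = (\<Sum>T\<in>\<T>. vol T * r T)"
    unfolding sum_subtractf[symmetric] by (intro sum.cong) (auto simp: max_def algebra_simps)
  finally show ?thesis .
qed

text \<open>Since elements have positive volume, one infinite value makes the positive part
  infinite. The negative part is finite, so the difference does not rest on a convention for
  \<infinity> - \<infinity>.\<close>

lemma ereal_integral_infinite:
  assumes F: "\<And>T x. T \<in> \<T> \<Longrightarrow> x \<in> interior T \<Longrightarrow> F x = F (bc T)"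
    and T: "T \<in> \<T>" "F (bc T) = \<infinity>" and fin: "\<And>T. T \<in> \<T> \<Longrightarrow> F (bc T) \<noteq> -\<infinity>"
  shows "ereal_integral \<Omega> F = \<infinity>"
proof -
  have "(\<integral>\<^sup>+x\<in>\<Omega>. e2ennreal (F x) \<partial>lebesgue) = (\<Sum>T\<in>\<T>. e2ennreal (F (bc T)) * ennreal (vol T))"
    by (rule nn_integral_elementwise_const) (simp only: F)
  moreover have "e2ennreal (F (bc T)) * ennreal (vol T) = top"
    using vol_pos[OF T(1)] T(2) by (simp add: e2ennreal_infty ennreal_top_mult)
  moreover have "e2ennreal (F (bc T)) * ennreal (vol T) \<le> (\<Sum>T\<in>\<T>. e2ennreal (F (bc T)) * ennreal (vol T))"
    using T(1) by (intro member_le_sum) simp_all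
  ultimately have p: "(\<integral>\<^sup>+x\<in>\<Omega>. e2ennreal (F x) \<partial>lebesgue) = top"
    by (simp add: top.extremum_unique)
  have "(\<integral>\<^sup>+x\<in>\<Omega>. e2ennreal (- F x) \<partial>lebesgue) = (\<Sum>T\<in>\<T>. e2ennreal (- F (bc T)) * ennreal (vol T))"
    by (rule nn_integral_elementwise_const) (simp only: F)
  also have "\<dots> < top"
  proof -
    have "e2ennreal (- F (bc T)) * ennreal (vol T) < top" if "T \<in> \<T>" for T
      using fin[OF that] by (cases "F (bc T)") (auto simp: e2ennreal_ereal ennreal_mult_less_top e2ennreal_neg)
    then show ?thesis by simp
  qed
  finally have "(\<integral>\<^sup>+x\<in>\<Omega>. e2ennreal (- F x) \<partial>lebesgue) < top" .
  then obtain c where "(\<integral>\<^sup>+x\<in>\<Omega>. e2ennreal (- F x) \<partial>lebesgue) = ennreal c" "c \<ge> 0"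
    by (cases "\<integral>\<^sup>+x\<in>\<Omega>. e2ennreal (- F x) \<partial>lebesgue") auto
  then show ?thesis unfolding ereal_integral_def p by simp
qed

lemma conjugate_const:
  assumes y: "y \<in> RT \<T>" and T: "T \<in> \<T>" and x: "x \<in> interior T"
  shows "fenchel_conjugate (f_reg (\<epsilon> x)) (norm (L2_proj \<Omega> \<T> y x))
    = fenchel_conjugate (f_reg (\<epsilon> (bc T))) (norm (y (bc T)))"
proof -
  have "L2_proj \<Omega> \<T> y x = y (bc T)" by (rule RT_element(4)[OF RT_affine[OF y] T x])
  then show ?thesis by (simp only: \<epsilon>_const[OF T x])
qed

lemma D_rt_finite:
  assumes y: "y \<in> RT \<T>"
    and r: "\<And>T. T \<in> \<T> \<Longrightarrow> fenchel_conjugate (f_reg (\<epsilon> (bc T))) (norm (y (bc T))) = ereal (r T)"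
  shows "D_rt \<Omega> \<T> \<epsilon> \<alpha> g y = ereal (\<Sum>T\<in>\<T>. vol T *
    (- r T - 1 / (2 * \<alpha>) * (div_h \<T> y (bc T) + \<alpha> * g (bc T))\<^sup>2 + \<alpha> / 2 * (g (bc T))\<^sup>2))"
proof -
  have 1: "ereal_integral \<Omega> (\<lambda>x. fenchel_conjugate (f_reg (\<epsilon> x)) (norm (L2_proj \<Omega> \<T> y x))) = ereal (\<Sum>T\<in>\<T>. vol T * r T)"
    by (rule ereal_integral_finite) (rule trans[OF conjugate_const[OF y] r])
  have 2: "(L2_norm \<Omega> (\<lambda>x. div_h \<T> y x + \<alpha> * g x))\<^sup>2 = (\<Sum>T\<in>\<T>. vol T * (div_h \<T> y (bc T) + \<alpha> * g (bc T))\<^sup>2)"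
  proof (rule L2_norm_sq)
    fix T x assume T: "T \<in> \<T>" and x: "x \<in> interior T"
    have "div_h \<T> y x = div_h \<T> y (bc T)" by (rule RT_element(1)[OF RT_affine[OF y] T x])
    then show "div_h \<T> y x + \<alpha> * g x = div_h \<T> y (bc T) + \<alpha> * g (bc T)"
      by (simp only: g_const[OF T x])
  qed
  have 3: "(L2_norm \<Omega> g)\<^sup>2 = (\<Sum>T\<in>\<T>. vol T * (g (bc T))\<^sup>2)"
    by (rule L2_norm_sq) (rule g_const)
  have "- (\<Sum>T\<in>\<T>. vol T * r T) - 1 / (2 * \<alpha>) * (\<Sum>T\<in>\<T>. vol T * (div_h \<T> y (bc T) + \<alpha> * g (bc T))\<^sup>2)
      + \<alpha> / 2 * (\<Sum>T\<in>\<T>. vol T * (g (bc T))\<^sup>2)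
    = (\<Sum>T\<in>\<T>. - (vol T * r T) - 1 / (2 * \<alpha>) * (vol T * (div_h \<T> y (bc T) + \<alpha> * g (bc T))\<^sup>2) + \<alpha> / 2 * (vol T * (g (bc T))\<^sup>2))"
    by (simp only: sum.distrib sum_subtractf sum_negf sum_distrib_left)
  also have "\<dots> = (\<Sum>T\<in>\<T>. vol T *
    (- r T - 1 / (2 * \<alpha>) * (div_h \<T> y (bc T) + \<alpha> * g (bc T))\<^sup>2 + \<alpha> / 2 * (g (bc T))\<^sup>2))"
    by (intro sum.cong refl) (simp add: algebra_simps)
  finally show ?thesis
    unfolding D_rt_def 1 2 3 by simp
qed

text \<open>The conjugate is infinite where the norm of the field exceeds 1 - \<epsilon>, the
  asymptotic slope of \<open>f_reg\<close>. For such fields weak duality is trivial.\<close>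

lemma D_rt_infinite:
  assumes y: "y \<in> RT \<T>" and T: "T \<in> \<T>"
    and inf: "fenchel_conjugate (f_reg (\<epsilon> (bc T))) (norm (y (bc T))) = \<infinity>"
  shows "D_rt \<Omega> \<T> \<epsilon> \<alpha> g y = -\<infinity>"
proof -
  let ?F = "\<lambda>x. fenchel_conjugate (f_reg (\<epsilon> x)) (norm (L2_proj \<Omega> \<T> y x))"
  have F: "?F x = ?F (bc T)" if "T \<in> \<T>" "x \<in> interior T" for T x
    by (simp only: conjugate_const[OF y that] conjugate_const[OF y that(1) barycenter_element[OF that(1)]])
  have "?F (bc T) = \<infinity>"
    using inf by (simp only: conjugate_const[OF y T barycenter_element[OF T]])
  \<comment> \<open>The competitor \<open>t = 0\<close> in the supremum gives a real lower
    bound.\<close>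
  moreover have "fenchel_conjugate f s \<noteq> -\<infinity>" for f s
    using fenchel_young[of s 0 f] by auto
  ultimately have "ereal_integral \<Omega> ?F = \<infinity>"
    using ereal_integral_infinite[of ?F, OF F T] by blast
  then show ?thesis unfolding D_rt_def by simp
qed

lemma weak_duality:
  assumes v: "v \<in> CR \<T>" and y: "y \<in> RT_N \<Omega> \<T>"
  shows "D_rt \<Omega> \<T> \<epsilon> \<alpha> g y \<le> ereal (I_cr \<Omega> \<T> \<epsilon> \<alpha> g v)"
proof -
  define K where "K T = fenchel_conjugate (f_reg (\<epsilon> (bc T))) (norm (y (bc T)))" for T
  have Kn: "K T \<noteq> -\<infinity>" for T
    using fenchel_young[of "norm (y (bc T))" 0 "f_reg (\<epsilon> (bc T))"] by (auto simp: K_def)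
  show ?thesis
  proof (cases "\<exists>T\<in>\<T>. K T = \<infinity>")
    case True
    then obtain T where "T \<in> \<T>" "K T = \<infinity>" by blast
    then have "D_rt \<Omega> \<T> \<epsilon> \<alpha> g y = -\<infinity>"
      by (intro D_rt_infinite[OF RT_N_RT[OF y]]) (simp_all only: K_def)
    then show ?thesis by simp
  next
    case False
    define r where "r T = real_of_ereal (K T)" for T
    have r: "K T = ereal (r T)" if "T \<in> \<T>" for T
      using False Kn[of T] that by (cases "K T") (auto simp: r_def)
    define G where "G T = grad_h \<T> v (bc T)" for T
    define w where "w T = div_h \<T> y (bc T)" for T
    have D: "D_rt \<Omega> \<T> \<epsilon> \<alpha> g y = ereal (\<Sum>T\<in>\<T>. vol T *
        (- r T - 1 / (2 * \<alpha>) * (w T + \<alpha> * g (bc T))\<^sup>2 + \<alpha> / 2 * (g (bc T))\<^sup>2))"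
      unfolding w_def by (rule D_rt_finite[OF RT_N_RT[OF y]]) (simp only: K_def[symmetric] r)
    have I: "I_cr \<Omega> \<T> \<epsilon> \<alpha> g v = (\<Sum>T\<in>\<T>. vol T * (f_reg (\<epsilon> (bc T)) (norm (G T)) + \<alpha> / 2 * (v (bc T) - g (bc T))\<^sup>2))"
      unfolding G_def by (rule I_cr_eq[OF CR_pw_poly[OF v]])
    have "(- r T - 1 / (2 * \<alpha>) * (w T + \<alpha> * g (bc T))\<^sup>2 + \<alpha> / 2 * (g (bc T))\<^sup>2)
        \<le> f_reg (\<epsilon> (bc T)) (norm (G T)) + \<alpha> / 2 * (v (bc T) - g (bc T))\<^sup>2
          - (G T \<bullet> y (bc T) + v (bc T) * w T)" if T: "T \<in> \<T>" for T
    proof -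
      have "ereal (norm (y (bc T)) * norm (G T) - f_reg (\<epsilon> (bc T)) (norm (G T))) \<le> ereal (r T)"
        unfolding r[OF T, symmetric] K_def by (rule fenchel_young)
      then have "norm (y (bc T)) * norm (G T) - f_reg (\<epsilon> (bc T)) (norm (G T)) \<le> r T" by simp
      moreover have "G T \<bullet> y (bc T) \<le> norm (y (bc T)) * norm (G T)"
        using norm_cauchy_schwarz[of "G T" "y (bc T)"] by (simp add: mult.commute)
      \<comment> \<open>Fenchel--Young for the quadratic term, by completing the square. The gap
        vanishes for \<open>w T = \<alpha> * (v (bc T) - g (bc T))\<close>, which is the divergence
        relation of the flux.\<close>
      moreover have "v (bc T) * w T \<le> 1 / (2 * \<alpha>) * (w T + \<alpha> * g (bc T))\<^sup>2 - \<alpha> / 2 * (g (bc T))\<^sup>2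
          + \<alpha> / 2 * (v (bc T) - g (bc T))\<^sup>2"
      proof -
        have "1 / (2 * \<alpha>) * (w T + \<alpha> * g (bc T))\<^sup>2 - \<alpha> / 2 * (g (bc T))\<^sup>2
            + \<alpha> / 2 * (v (bc T) - g (bc T))\<^sup>2 - v (bc T) * w T
          = 1 / (2 * \<alpha>) * (w T + \<alpha> * g (bc T) - \<alpha> * v (bc T))\<^sup>2"
          using \<alpha>_pos by (simp add: field_simps power2_eq_square)
        moreover have "\<dots> \<ge> 0" using \<alpha>_pos by simp
        ultimately show ?thesis by linarith
      qed
      ultimately show ?thesis by linarith
    qed
    then have "(\<Sum>T\<in>\<T>. vol T * (- r T - 1 / (2 * \<alpha>) * (w T + \<alpha> * g (bc T))\<^sup>2 + \<alpha> / 2 * (g (bc T))\<^sup>2))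
        \<le> (\<Sum>T\<in>\<T>. vol T * (f_reg (\<epsilon> (bc T)) (norm (G T)) + \<alpha> / 2 * (v (bc T) - g (bc T))\<^sup>2
          - (G T \<bullet> y (bc T) + v (bc T) * w T)))"
      by (intro sum_mono mult_left_mono) simp_all
    also have "\<dots> = I_cr \<Omega> \<T> \<epsilon> \<alpha> g v - (\<Sum>T\<in>\<T>. vol T * (G T \<bullet> y (bc T) + v (bc T) * w T))"
      unfolding I by (simp only: right_diff_distrib sum_subtractf)
    also have "(\<Sum>T\<in>\<T>. vol T * (G T \<bullet> y (bc T) + v (bc T) * w T)) = 0"
      unfolding G_def w_def by (rule integration_by_parts[OF v y])
    finally show ?thesis unfolding D by simp
  qed
qed

section \<open>The flux of the minimizer\<close>

lemma flux_interior:
  assumes u: "u \<in> pw_poly 1 \<T>" and T: "T \<in> \<T>" and x: "x \<in> interior T"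
  shows "flux \<Omega> \<T> \<epsilon> \<alpha> g u x = f_reg_quot (\<epsilon> (bc T)) (norm (grad_h \<T> u (bc T))) *\<^sub>R grad_h \<T> u (bc T)
     + (\<alpha> * ((u (bc T) - g (bc T)) / DIM('a))) *\<^sub>R (x - bc T)"
proof -
  have "L2_proj \<Omega> \<T> (\<lambda>x. x) x = bc T"
  proof (rule L2_proj_affine[OF _ T x])
    have "linear (\<lambda>x::'a. x)" by (rule linear_ident)
    then show "\<exists>a L. linear L \<and> (\<forall>x\<in>interior T'. x = a + L x)" for T' :: "'a set"
      by (intro exI[of _ 0] exI[of _ "\<lambda>x. x"]) simp
  qed
  then show ?thesis
    unfolding flux_def \<epsilon>_const[OF T x] g_const[OF T x] pw_poly_1_element(1)[OF u T x] pw_poly_1_element(4)[OF u T x]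
    by simp
qed

text \<open>The two corrections in \<open>flux\<close> are independent: division by d turns the
  slope into the prescribed divergence, and subtracting the barycenter leaves the mean
  \<open>q\<close> unchanged.\<close>

lemma flux_affine:
  assumes u: "u \<in> pw_poly 1 \<T>" and T: "T \<in> \<T>"
  defines "q \<equiv> f_reg_quot (\<epsilon> (bc T)) (norm (grad_h \<T> u (bc T))) *\<^sub>R grad_h \<T> u (bc T)"
    and "b \<equiv> \<alpha> * ((u (bc T) - g (bc T)) / DIM('a))"
  shows "\<And>x. x \<in> interior T \<Longrightarrow> flux \<Omega> \<T> \<epsilon> \<alpha> g u x = (q - b *\<^sub>R bc T) + b *\<^sub>R x"
    and "flux \<Omega> \<T> \<epsilon> \<alpha> g u (bc T) = q"
    and "div_h \<T> (flux \<Omega> \<T> \<epsilon> \<alpha> g u) (bc T) = \<alpha> * (u (bc T) - g (bc T))"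
proof -
  show f: "flux \<Omega> \<T> \<epsilon> \<alpha> g u x = (q - b *\<^sub>R bc T) + b *\<^sub>R x" if "x \<in> interior T" for x
    unfolding flux_interior[OF u T that] q_def b_def by (simp add: algebra_simps)
  show "flux \<Omega> \<T> \<epsilon> \<alpha> g u (bc T) = q"
    unfolding f[OF barycenter_element[OF T]] by simp
  have "div_h \<T> (flux \<Omega> \<T> \<epsilon> \<alpha> g u) (bc T) = b * DIM('a)"
    by (rule div_h_eq[OF T _ barycenter_element[OF T]]) (rule f)
  then show "div_h \<T> (flux \<Omega> \<T> \<epsilon> \<alpha> g u) (bc T) = \<alpha> * (u (bc T) - g (bc T))"
    by (simp add: b_def)
qed

text \<open>Along the line through \<open>u\<close> in direction \<phi> the functional is a finite
  sum of differentiable functions of one real variable with a minimum at 0. Its derivative there is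
  the stated sum, once \<open>flux_affine\<close> identifies the coefficients.\<close>

lemma Euler_Lagrange:
  assumes min: "is_arg_min (I_cr \<Omega> \<T> \<epsilon> \<alpha> g) (\<lambda>v. v \<in> CR \<T>) u" and \<phi>: "\<phi> \<in> CR \<T>"
  shows "(\<Sum>T\<in>\<T>. vol T * (grad_h \<T> \<phi> (bc T) \<bullet> flux \<Omega> \<T> \<epsilon> \<alpha> g u (bc T)
    + \<phi> (bc T) * div_h \<T> (flux \<Omega> \<T> \<epsilon> \<alpha> g u) (bc T))) = 0"
proof -
  have u: "u \<in> CR \<T>" and le: "\<And>v. v \<in> CR \<T> \<Longrightarrow> I_cr \<Omega> \<T> \<epsilon> \<alpha> g u \<le> I_cr \<Omega> \<T> \<epsilon> \<alpha> g v"
    using min unfolding is_arg_min_def by (auto simp: not_less)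
  note pw = CR_pw_poly[OF u] CR_pw_poly[OF \<phi>]
  define J where "J t = (\<Sum>T\<in>\<T>. vol T * (f_reg (\<epsilon> (bc T)) (norm (grad_h \<T> u (bc T) + t *\<^sub>R grad_h \<T> \<phi> (bc T)))
    + \<alpha> / 2 * (u (bc T) + t * \<phi> (bc T) - g (bc T))\<^sup>2))" for t
  have J: "I_cr \<Omega> \<T> \<epsilon> \<alpha> g (\<lambda>x. u x + t * \<phi> x) = J t" for t
    unfolding I_cr_eq[OF CR_combination(1)[OF pw]] J_def
    by (intro sum.cong refl) (simp only: CR_combination(2)[OF pw])
  define l where "l = (\<Sum>T\<in>\<T>. vol T * (f_reg_quot (\<epsilon> (bc T)) (norm (grad_h \<T> u (bc T))) * (grad_h \<T> u (bc T) \<bullet> grad_h \<T> \<phi> (bc T))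
    + \<alpha> * (u (bc T) - g (bc T)) * \<phi> (bc T)))"
  have "(J has_field_derivative l) (at 0)"
    unfolding J_def[abs_def] l_def
  proof (intro DERIV_sum DERIV_cmult DERIV_add f_reg_has_derivative_line)
    fix T assume T: "T \<in> \<T>"
    show "0 < \<epsilon> (bc T)" using \<epsilon>_range[OF T] by simp
    show "((\<lambda>t. \<alpha> / 2 * (u (bc T) + t * \<phi> (bc T) - g (bc T))\<^sup>2) has_field_derivative \<alpha> * (u (bc T) - g (bc T)) * \<phi> (bc T)) (at 0)"
      by (auto intro!: derivative_eq_intros)
  qed
  moreover have "J 0 \<le> J t" for t
    using le[OF CR_line[OF u \<phi>, of t]] J[of t] J[of 0] by simp
  \<comment> \<open>The minimum at 0 is global on the line, so any radius, here 1, will do.\<close>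
  ultimately have "l = 0"
    by (intro DERIV_local_min[of J l 0 1]) auto
  moreover have "(\<Sum>T\<in>\<T>. vol T * (grad_h \<T> \<phi> (bc T) \<bullet> flux \<Omega> \<T> \<epsilon> \<alpha> g u (bc T)
    + \<phi> (bc T) * div_h \<T> (flux \<Omega> \<T> \<epsilon> \<alpha> g u) (bc T))) = l"
    unfolding l_def by (intro sum.cong refl) (simp add: flux_affine(2,3)[OF pw(1)] inner_commute)
  ultimately show ?thesis by simp
qed

text \<open>Testing the Euler--Lagrange equation with the basis function of a facet \<open>S\<close> leaves only the
  normal components on \<open>S\<close>.\<close>

lemma flux_facet_balance:
  assumes min: "is_arg_min (I_cr \<Omega> \<T> \<epsilon> \<alpha> g) (\<lambda>v. v \<in> CR \<T>) u"
  defines "z \<equiv> flux \<Omega> \<T> \<epsilon> \<alpha> g u"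
  shows "(\<Sum>T | T \<in> \<T> \<and> S facet_of T. vol T * (facet_grad T S \<bullet> trace_from T z (bc S))) = 0"
proof -
  define d where "d = real DIM('a)"
  have u: "u \<in> CR \<T>" using min unfolding is_arg_min_def by blast
  note pw = CR_pw_poly[OF u]
  have za: "\<exists>a (b::real). \<forall>x\<in>interior T. z x = a + b *\<^sub>R x" if "T \<in> \<T>" for T
    using flux_affine(1)[OF pw that] unfolding z_def by blast
  have el: "vol T * (grad_h \<T> (CR_basis S) (bc T) \<bullet> z (bc T) + CR_basis S (bc T) * div_h \<T> z (bc T))
      = (if S facet_of T then - d * (vol T * (facet_grad T S \<bullet> trace_from T z (bc S))) else 0)" if T: "T \<in> \<T>" for T
  proof (cases "S facet_of T")
    case True
    define \<beta> where "\<beta> = div_h \<T> z (bc T) / d"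
    have tr: "trace_from T z (bc S) = z (bc T) + \<beta> *\<^sub>R (bc S - bc T)"
      unfolding \<beta>_def d_def by (rule RT_element(3)[OF za T barycenter_facet_mem[OF simplexD[OF T] True]])
    have "facet_grad T S \<bullet> (bc T - bc S) = 1 / (d + 1)"
      using facet_coord_barycenter[OF simplexD[OF T] True] by (simp add: facet_coord_def d_def)
    then have m: "facet_grad T S \<bullet> (bc S - bc T) = - 1 / (d + 1)"
      by (simp add: inner_diff_right)
    \<comment> \<open>The value 1/(d + 1) of the basis function at the barycenter equals the drop of
      the coordinate of \<open>S\<close> towards \<open>S\<close>; so the divergence term supplies
      exactly the slope part of the trace on \<open>S\<close>.\<close>
    have "CR_basis S (bc T) * div_h \<T> z (bc T) = d * \<beta> / (d + 1)"
      using True by (simp add: CR_basis_barycenter[OF T] \<beta>_def d_def)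
    moreover have "grad_h \<T> (CR_basis S) (bc T) \<bullet> z (bc T) = - d * (facet_grad T S \<bullet> z (bc T))"
      using True by (simp add: grad_CR_basis[OF T] d_def)
    ultimately show ?thesis
      unfolding tr inner_add_right inner_scaleR_right m using True by (simp add: algebra_simps)
  next
    case False
    then show ?thesis by (simp add: grad_CR_basis[OF T] CR_basis_barycenter[OF T])
  qed
  have "0 = (\<Sum>T\<in>\<T>. vol T * (grad_h \<T> (CR_basis S) (bc T) \<bullet> z (bc T) + CR_basis S (bc T) * div_h \<T> z (bc T)))"
    unfolding z_def by (rule Euler_Lagrange[OF min CR_basis_CR, symmetric])
  also have "\<dots> = (\<Sum>T\<in>\<T>. if S facet_of T then - d * (vol T * (facet_grad T S \<bullet> trace_from T z (bc S))) else 0)"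
    by (intro sum.cong refl el)
  also have "\<dots> = (\<Sum>T | T \<in> \<T> \<and> S facet_of T. - d * (vol T * (facet_grad T S \<bullet> trace_from T z (bc S))))"
    by (rule sum.inter_filter[symmetric]) simp
  also have "\<dots> = - d * (\<Sum>T | T \<in> \<T> \<and> S facet_of T. vol T * (facet_grad T S \<bullet> trace_from T z (bc S)))"
    by (simp only: sum_distrib_left)
  finally show ?thesis by (simp add: d_def)
qed

text \<open>For a field \<open>a + b *\<^sub>R x\<close> the slope part is tangential along a facet,
  so its normal component is constant there. The single balance at the facet barycenter therefore
  settles continuity, or the boundary condition, on the whole facet.\<close>

lemma flux_RT_N:
  assumes min: "is_arg_min (I_cr \<Omega> \<T> \<epsilon> \<alpha> g) (\<lambda>v. v \<in> CR \<T>) u"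
  defines "z \<equiv> flux \<Omega> \<T> \<epsilon> \<alpha> g u"
  shows "z \<in> RT_N \<Omega> \<T>"
proof -
  have u: "u \<in> CR \<T>" using min unfolding is_arg_min_def by blast
  note pw = CR_pw_poly[OF u]
  have za: "\<exists>a (b::real). \<forall>x\<in>interior T. z x = a + b *\<^sub>R x" if "T \<in> \<T>" for T
    using flux_affine(1)[OF pw that] unfolding z_def by blast
  have poly: "z \<in> pw_poly 1 \<T>"
    unfolding pw_poly_def mem_Collect_eq
  proof (intro ballI)
    fix T and e :: 'a assume T: "T \<in> \<T>"
    obtain a and b :: real where ab: "\<And>x. x \<in> interior T \<Longrightarrow> z x = a + b *\<^sub>R x" using za[OF T] by blast
    have p: "(\<lambda>x. a \<bullet> e + (b *\<^sub>R e) \<bullet> x) \<in> polynomials_upto 1" unfolding polynomials_upto_1 by blast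
    have eq: "z x \<bullet> e = a \<bullet> e + (b *\<^sub>R e) \<bullet> x" if "x \<in> interior T" for x
      unfolding ab[OF that] inner_add_left inner_scaleR_left inner_commute[of x e] ..
    show "\<exists>p\<in>polynomials_upto 1. \<forall>x\<in>interior T. z x \<bullet> e = p x"
      by (rule bexI[OF _ p]) (intro ballI eq)
  qed
  have const: "facet_grad T S \<bullet> trace_from T z x = facet_grad T S \<bullet> trace_from T z (bc S)"
    if T: "T \<in> \<T>" and S: "S facet_of T" and x: "x \<in> S" for T S x
  proof -
    define \<beta> where "\<beta> = div_h \<T> z (bc T) / DIM('a)"
    have tr: "trace_from T z x = z (bc T) + \<beta> *\<^sub>R (x - bc T)" if "x \<in> T" for x
      unfolding \<beta>_def by (rule RT_element(3)[OF za T that])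
    have "trace_from T z x - trace_from T z (bc S) = \<beta> *\<^sub>R (x - bc S)"
      using x facet_of_imp_subset[OF S] barycenter_facet_mem[OF simplexD[OF T] S]
      by (simp add: tr subsetD algebra_simps)
    then have "facet_grad T S \<bullet> (trace_from T z x - trace_from T z (bc S)) = 0"
      using facet_grad_on_facet[OF T S x] by simp
    then show ?thesis by (simp add: inner_diff_right)
  qed
  have nconst: "trace_from T z x \<bullet> n = trace_from T z (bc S) \<bullet> n"
    if T: "T \<in> \<T>" and S: "S facet_of T" and n: "unit_normal S n" and x: "x \<in> S" for T S n x
  proof -
    obtain c where "n = c *\<^sub>R facet_grad T S" by (rule unit_normal_parallel[OF T S n])
    then show ?thesis using const[OF T S x] by (simp add: inner_commute[of _ "facet_grad T S"])
  qed
  have ncont: "trace_from T z x \<bullet> n = trace_from T' z x \<bullet> n"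
    if T: "T \<in> \<T>" "T' \<in> \<T>" and S: "S facet_of T" "S facet_of T'" and n: "unit_normal S n" and x: "x \<in> S" for T T' S n x
  proof (cases "T = T'")
    case False
    obtain c where c: "n = c *\<^sub>R facet_grad T S" by (rule unit_normal_parallel[OF T(1) S(1) n])
    have eq: "{T \<in> \<T>. S facet_of T} = {T, T'}"
    proof (cases rule: facet_elements_cases[OF T(1) S(1)])
      case 1
      then show ?thesis using False T S by blast
    next
      case (2 U)
      then show ?thesis using False T S by blast
    qed
    have "vol T * (facet_grad T S \<bullet> trace_from T z (bc S)) + vol T' * (facet_grad T' S \<bullet> trace_from T' z (bc S)) = 0"
      using flux_facet_balance[OF min, of S] False unfolding z_def[symmetric] eq by simp
    then have "(vol T *\<^sub>R facet_grad T S) \<bullet> trace_from T z (bc S) + (vol T' *\<^sub>R facet_grad T' S) \<bullet> trace_from T' z (bc S) = 0"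
      by simp
    then have "vol T * (facet_grad T S \<bullet> trace_from T z (bc S) - facet_grad T S \<bullet> trace_from T' z (bc S)) = 0"
      unfolding facet_weights[OF T False S] by (simp add: algebra_simps)
    then have "facet_grad T S \<bullet> trace_from T z (bc S) = facet_grad T S \<bullet> trace_from T' z (bc S)"
      using vol_pos[OF T(1)] by simp
    then have "trace_from T z (bc S) \<bullet> n = trace_from T' z (bc S) \<bullet> n"
      by (simp add: c inner_commute[of _ "facet_grad T S"])
    then show ?thesis using nconst[OF T(1) S(1) n x] nconst[OF T(2) S(2) n x] by simp
  qed simp
  have nbd: "trace_from T z x \<bullet> n = 0"
    if T: "T \<in> \<T>" and S: "S facet_of T" "S \<subseteq> frontier \<Omega>" and n: "unit_normal S n" and x: "x \<in> S" for T S n x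
  proof -
    obtain c where c: "n = c *\<^sub>R facet_grad T S" by (rule unit_normal_parallel[OF T S(1) n])
    have eq: "{T \<in> \<T>. S facet_of T} = {T}"
    proof (cases rule: facet_elements_cases[OF T S(1)])
      case (2 U)
      then show ?thesis using S(2) by blast
    qed
    have "facet_grad T S \<bullet> trace_from T z (bc S) = 0"
      using flux_facet_balance[OF min, of S] vol_pos[OF T] unfolding z_def[symmetric] eq by simp
    then show ?thesis
      using nconst[OF T S(1) n x] by (simp add: c inner_commute[of _ "facet_grad T S"])
  qed
  have "z \<in> RT \<T>"
    unfolding RT_def mem_Collect_eq
  proof (intro conjI poly ballI za allI impI)
    show "\<exists>c. \<forall>x\<in>S. trace_from T z x \<bullet> n = c" if "T \<in> \<T>" "S facet_of T \<and> unit_normal S n" for T S n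
      using nconst that by blast
    show "trace_from T z x \<bullet> n = trace_from T' z x \<bullet> n"
      if "T \<in> \<T>" "T' \<in> \<T>" "S facet_of T \<and> S facet_of T' \<and> unit_normal S n" "x \<in> S" for T T' S n x
      using ncont that by blast
  qed
  then show ?thesis
    unfolding RT_N_def mem_Collect_eq
  proof (intro conjI ballI allI impI)
    show "trace_from T z x \<bullet> n = 0" if "T \<in> \<T>" "S facet_of T \<and> S \<subseteq> frontier \<Omega> \<and> unit_normal S n" "x \<in> S" for T S n x
      using nbd that by blast
  qed
qed

text \<open>At the flux both estimates behind weak duality are equalities on each element:
  \<open>z\<close> is parallel to the gradient with norm the derivative of \<open>f_reg\<close>,
  where the conjugate is attained, and the completed square vanishes. What remains is the
  Euler--Lagrange sum for the test function \<open>u\<close>.\<close>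

lemma strong_duality:
  assumes min: "is_arg_min (I_cr \<Omega> \<T> \<epsilon> \<alpha> g) (\<lambda>v. v \<in> CR \<T>) u"
  defines "z \<equiv> flux \<Omega> \<T> \<epsilon> \<alpha> g u"
  shows "ereal (I_cr \<Omega> \<T> \<epsilon> \<alpha> g u) = D_rt \<Omega> \<T> \<epsilon> \<alpha> g z"
proof -
  have u: "u \<in> CR \<T>" using min unfolding is_arg_min_def by blast
  note pw = CR_pw_poly[OF u]
  define G where "G T = grad_h \<T> u (bc T)" for T
  define q where "q T = f_reg_quot (\<epsilon> (bc T)) (norm (G T))" for T
  define r where "r T = q T * norm (G T) * norm (G T) - f_reg (\<epsilon> (bc T)) (norm (G T))" for T
  have z: "z (bc T) = q T *\<^sub>R G T" "div_h \<T> z (bc T) = \<alpha> * (u (bc T) - g (bc T))" if T: "T \<in> \<T>" for T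
    using flux_affine(2,3)[OF pw T] by (simp_all add: z_def q_def G_def)
  have zRT: "z \<in> RT \<T>" unfolding z_def by (rule RT_N_RT[OF flux_RT_N[OF min]])
  have "D_rt \<Omega> \<T> \<epsilon> \<alpha> g z = ereal (\<Sum>T\<in>\<T>. vol T *
    (- r T - 1 / (2 * \<alpha>) * (div_h \<T> z (bc T) + \<alpha> * g (bc T))\<^sup>2 + \<alpha> / 2 * (g (bc T))\<^sup>2))"
  proof (rule D_rt_finite[OF zRT])
    fix T assume T: "T \<in> \<T>"
    have \<epsilon>: "0 < \<epsilon> (bc T)" "\<epsilon> (bc T) < 1" using \<epsilon>_range[OF T] by simp_all
    \<comment> \<open>Nonnegativity, due to \<epsilon> < 1, lets \<open>q T\<close> leave the norm;
      the conjugate is then evaluated at the slope of \<open>f_reg\<close> at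
      \<open>norm (G T)\<close>.\<close>
    then have "q T \<ge> 0" by (simp add: q_def f_reg_quot_eq)
    then have "norm (z (bc T)) = q T * norm (G T)" by (simp add: z(1)[OF T])
    then show "fenchel_conjugate (f_reg (\<epsilon> (bc T))) (norm (z (bc T))) = ereal (r T)"
      using fenchel_conjugate_f_reg[OF \<epsilon>, of "norm (G T)"] by (simp add: r_def q_def)
  qed
  also have "(\<Sum>T\<in>\<T>. vol T *
      (- r T - 1 / (2 * \<alpha>) * (div_h \<T> z (bc T) + \<alpha> * g (bc T))\<^sup>2 + \<alpha> / 2 * (g (bc T))\<^sup>2))
    = (\<Sum>T\<in>\<T>. vol T * (f_reg (\<epsilon> (bc T)) (norm (G T)) + \<alpha> / 2 * (u (bc T) - g (bc T))\<^sup>2)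
        - vol T * (G T \<bullet> z (bc T) + u (bc T) * div_h \<T> z (bc T)))"
  proof (intro sum.cong refl)
    fix T assume T: "T \<in> \<T>"
    \<comment> \<open>The divergence relation cancels the data inside the square.\<close>
    have "1 / (2 * \<alpha>) * (\<alpha> * (u (bc T) - g (bc T)) + \<alpha> * g (bc T))\<^sup>2 = \<alpha> / 2 * (u (bc T))\<^sup>2"
      using \<alpha>_pos by (simp add: field_simps power2_eq_square)
    moreover have "G T \<bullet> z (bc T) = q T * norm (G T) * norm (G T)"
      by (simp add: z(1)[OF T] dot_square_norm power2_eq_square)
    ultimately show "vol T * (- r T - 1 / (2 * \<alpha>) * (div_h \<T> z (bc T) + \<alpha> * g (bc T))\<^sup>2 + \<alpha> / 2 * (g (bc T))\<^sup>2)
      = vol T * (f_reg (\<epsilon> (bc T)) (norm (G T)) + \<alpha> / 2 * (u (bc T) - g (bc T))\<^sup>2)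
        - vol T * (G T \<bullet> z (bc T) + u (bc T) * div_h \<T> z (bc T))"
      unfolding z(2)[OF T] r_def by (simp only:) (simp add: field_simps power2_eq_square)
  qed
  also have "\<dots> = I_cr \<Omega> \<T> \<epsilon> \<alpha> g u"
    using Euler_Lagrange[OF min u] unfolding I_cr_eq[OF pw] sum_subtractf G_def z_def by simp
  finally show ?thesis by simp
qed

end

theorem proposition4p5:
  fixes \<Omega> :: "'a::euclidean_space set" and \<T> :: "'a set set"
    and g g\<^sub>h \<epsilon>\<^sub>h :: "'a \<Rightarrow> real" and \<alpha> :: real
  assumes "polyhedral_Lipschitz_domain \<Omega>"
    and "conforming_triangulation \<Omega> \<T>"
    and "in_L2 \<Omega> g"
    and "\<alpha> > 0"
    and "g\<^sub>h = L2_proj \<Omega> \<T> g"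
    and "\<epsilon>\<^sub>h \<in> pw_poly 0 \<T>"
    and "AE x in lebesgue. x \<in> \<Omega> \<longrightarrow> 0 < \<epsilon>\<^sub>h x \<and> \<epsilon>\<^sub>h x < 1"
  shows "(INF v\<in>CR \<T>. ereal (I_cr \<Omega> \<T> \<epsilon>\<^sub>h \<alpha> g\<^sub>h v)) \<ge> (SUP y\<in>RT_N \<Omega> \<T>. D_rt \<Omega> \<T> \<epsilon>\<^sub>h \<alpha> g\<^sub>h y)
    \<and> (\<forall>u z. is_arg_min (I_cr \<Omega> \<T> \<epsilon>\<^sub>h \<alpha> g\<^sub>h) (\<lambda>v. v \<in> CR \<T>) u \<and> z = flux \<Omega> \<T> \<epsilon>\<^sub>h \<alpha> g\<^sub>h u \<longrightarrow>
         (z \<in> RT_N \<Omega> \<T>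
          \<and> pw_eq \<T> (div_h \<T> z) (\<lambda>x. \<alpha> * (L2_proj \<Omega> \<T> u x - g\<^sub>h x))
          \<and> pw_eq \<T> (L2_proj \<Omega> \<T> z)
              (\<lambda>x. f_reg_quot (\<epsilon>\<^sub>h x) (norm (grad_h \<T> u x)) *\<^sub>R grad_h \<T> u x))
         \<and> is_arg_max (D_rt \<Omega> \<T> \<epsilon>\<^sub>h \<alpha> g\<^sub>h) (\<lambda>y. y \<in> RT_N \<Omega> \<T>) z
         \<and> ereal (I_cr \<Omega> \<T> \<epsilon>\<^sub>h \<alpha> g\<^sub>h u) = D_rt \<Omega> \<T> \<epsilon>\<^sub>h \<alpha> g\<^sub>h z)"
proof -
  interpret triangulated_domain \<Omega> \<T>
    using assms(1,2) by unfold_locales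
  interpret regularized_problem \<Omega> \<T> \<epsilon>\<^sub>h g\<^sub>h \<alpha>
  proof unfold_locales
    show "g\<^sub>h \<in> pw_poly 0 \<T>"
      unfolding assms(5) by (rule L2_proj_interior(1)[OF L2_imp_integrable[OF assms(3)]])
    show "0 < \<epsilon>\<^sub>h (barycenter T) \<and> \<epsilon>\<^sub>h (barycenter T) < 1" if "T \<in> \<T>" for T
      by (rule AE_imp_element[OF assms(6,7) that])
  qed (use assms in auto)
  show ?thesis
  proof (intro conjI allI impI)
    show "(SUP y\<in>RT_N \<Omega> \<T>. D_rt \<Omega> \<T> \<epsilon>\<^sub>h \<alpha> g\<^sub>h y) \<le> (INF v\<in>CR \<T>. ereal (I_cr \<Omega> \<T> \<epsilon>\<^sub>h \<alpha> g\<^sub>h v))"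
      by (intro SUP_least INF_greatest weak_duality)
    fix u z assume uz: "is_arg_min (I_cr \<Omega> \<T> \<epsilon>\<^sub>h \<alpha> g\<^sub>h) (\<lambda>v. v \<in> CR \<T>) u \<and> z = flux \<Omega> \<T> \<epsilon>\<^sub>h \<alpha> g\<^sub>h u"
    then have min: "is_arg_min (I_cr \<Omega> \<T> \<epsilon>\<^sub>h \<alpha> g\<^sub>h) (\<lambda>v. v \<in> CR \<T>) u" and z: "z = flux \<Omega> \<T> \<epsilon>\<^sub>h \<alpha> g\<^sub>h u"
      by blast+
    have u: "u \<in> CR \<T>" using min unfolding is_arg_min_def by blast
    note pw = CR_pw_poly[OF u]
    show mem: "z \<in> RT_N \<Omega> \<T>" unfolding z by (rule flux_RT_N[OF min])
    note z_affine = RT_affine[OF RT_N_RT[OF mem]]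
    show "pw_eq \<T> (div_h \<T> z) (\<lambda>x. \<alpha> * (L2_proj \<Omega> \<T> u x - g\<^sub>h x))"
      unfolding pw_eq_def
    proof (intro ballI)
      fix T x assume T: "T \<in> \<T>" and x: "x \<in> interior T"
      have "div_h \<T> z x = div_h \<T> z (bc T)"
        by (rule RT_element(1)[OF z_affine T x])
      then show "div_h \<T> z x = \<alpha> * (L2_proj \<Omega> \<T> u x - g\<^sub>h x)"
        unfolding pw_poly_1_element(4)[OF pw T x] g_const[OF T x]
        unfolding z by (rule trans[OF _ flux_affine(3)[OF pw T]])
    qed
    show "pw_eq \<T> (L2_proj \<Omega> \<T> z) (\<lambda>x. f_reg_quot (\<epsilon>\<^sub>h x) (norm (grad_h \<T> u x)) *\<^sub>R grad_h \<T> u x)"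
      unfolding pw_eq_def
    proof (intro ballI)
      fix T x assume T: "T \<in> \<T>" and x: "x \<in> interior T"
      have "L2_proj \<Omega> \<T> z x = z (bc T)"
        by (rule RT_element(4)[OF z_affine T x])
      then show "L2_proj \<Omega> \<T> z x = f_reg_quot (\<epsilon>\<^sub>h x) (norm (grad_h \<T> u x)) *\<^sub>R grad_h \<T> u x"
        unfolding pw_poly_1_element(1)[OF pw T x] \<epsilon>_const[OF T x]
        unfolding z by (rule trans[OF _ flux_affine(2)[OF pw T]])
    qed
    show eq: "ereal (I_cr \<Omega> \<T> \<epsilon>\<^sub>h \<alpha> g\<^sub>h u) = D_rt \<Omega> \<T> \<epsilon>\<^sub>h \<alpha> g\<^sub>h z"
      unfolding z by (rule strong_duality[OF min])
    show "is_arg_max (D_rt \<Omega> \<T> \<epsilon>\<^sub>h \<alpha> g\<^sub>h) (\<lambda>y. y \<in> RT_N \<Omega> \<T>) z"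
      \<comment> \<open>The value at \<open>z\<close> is the primal value at \<open>u\<close>, which
        by weak duality bounds the dual functional on every admissible field.\<close>
      unfolding is_arg_max_def eq[symmetric] using mem weak_duality[OF u] by (auto simp: not_less)
  qed
qed

end
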